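(* Let $E,A\in\mathbb{R}^{n\times n}$, $P(s)=sE-A$, and $P'(s)=sA-E$. Assume that $P$ is regular. Then $P$ is dissipative Hamiltonian if and only if all of the following hold: (i) $\operatorname{Re}\lambda\le0$ for each eigenvalue $\lambda\in\mathbb{C}$ of $P$; (ii) non-zero purely imaginary eigenvalues of $P$ are semi-simple; (iii) the index of $P$ is at most two; (iv) the index of $P'$ is at most two.
   Context: A pencil $P(s)=sE-A$ with $E,A\in\mathbb{R}^{n\times n}$ is regular if $P(\mu)$ is invertible for some $\mu\in\mathbb{C}$. It is dissipative Hamiltonian if $A=(J-R)Q$ for some $J,R,Q\in\mathbb{R}^{n\times n}$ with $J=-J^\top$, $R=R^\top\ge0$, $Q^\top E=E^\top Q\ge0$. $\lambda\in\mathbb{C}$ is an eigenvalue of $P$ if $P(\lambda)x=0$ for some $x\ne0$; $\lambda=\infty$ is an eigenvalue if $Ex=0$ for some $x\ne0$. A chain of $P$ at the eigenvalue $\lambda$ of length $k+1$ is a tuple $(x_0,\dots,x_k)$ of non-zero vectors in $\mathbb{C}^n$ with, for $\lambda\in\mathbb{C}$: $(A-\lambda E)x_0=0$, $(A-\lambda E)x_j=Ex_{j-1}$ ($j=1,\dots,k$); for $\lambda=\infty$: $Ex_0=0$, $Ex_j=Ax_{j-1}$ ($j=1,\dots,k$). An eigenvalue is semi-simple if there are no chains of length greater than one at it. The index of $P$ is the maximal length of chains at $\lambda=\infty$ ($0$ if $\infty$ is not an eigenvalue); the same definitions apply to $P'$ (with the roles of $E$ and $A$ exchanged). *)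

theory Defs
  imports "Jordan_Normal_Form.Matrix" "HOL-Library.Extended_Nat" Complex_Main
begin

text \<open>
  The pencil \<open>s E - A\<close> with real square coefficients of size \<open>n\<close> is represented by the
  triple \<open>n\<close>, \<open>E\<close>, \<open>A\<close>, so that the reversed pencil \<open>s A - E\<close> is the triple \<open>n\<close>, \<open>A\<close>, \<open>E\<close>.
\<close>

abbreviation complex_mat :: "real mat \<Rightarrow> complex mat" where
  "complex_mat \<equiv> map_mat complex_of_real"

definition pencil_at :: "real mat \<Rightarrow> real mat \<Rightarrow> complex \<Rightarrow> complex mat" where
  "pencil_at E A s = s \<cdot>\<^sub>m complex_mat E - complex_mat A"

definition regular_pencil :: "real mat \<Rightarrow> real mat \<Rightarrow> bool" where
  "regular_pencil E A \<longleftrightarrow> (\<exists>\<mu>. invertible_mat (pencil_at E A \<mu>))"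

definition real_psd :: "nat \<Rightarrow> real mat \<Rightarrow> bool" where
  "real_psd n M \<longleftrightarrow> M \<in> carrier_mat n n \<and> M\<^sup>T = M \<and>
     (\<forall>x \<in> carrier_vec n. 0 \<le> x \<bullet> (M *\<^sub>v x))"

definition dissipative_Hamiltonian :: "nat \<Rightarrow> real mat \<Rightarrow> real mat \<Rightarrow> bool" where
  "dissipative_Hamiltonian n E A \<longleftrightarrow>
     (\<exists>J \<in> carrier_mat n n. \<exists>R \<in> carrier_mat n n. \<exists>Q \<in> carrier_mat n n.
        A = (J - R) * Q \<and> J = - J\<^sup>T \<and> real_psd n R \<and>
        Q\<^sup>T * E = E\<^sup>T * Q \<and> real_psd n (Q\<^sup>T * E))"

definition pencil_eigenvalue :: "nat \<Rightarrow> real mat \<Rightarrow> real mat \<Rightarrow> complex \<Rightarrow> bool" where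
  "pencil_eigenvalue n E A lam \<longleftrightarrow>
     (\<exists>x \<in> carrier_vec n. x \<noteq> 0\<^sub>v n \<and> pencil_at E A lam *\<^sub>v x = 0\<^sub>v n)"

definition pencil_eigenvalue_inf :: "nat \<Rightarrow> real mat \<Rightarrow> bool" where
  "pencil_eigenvalue_inf n E \<longleftrightarrow>
     (\<exists>x \<in> carrier_vec n. x \<noteq> 0\<^sub>v n \<and> complex_mat E *\<^sub>v x = 0\<^sub>v n)"

text \<open>
  A chain \<open>(x\<^sub>0, \<dots>, x\<^sub>k)\<close> is a non-empty list, whose length is \<open>k + 1\<close>.
\<close>

definition pencil_chain ::
  "nat \<Rightarrow> real mat \<Rightarrow> real mat \<Rightarrow> complex \<Rightarrow> complex vec list \<Rightarrow> bool" where
  "pencil_chain n E A lam xs \<longleftrightarrow>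
     xs \<noteq> [] \<and> (\<forall>x \<in> set xs. x \<in> carrier_vec n \<and> x \<noteq> 0\<^sub>v n) \<and>
     (complex_mat A - lam \<cdot>\<^sub>m complex_mat E) *\<^sub>v (xs ! 0) = 0\<^sub>v n \<and>
     (\<forall>j. 1 \<le> j \<and> j < length xs \<longrightarrow>
        (complex_mat A - lam \<cdot>\<^sub>m complex_mat E) *\<^sub>v (xs ! j) = complex_mat E *\<^sub>v (xs ! (j - 1)))"

definition pencil_chain_inf ::
  "nat \<Rightarrow> real mat \<Rightarrow> real mat \<Rightarrow> complex vec list \<Rightarrow> bool" where
  "pencil_chain_inf n E A xs \<longleftrightarrow>
     xs \<noteq> [] \<and> (\<forall>x \<in> set xs. x \<in> carrier_vec n \<and> x \<noteq> 0\<^sub>v n) \<and>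
     complex_mat E *\<^sub>v (xs ! 0) = 0\<^sub>v n \<and>
     (\<forall>j. 1 \<le> j \<and> j < length xs \<longrightarrow>
        complex_mat E *\<^sub>v (xs ! j) = complex_mat A *\<^sub>v (xs ! (j - 1)))"

definition semisimple_at :: "nat \<Rightarrow> real mat \<Rightarrow> real mat \<Rightarrow> complex \<Rightarrow> bool" where
  "semisimple_at n E A lam \<longleftrightarrow> \<not> (\<exists>xs. pencil_chain n E A lam xs \<and> length xs > 1)"

text \<open>
  The index is the maximal chain length at infinity.  It takes values in \<^typ>\<open>enat\<close> because
  the lengths can be unbounded for a singular pencil, where a supremum of naturals would be
  unspecified.
\<close>

definition pencil_index :: "nat \<Rightarrow> real mat \<Rightarrow> real mat \<Rightarrow> enat" where
  "pencil_index n E A =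
     (if pencil_eigenvalue_inf n E
      then Sup {enat (length xs) | xs. pencil_chain_inf n E A xs} else 0)"

end

theory Submission
  imports Defs "Jordan_Normal_Form.Schur_Decomposition"
begin

text \<open>
  Necessity: along a chain, the real part of \<open>(A u, Q u)\<close> is \<open>- (Q u)\<^sup>* R (Q u)\<close>, so whenever it vanishes
  \<open>R\<close> kills \<open>Q u\<close>, and \<open>A\<close> acts there like a skew-symmetric matrix; together with the symmetry of
  \<open>Q\<^sup>T E\<close> this forces \<open>E\<^sup>T Q u = A\<^sup>T Q u = 0\<close>, hence \<open>Q u = 0\<close> by regularity.

  Sufficiency: by (i) the matrix \<open>W = E - A\<close> is invertible, and with the Cayley transform
  \<open>V = W\<^sup>-\<^sup>1 (E + A)\<close> the pencil becomes \<open>E = W (V + 1) / 2\<close>, \<open>A = W (V - 1) / 2\<close>. The hypotheses say that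
  the spectrum of \<open>V\<close> lies in the closed unit disc, with Jordan blocks of size at most two at 1 and -1
  and of size one elsewhere on the circle. Put \<open>W\<^sup>T Q = X (V + 1) + Y\<close>. The matrix \<open>X\<close> is positive
  semidefinite with \<open>V\<^sup>T X V \<le> X\<close>: it is a sum of squared norms of \<open>p(V) x\<close>, one for each unimodular
  eigenvalue except -1, and of a Lyapunov form on the stable part. The matrix \<open>Y\<close> handles the
  eigenvalue -1, where \<open>V + 1\<close> is nilpotent. Then \<open>Q\<^sup>T E\<close> is symmetric and positive semidefinite,
  \<open>x\<^sup>T Q\<^sup>T A x \<le> 0\<close>, and the kernel of \<open>Q\<close> is contained in that of \<open>A\<close>; a generalized inverse of \<open>Q\<close>
  yields \<open>J - R\<close>.
\<close>

subsection \<open>Complex inner products and semidefinite matrices\<close>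

text \<open>The Cayley transform moves 0 and infinity to 1 and -1, so that both become ordinary
  eigenvalues of one matrix. The shape of \<open>Q\<close> comes from the two forms to be
  controlled: \<open>W\<^sup>T Q = X (V + 1)\<close> gives
  \<open>2 Q\<^sup>T E = (V + 1)\<^sup>T X (V + 1)\<close>, while
  \<open>2 Q\<^sup>T A = (V + 1)\<^sup>T X (V - 1)\<close> has symmetric part
  \<open>V\<^sup>T X V - X\<close>, so the inequality for \<open>X\<close> is exactly dissipativity.
  The obstacle is definiteness: a Jordan block of size two on the unit circle admits no definite
  solution of that inequality, so \<open>X\<close> has to degenerate at 1 and -1. At 1 this is
  harmless, because on the generalized eigenspace only the kernel of \<open>V - 1\<close> is lost,
  and \<open>A\<close> vanishes there. At -1 it is fatal: \<open>X (V + 1)\<close> vanishes on the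
  kernel of \<open>V + 1\<close>, where \<open>A\<close> is injective, so no choice of
  \<open>X\<close> alone puts the kernel of \<open>Q\<close> inside that of
  \<open>A\<close>.\<close>

lemma cip_commute:
  fixes x y :: "complex vec"
  assumes "x \<in> carrier_vec n" "y \<in> carrier_vec n"
  shows "y \<bullet>c x = cnj (x \<bullet>c y)"
  using assms by (simp add: scalar_prod_def mult.commute)

lemma cip_smult:
  fixes x y :: "complex vec"
  assumes "x \<in> carrier_vec n" "y \<in> carrier_vec n"
  shows "(c \<cdot>\<^sub>v x) \<bullet>c y = c * (x \<bullet>c y)" "x \<bullet>c (c \<cdot>\<^sub>v y) = cnj c * (x \<bullet>c y)"
  using assms by (simp_all add: conjugate_smult_vec)

lemma cip_add:
  fixes x y z :: "complex vec"
  assumes "x \<in> carrier_vec n" "y \<in> carrier_vec n" "z \<in> carrier_vec n"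
  shows "(x + y) \<bullet>c z = x \<bullet>c z + y \<bullet>c z" "z \<bullet>c (x + y) = z \<bullet>c x + z \<bullet>c y"
  using assms by (simp_all add: conjugate_add_vec[where n = n] add_scalar_prod_distrib[where n = n]
      scalar_prod_add_distrib[where n = n])

lemma cip_adjoint:
  assumes M: "M \<in> carrier_mat m n" and x: "x \<in> carrier_vec n" and y: "y \<in> carrier_vec m"
  shows "(M *\<^sub>v x) \<bullet>c y = x \<bullet>c ((map_mat cnj M)\<^sup>T *\<^sub>v y)"
proof -
  have eq: "conjugate ((map_mat cnj M)\<^sup>T *\<^sub>v y) = M\<^sup>T *\<^sub>v conjugate y"
    using M y by (intro eq_vecI) (auto simp: scalar_prod_def)
  have "(M *\<^sub>v x) \<bullet>c y = conjugate y \<bullet> (M *\<^sub>v x)"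
    using M x y by (intro comm_scalar_prod[of _ m]) auto
  also have "\<dots> = (M\<^sup>T *\<^sub>v conjugate y) \<bullet> x"
    using transpose_vec_mult_scalar[OF M x, of "conjugate y"] y by simp
  also have "\<dots> = x \<bullet>c ((map_mat cnj M)\<^sup>T *\<^sub>v y)"
    unfolding eq[symmetric] using M x y by (intro comm_scalar_prod[of _ n]) auto
  finally show ?thesis .
qed

lemma complex_mat_adjoint:
  assumes "M \<in> carrier_mat m n" "x \<in> carrier_vec n" "y \<in> carrier_vec m"
  shows "(complex_mat M *\<^sub>v x) \<bullet>c y = x \<bullet>c (complex_mat M\<^sup>T *\<^sub>v y)"
proof -
  have "(map_mat cnj (complex_mat M))\<^sup>T = complex_mat M\<^sup>T" by (intro eq_matI) auto
  then show ?thesis using cip_adjoint[of "complex_mat M" m n x y] assms by simp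
qed

section \<open>Real and imaginary parts; semidefinite matrices on complex vectors\<close>

definition Re_vec :: "complex vec \<Rightarrow> real vec" where "Re_vec = map_vec Re"
definition Im_vec :: "complex vec \<Rightarrow> real vec" where "Im_vec = map_vec Im"

lemma Re_Im_vec_carrier [simp]:
  "Re_vec x \<in> carrier_vec n \<longleftrightarrow> x \<in> carrier_vec n" "Im_vec x \<in> carrier_vec n \<longleftrightarrow> x \<in> carrier_vec n"
  by (auto simp: Re_vec_def Im_vec_def)

lemma Re_Im_vec_mult:
  assumes "M \<in> carrier_mat m n" "x \<in> carrier_vec n"
  shows "Re_vec (complex_mat M *\<^sub>v x) = M *\<^sub>v Re_vec x" "Im_vec (complex_mat M *\<^sub>v x) = M *\<^sub>v Im_vec x"
  using assms by (auto simp: Re_vec_def Im_vec_def scalar_prod_def intro!: eq_vecI sum.cong)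

lemma Re_cip:
  assumes "x \<in> carrier_vec n" "y \<in> carrier_vec n"
  shows "Re (x \<bullet>c y) = Re_vec x \<bullet> Re_vec y + Im_vec x \<bullet> Im_vec y"
proof -
  have "Re (x \<bullet>c y) = (\<Sum>i = 0..<n. Re (x $ i) * Re (y $ i) + Im (x $ i) * Im (y $ i))"
    using assms by (auto simp: scalar_prod_def intro!: sum.cong)
  then show ?thesis
    using assms by (simp add: Re_vec_def Im_vec_def scalar_prod_def sum.distrib)
qed

lemma vec_eq_0_iff_Re_Im:
  assumes "x \<in> carrier_vec n"
  shows "x = 0\<^sub>v n \<longleftrightarrow> Re_vec x = 0\<^sub>v n \<and> Im_vec x = 0\<^sub>v n"
  using assms by (auto simp: Re_vec_def Im_vec_def vec_eq_iff complex_eq_iff)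

lemma real_psd_sym:
  assumes "real_psd n M" "x \<in> carrier_vec n" "y \<in> carrier_vec n"
  shows "x \<bullet> (M *\<^sub>v y) = y \<bullet> (M *\<^sub>v x)"
proof -
  have M: "M \<in> carrier_mat n n" "M\<^sup>T = M" using assms by (auto simp: real_psd_def)
  have "x \<bullet> (M *\<^sub>v y) = (M\<^sup>T *\<^sub>v x) \<bullet> y"
    using transpose_vec_mult_scalar[OF M(1) assms(3,2)] by simp
  then show ?thesis using M assms by (simp add: comm_scalar_prod[of _ n])
qed

text \<open>Moving from \<open>x\<close> by \<open>- t M x\<close> gives the form the value
  \<open>t\<^sup>2 b - 2 t a\<close>, where \<open>a\<close> is the squared length of
  \<open>M x\<close>. If \<open>a > 0\<close>, this is negative at \<open>t = 1\<close> when
  \<open>b \<le> 0\<close>, and otherwise at its minimum \<open>t = a / b\<close>.\<close>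

lemma real_psd_null:
  assumes psd: "real_psd n M" and x: "x \<in> carrier_vec n" and 0: "x \<bullet> (M *\<^sub>v x) = 0"
  shows "M *\<^sub>v x = 0\<^sub>v n"
proof -
  have M: "M \<in> carrier_mat n n" using psd by (auto simp: real_psd_def)
  define y where "y = M *\<^sub>v x"
  define a where "a = y \<bullet> y"
  define b where "b = y \<bullet> (M *\<^sub>v y)"
  have y: "y \<in> carrier_vec n" unfolding y_def using M x by simp
  have xy: "x \<bullet> (M *\<^sub>v y) = a"
    using real_psd_sym[OF psd x y] by (simp add: a_def y_def)
  have ge: "0 \<le> t\<^sup>2 * b - 2 * t * a" for t
  proof -
    have c: "x - t \<cdot>\<^sub>v y \<in> carrier_vec n" using x y by simp
    have "0 \<le> (x - t \<cdot>\<^sub>v y) \<bullet> (M *\<^sub>v (x - t \<cdot>\<^sub>v y))" using psd c by (auto simp: real_psd_def)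
    also have "M *\<^sub>v (x - t \<cdot>\<^sub>v y) = y - t \<cdot>\<^sub>v (M *\<^sub>v y)"
      using M x y by (simp add: y_def mult_minus_distrib_mat_vec[of M n n] mult_mat_vec[of M n n])
    also have "(x - t \<cdot>\<^sub>v y) \<bullet> (y - t \<cdot>\<^sub>v (M *\<^sub>v y)) = x \<bullet> y - t * a - t * (y \<bullet> y) + t\<^sup>2 * b"
      using M x y xy
      by (simp add: minus_scalar_prod_distrib[of _ n] scalar_prod_minus_distrib[of _ n] b_def
          power2_eq_square algebra_simps)
    also have "x \<bullet> y = 0" using 0 by (simp add: y_def)
    finally show ?thesis by (simp add: a_def)
  qed
  have a0: "a \<ge> 0" unfolding a_def using conjugate_square_ge_0_vec[of y] by simp
  have "a = 0"
  proof (rule ccontr)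
    assume "a \<noteq> 0"
    then have a: "a > 0" using a0 by simp
    show False
    proof (cases "b \<le> 0")
      case True
      then show False using ge[of 1] a by simp
    next
      case False
      then show False using ge[of "a / b"] mult_pos_pos[OF a a] by (simp add: power2_eq_square field_simps)
    qed
  qed
  then show ?thesis
    using conjugate_square_eq_0_vec[OF y] by (simp add: a_def y_def)
qed

text \<open>A real symmetric form sees real and imaginary parts separately: the real part of its
  value at \<open>x\<close> is the sum of its values at \<open>Re_vec x\<close> and
  \<open>Im_vec x\<close>, both nonnegative.\<close>

lemma real_psd_cip:
  assumes psd: "real_psd n M" and x: "x \<in> carrier_vec n"
  shows "Re (x \<bullet>c (complex_mat M *\<^sub>v x)) \<ge> 0"
    and "Re (x \<bullet>c (complex_mat M *\<^sub>v x)) = 0 \<Longrightarrow> complex_mat M *\<^sub>v x = 0\<^sub>v n"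
proof -
  have M: "M \<in> carrier_mat n n" using psd by (auto simp: real_psd_def)
  have cx: "complex_mat M *\<^sub>v x \<in> carrier_vec n" using M x by simp
  have eq: "Re (x \<bullet>c (complex_mat M *\<^sub>v x)) =
      Re_vec x \<bullet> (M *\<^sub>v Re_vec x) + Im_vec x \<bullet> (M *\<^sub>v Im_vec x)"
    using Re_cip[OF x cx] Re_Im_vec_mult[OF M x] by simp
  have nn: "Re_vec x \<bullet> (M *\<^sub>v Re_vec x) \<ge> 0" "Im_vec x \<bullet> (M *\<^sub>v Im_vec x) \<ge> 0"
    using psd x by (auto simp: real_psd_def)
  then show "Re (x \<bullet>c (complex_mat M *\<^sub>v x)) \<ge> 0" using eq by simp
  assume "Re (x \<bullet>c (complex_mat M *\<^sub>v x)) = 0"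
  then have "Re_vec x \<bullet> (M *\<^sub>v Re_vec x) = 0" "Im_vec x \<bullet> (M *\<^sub>v Im_vec x) = 0" using eq nn by auto
  then have "M *\<^sub>v Re_vec x = 0\<^sub>v n" "M *\<^sub>v Im_vec x = 0\<^sub>v n"
    using real_psd_null[OF psd] x by auto
  then show "complex_mat M *\<^sub>v x = 0\<^sub>v n"
    using vec_eq_0_iff_Re_Im[OF cx] Re_Im_vec_mult[OF M x] by simp
qed

subsection \<open>Necessity\<close>

text \<open>The necessity argument runs on these sesquilinear facts, from which \<open>J\<close> and
  \<open>R\<close> have disappeared. The energy of \<open>u\<close> is \<open>(E u, Q u)\<close>,
  and its dissipation is minus the real part of \<open>(A u, Q u)\<close>. The axioms
  \<open>energy_0\<close> and \<open>dissipation_0\<close> express that a semidefinite matrix kills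
  a vector on which its form vanishes; in the second case that matrix is \<open>R\<close>, and what
  remains of \<open>A\<close> is skew.\<close>

locale dissipative_forms =
  fixes n :: nat and E A Q :: "complex mat"
  assumes carr: "E \<in> carrier_mat n n" "A \<in> carrier_mat n n" "Q \<in> carrier_mat n n"
    and sym: "\<And>u w. u \<in> carrier_vec n \<Longrightarrow> w \<in> carrier_vec n \<Longrightarrow>
      (E *\<^sub>v u) \<bullet>c (Q *\<^sub>v w) = (Q *\<^sub>v u) \<bullet>c (E *\<^sub>v w)"
    and energy_nonneg: "\<And>u. u \<in> carrier_vec n \<Longrightarrow> Re ((E *\<^sub>v u) \<bullet>c (Q *\<^sub>v u)) \<ge> 0"
    and energy_0: "\<And>u w. u \<in> carrier_vec n \<Longrightarrow> w \<in> carrier_vec n \<Longrightarrow>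
      Re ((E *\<^sub>v u) \<bullet>c (Q *\<^sub>v u)) = 0 \<Longrightarrow> (E *\<^sub>v w) \<bullet>c (Q *\<^sub>v u) = 0"
    and dissipation_nonpos: "\<And>u. u \<in> carrier_vec n \<Longrightarrow> Re ((A *\<^sub>v u) \<bullet>c (Q *\<^sub>v u)) \<le> 0"
    and dissipation_0: "\<And>u w. u \<in> carrier_vec n \<Longrightarrow> w \<in> carrier_vec n \<Longrightarrow>
      Re ((A *\<^sub>v u) \<bullet>c (Q *\<^sub>v u)) = 0 \<Longrightarrow> (A *\<^sub>v w) \<bullet>c (Q *\<^sub>v u) = - ((Q *\<^sub>v w) \<bullet>c (A *\<^sub>v u))"
    and left_regular: "\<And>y. y \<in> carrier_vec n \<Longrightarrow>
      (\<And>w. w \<in> carrier_vec n \<Longrightarrow> (E *\<^sub>v w) \<bullet>c y = 0) \<Longrightarrow>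
      (\<And>w. w \<in> carrier_vec n \<Longrightarrow> (A *\<^sub>v w) \<bullet>c y = 0) \<Longrightarrow> y = 0\<^sub>v n"
    and kernel: "\<And>u. u \<in> carrier_vec n \<Longrightarrow> Q *\<^sub>v u = 0\<^sub>v n \<Longrightarrow> A *\<^sub>v u = 0\<^sub>v n"
    and right_regular: "\<And>u. u \<in> carrier_vec n \<Longrightarrow> E *\<^sub>v u = 0\<^sub>v n \<Longrightarrow> A *\<^sub>v u = 0\<^sub>v n \<Longrightarrow> u = 0\<^sub>v n"
begin

lemma carrier_mult [simp]:
  assumes "u \<in> carrier_vec n"
  shows "E *\<^sub>v u \<in> carrier_vec n" "A *\<^sub>v u \<in> carrier_vec n" "Q *\<^sub>v u \<in> carrier_vec n"
  using carr assms by auto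

text \<open>\<open>energy_0\<close> makes \<open>Q u\<close> orthogonal to the range of
  \<open>E\<close>; \<open>dissipation_0\<close> together with \<open>orth\<close> makes it
  orthogonal to the range of \<open>A\<close>. Every contradiction in this locale is reached through
  this lemma.\<close>

lemma Q_eq_0:
  assumes u: "u \<in> carrier_vec n"
    and energy: "(E *\<^sub>v u) \<bullet>c (Q *\<^sub>v u) = 0" and dissipation: "Re ((A *\<^sub>v u) \<bullet>c (Q *\<^sub>v u)) = 0"
    and orth: "\<And>w. w \<in> carrier_vec n \<Longrightarrow> (Q *\<^sub>v w) \<bullet>c (A *\<^sub>v u) = 0"
  shows "Q *\<^sub>v u = 0\<^sub>v n" "A *\<^sub>v u = 0\<^sub>v n"
proof -
  show "Q *\<^sub>v u = 0\<^sub>v n"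
    using left_regular[of "Q *\<^sub>v u"] energy_0[OF u] dissipation_0[OF u] assms by simp
  then show "A *\<^sub>v u = 0\<^sub>v n" using kernel u by simp
qed

text \<open>For an eigenvector \<open>A u\<close> is a multiple of \<open>E u\<close>, so vanishing
  energy already yields the other two hypotheses of \<open>Q_eq_0\<close>.\<close>

lemma eigen_energy_0:
  assumes u: "u \<in> carrier_vec n" and eig: "A *\<^sub>v u = l \<cdot>\<^sub>v (E *\<^sub>v u)"
    and energy: "(E *\<^sub>v u) \<bullet>c (Q *\<^sub>v u) = 0"
  shows "A *\<^sub>v u = 0\<^sub>v n"
proof (rule Q_eq_0[OF u energy])
  show "Re ((A *\<^sub>v u) \<bullet>c (Q *\<^sub>v u)) = 0"
    using energy u by (simp add: eig cip_smult[of _ n])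
  show "(Q *\<^sub>v w) \<bullet>c (A *\<^sub>v u) = 0" if w: "w \<in> carrier_vec n" for w
  proof -
    have "(Q *\<^sub>v w) \<bullet>c (A *\<^sub>v u) = cnj l * ((Q *\<^sub>v w) \<bullet>c (E *\<^sub>v u))"
      using u w by (simp add: eig cip_smult[of _ n])
    also have "(Q *\<^sub>v w) \<bullet>c (E *\<^sub>v u) = (E *\<^sub>v w) \<bullet>c (Q *\<^sub>v u)" using sym[OF w u] by simp
    also have "\<dots> = 0" using energy_0[OF u w] energy by simp
    finally show ?thesis by simp
  qed
qed

lemma energy_real:
  assumes u: "u \<in> carrier_vec n"
  shows "Im ((E *\<^sub>v u) \<bullet>c (Q *\<^sub>v u)) = 0"
proof -
  have "(E *\<^sub>v u) \<bullet>c (Q *\<^sub>v u) = cnj ((E *\<^sub>v u) \<bullet>c (Q *\<^sub>v u))"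
    using sym[OF u u] cip_commute[of "E *\<^sub>v u" n "Q *\<^sub>v u"] u by simp
  then show ?thesis by (simp add: complex_eq_iff)
qed

text \<open>If the energy vanished, then \<open>A u = 0\<close>, and for \<open>l \<noteq> 0\<close>
  also \<open>E u = 0\<close>, against \<open>right_regular\<close>.\<close>

lemma eigen_nonzero_energy:
  assumes u: "u \<in> carrier_vec n" "u \<noteq> 0\<^sub>v n" and eig: "A *\<^sub>v u = l \<cdot>\<^sub>v (E *\<^sub>v u)" and l: "l \<noteq> 0"
  shows "Re ((E *\<^sub>v u) \<bullet>c (Q *\<^sub>v u)) > 0"
proof (rule ccontr)
  assume "\<not> ?thesis"
  then have "(E *\<^sub>v u) \<bullet>c (Q *\<^sub>v u) = 0"
    using energy_nonneg[OF u(1)] energy_real[OF u(1)] by (simp add: complex_eq_iff)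
  then have A0: "A *\<^sub>v u = 0\<^sub>v n" using eigen_energy_0 u eig by blast
  have "E *\<^sub>v u = (1 / l) \<cdot>\<^sub>v (l \<cdot>\<^sub>v (E *\<^sub>v u))" using l by (simp add: smult_smult_assoc)
  also have "\<dots> = 0\<^sub>v n" using A0 eig by auto
  finally show False using right_regular A0 u by blast
qed

lemma eigen_Re_nonpos:
  assumes u: "u \<in> carrier_vec n" "u \<noteq> 0\<^sub>v n" and eig: "A *\<^sub>v u = l \<cdot>\<^sub>v (E *\<^sub>v u)"
  shows "Re l \<le> 0"
proof (cases "l = 0")
  case False
  have "Re ((A *\<^sub>v u) \<bullet>c (Q *\<^sub>v u)) = Re l * Re ((E *\<^sub>v u) \<bullet>c (Q *\<^sub>v u))"
    using u energy_real[of u] by (simp add: eig cip_smult[of _ n])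
  then show ?thesis
    using dissipation_nonpos[OF u(1)] eigen_nonzero_energy[OF u eig False]
    by (metis mult_le_0_iff not_less)
qed auto

text \<open>At an imaginary eigenvalue \<open>u\<close> has no dissipation, so \<open>A\<close> is
  skew against \<open>Q u\<close>. Pairing the chain equation with \<open>Q u\<close> then cancels
  the terms in \<open>l\<close> and leaves the energy of \<open>u\<close> equal to zero.\<close>

lemma imaginary_no_chain:
  assumes u: "u \<in> carrier_vec n" "u \<noteq> 0\<^sub>v n" and eig: "A *\<^sub>v u = l \<cdot>\<^sub>v (E *\<^sub>v u)"
    and l: "l \<noteq> 0" "Re l = 0"
    and w: "w \<in> carrier_vec n" and chain: "A *\<^sub>v w = l \<cdot>\<^sub>v (E *\<^sub>v w) + E *\<^sub>v u"
  shows False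
proof -
  have cl: "cnj l = - l" using l by (simp add: complex_eq_iff)
  have dis: "Re ((A *\<^sub>v u) \<bullet>c (Q *\<^sub>v u)) = 0"
    using u energy_real[of u] l by (simp add: eig cip_smult[of _ n])
  have "(A *\<^sub>v w) \<bullet>c (Q *\<^sub>v u) = - ((Q *\<^sub>v w) \<bullet>c (A *\<^sub>v u))"
    using dissipation_0[OF u(1) w dis] .
  also have "\<dots> = l * ((E *\<^sub>v w) \<bullet>c (Q *\<^sub>v u))"
    using u w cl sym[OF w u(1)] by (simp add: eig cip_smult[of _ n])
  finally have "(E *\<^sub>v u) \<bullet>c (Q *\<^sub>v u) = 0"
    using u w by (simp add: chain cip_add[of _ n] cip_smult[of _ n])
  then show False using eigen_nonzero_energy[OF u eig l(1)] by simp
qed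

text \<open>Skewness at \<open>x0\<close> equates the energy of \<open>x1\<close> with minus
  \<open>(A x1, Q x0) = (E x2, Q x0)\<close>, which is zero because \<open>x0\<close> has no energy.
  Hence \<open>Q x1\<close> is orthogonal to the range of \<open>E\<close>, which by symmetry is the
  orthogonality that \<open>Q_eq_0\<close> asks of \<open>A x0 = E x1\<close>.\<close>

lemma no_infinite_chain:
  assumes x: "x0 \<in> carrier_vec n" "x1 \<in> carrier_vec n" "x2 \<in> carrier_vec n" "x0 \<noteq> 0\<^sub>v n"
    and chain: "E *\<^sub>v x0 = 0\<^sub>v n" "E *\<^sub>v x1 = A *\<^sub>v x0" "E *\<^sub>v x2 = A *\<^sub>v x1"
  shows False
proof -
  have e0: "(E *\<^sub>v w) \<bullet>c (Q *\<^sub>v x0) = 0" if "w \<in> carrier_vec n" for w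
    using energy_0[OF x(1) that] x chain(1) by simp
  have dis: "Re ((A *\<^sub>v x0) \<bullet>c (Q *\<^sub>v x0)) = 0"
    using e0[OF x(2)] chain by simp
  have flip: "(Q *\<^sub>v w) \<bullet>c (A *\<^sub>v x0) = (E *\<^sub>v w) \<bullet>c (Q *\<^sub>v x1)" if "w \<in> carrier_vec n" for w
    using sym[OF that x(2)] chain by simp
  have "(E *\<^sub>v x1) \<bullet>c (Q *\<^sub>v x1) = 0"
    using dissipation_0[OF x(1,2) dis] e0[OF x(3)] chain(3) flip[OF x(2)] by simp
  then have "(Q *\<^sub>v w) \<bullet>c (A *\<^sub>v x0) = 0" if "w \<in> carrier_vec n" for w
    using energy_0[OF x(2) that] flip[OF that] by simp
  then have "A *\<^sub>v x0 = 0\<^sub>v n"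
    using Q_eq_0[OF x(1)] e0[OF x(1)] dis by blast
  then show False using right_regular x chain by blast
qed

text \<open>\<open>Q_eq_0\<close> is applied twice. Skewness at \<open>x0\<close> makes the energy
  of \<open>x0\<close> vanish, so \<open>Q x0 = 0\<close>; then \<open>E x0 = A x1\<close> is
  orthogonal to the range of \<open>Q\<close>, and the same argument at \<open>x1\<close> gives
  \<open>A x1 = 0\<close>, that is \<open>E x0 = 0\<close>.\<close>

lemma no_zero_chain:
  assumes x: "x0 \<in> carrier_vec n" "x1 \<in> carrier_vec n" "x2 \<in> carrier_vec n" "x0 \<noteq> 0\<^sub>v n"
    and chain: "A *\<^sub>v x0 = 0\<^sub>v n" "A *\<^sub>v x1 = E *\<^sub>v x0" "A *\<^sub>v x2 = E *\<^sub>v x1"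
  shows False
proof -
  have dis0: "Re ((A *\<^sub>v x0) \<bullet>c (Q *\<^sub>v x0)) = 0" using x chain(1) by simp
  have orth0: "(Q *\<^sub>v w) \<bullet>c (A *\<^sub>v x0) = 0" if "w \<in> carrier_vec n" for w using that x chain(1) by simp
  have "(E *\<^sub>v x0) \<bullet>c (Q *\<^sub>v x0) = 0"
    using dissipation_0[OF x(1,2) dis0] orth0[OF x(2)] chain(2) by simp
  then have Q0: "Q *\<^sub>v x0 = 0\<^sub>v n" using Q_eq_0[OF x(1) _ dis0 orth0] by blast
  have orth1: "(Q *\<^sub>v w) \<bullet>c (A *\<^sub>v x1) = 0" if "w \<in> carrier_vec n" for w
    using sym[OF that x(1)] Q0 that by (simp add: chain(2))
  have dis1: "Re ((A *\<^sub>v x1) \<bullet>c (Q *\<^sub>v x1)) = 0"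
    using sym[OF x(1,2)] Q0 x by (simp add: chain(2))
  have "(E *\<^sub>v x1) \<bullet>c (Q *\<^sub>v x1) = 0"
    using dissipation_0[OF x(2,3) dis1] orth1[OF x(3)] chain(3) by simp
  then have "A *\<^sub>v x1 = 0\<^sub>v n" using Q_eq_0[OF x(2) _ dis1 orth1] by blast
  then show False using right_regular x chain by metis
qed

end

section \<open>From real coefficient matrices to the complex forms\<close>

declare minus_carrier_mat [simp]

lemma smult_mat_mult_vec:
  assumes "M \<in> carrier_mat m n" "v \<in> carrier_vec n"
  shows "(c \<cdot>\<^sub>m M) *\<^sub>v v = c \<cdot>\<^sub>v (M *\<^sub>v (v :: 'a :: comm_ring vec))"
  using assms by (intro eq_vecI) auto

lemma uminus_vec_eq_smult: "- v = (- 1) \<cdot>\<^sub>v (v :: 'a :: ring_1 vec)"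
  by (intro eq_vecI) auto

lemma complex_mat_hom:
  "A \<in> carrier_mat m n \<Longrightarrow> B \<in> carrier_mat n k \<Longrightarrow> complex_mat (A * B) = complex_mat A * complex_mat B"
  "A \<in> carrier_mat m n \<Longrightarrow> B \<in> carrier_mat m n \<Longrightarrow> complex_mat (A - B) = complex_mat A - complex_mat B"
  "A \<in> carrier_mat m n \<Longrightarrow> B \<in> carrier_mat m n \<Longrightarrow> complex_mat (A + B) = complex_mat A + complex_mat B"
  "complex_mat (c \<cdot>\<^sub>m A) = complex_of_real c \<cdot>\<^sub>m complex_mat A"
  by (auto simp: scalar_prod_def)

lemma regular_pencil_kernel:
  assumes E: "E \<in> carrier_mat n n" and A: "A \<in> carrier_mat n n" and reg: "regular_pencil E A"
    and y: "y \<in> carrier_vec n"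
  shows "complex_mat E *\<^sub>v y = 0\<^sub>v n \<Longrightarrow> complex_mat A *\<^sub>v y = 0\<^sub>v n \<Longrightarrow> y = 0\<^sub>v n"
    and "complex_mat E\<^sup>T *\<^sub>v y = 0\<^sub>v n \<Longrightarrow> complex_mat A\<^sup>T *\<^sub>v y = 0\<^sub>v n \<Longrightarrow> y = 0\<^sub>v n"
proof -
  obtain s where inv: "invertible_mat (pencil_at E A s)" using reg by (auto simp: regular_pencil_def)
  define P where "P = pencil_at E A s"
  have P: "P \<in> carrier_mat n n" using E A by (simp add: P_def pencil_at_def)
  obtain G where G: "P * G = 1\<^sub>m n" "G * P = 1\<^sub>m (dim_row G)"
    using inv P unfolding P_def[symmetric] invertible_mat_def inverts_mat_def by auto
  \<comment> \<open>Invertibility leaves the size of \<open>G\<close> open; comparing the numbers of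
    columns in both products fixes it.\<close>
  have Gc: "G \<in> carrier_mat n n"
    using arg_cong[OF G(1), of dim_col] arg_cong[OF G(2), of dim_col] P by auto
  have GP: "G * P = 1\<^sub>m n" using G Gc by simp
  show "y = 0\<^sub>v n" if "complex_mat E *\<^sub>v y = 0\<^sub>v n" "complex_mat A *\<^sub>v y = 0\<^sub>v n"
  proof -
    have "P *\<^sub>v y = s \<cdot>\<^sub>v (complex_mat E *\<^sub>v y) - complex_mat A *\<^sub>v y"
      unfolding P_def pencil_at_def using E A y
      by (subst minus_mult_distrib_mat_vec[of _ n n]) (auto simp: smult_mat_mult_vec[of _ n n])
    then have "P *\<^sub>v y = 0\<^sub>v n" using that by auto
    then have "G *\<^sub>v (P *\<^sub>v y) = 0\<^sub>v n" using Gc by auto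
    then show ?thesis using assoc_mult_mat_vec[OF Gc P y] GP y by simp
  qed
  show "y = 0\<^sub>v n" if "complex_mat E\<^sup>T *\<^sub>v y = 0\<^sub>v n" "complex_mat A\<^sup>T *\<^sub>v y = 0\<^sub>v n"
  proof -
    have PT: "P\<^sup>T = s \<cdot>\<^sub>m complex_mat E\<^sup>T - complex_mat A\<^sup>T"
      unfolding P_def pencil_at_def using E A by (intro eq_matI) auto
    have "P\<^sup>T *\<^sub>v y = s \<cdot>\<^sub>v (complex_mat E\<^sup>T *\<^sub>v y) - complex_mat A\<^sup>T *\<^sub>v y"
      unfolding PT using E A y
      by (subst minus_mult_distrib_mat_vec[of _ n n]) (auto simp: smult_mat_mult_vec[of _ n n])
    then have "P\<^sup>T *\<^sub>v y = 0\<^sub>v n" using that by auto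
    then have "G\<^sup>T *\<^sub>v (P\<^sup>T *\<^sub>v y) = 0\<^sub>v n" using Gc by auto
    moreover have "G\<^sup>T * P\<^sup>T = 1\<^sub>m n"
      using transpose_mult[OF P Gc] G by simp
    ultimately show ?thesis
      using assoc_mult_mat_vec[of "G\<^sup>T" n n "P\<^sup>T" n y] Gc P y by simp
  qed
qed

text \<open>Since \<open>J\<close> is skew, its form is purely imaginary, so the real part of
  \<open>(A u, Q u)\<close> is minus the form of \<open>R\<close> at \<open>Q u\<close>; where it
  vanishes, \<open>R Q u = 0\<close> and \<open>A u = J Q u\<close>.\<close>

lemma dissipative_Hamiltonian_forms:
  assumes E: "E \<in> carrier_mat n n" and A: "A \<in> carrier_mat n n" and reg: "regular_pencil E A"
    and dH: "dissipative_Hamiltonian n E A"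
  obtains Q where "dissipative_forms n (complex_mat E) (complex_mat A) (complex_mat Q)"
proof -
  from dH obtain J R Q where J: "J \<in> carrier_mat n n" and R: "R \<in> carrier_mat n n"
    and Q: "Q \<in> carrier_mat n n" and AJRQ: "A = (J - R) * Q" and skew: "J = - J\<^sup>T"
    and Rpsd: "real_psd n R" and QE: "Q\<^sup>T * E = E\<^sup>T * Q" and QEpsd: "real_psd n (Q\<^sup>T * E)"
    unfolding dissipative_Hamiltonian_def by blast
  let ?E = "complex_mat E" let ?A = "complex_mat A" let ?Q = "complex_mat Q"
  let ?J = "complex_mat J" let ?R = "complex_mat R"
  have RT: "R\<^sup>T = R" using Rpsd by (simp add: real_psd_def)
  have JT: "complex_mat J\<^sup>T = - ?J" using J by (subst skew) auto
  have JR: "(complex_mat (J - R)) *\<^sub>v v = ?J *\<^sub>v v - ?R *\<^sub>v v" if "v \<in> carrier_vec n" for v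
    using J R that by (subst complex_mat_hom(2)[OF J R], subst minus_mult_distrib_mat_vec[of _ n n]) auto
  have JRT: "(complex_mat (J - R)\<^sup>T) *\<^sub>v v = - (?J *\<^sub>v v) - ?R *\<^sub>v v" if "v \<in> carrier_vec n" for v
  proof -
    have "(J - R)\<^sup>T = J\<^sup>T - R" using J R RT by (metis transpose_minus)
    then have "(complex_mat (J - R)\<^sup>T) *\<^sub>v v = (complex_mat J\<^sup>T - ?R) *\<^sub>v v"
      using J R complex_mat_hom(2)[of "J\<^sup>T" n n R] by simp
    also have "\<dots> = - (?J *\<^sub>v v) - ?R *\<^sub>v v"
      unfolding JT using J R that by (subst minus_mult_distrib_mat_vec[of _ n n]) auto
    finally show ?thesis .
  qed
  have Amul: "?A *\<^sub>v v = complex_mat (J - R) *\<^sub>v (?Q *\<^sub>v v)" if "v \<in> carrier_vec n" for v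
  proof -
    have "?A = complex_mat (J - R) * ?Q" unfolding AJRQ using J R Q
      by (intro complex_mat_hom(1)[of _ n n _ n]) auto
    then show ?thesis using J R Q that by (simp add: assoc_mult_mat_vec[of _ n n _ n])
  qed
  have QEmul: "complex_mat (Q\<^sup>T * E) *\<^sub>v v = complex_mat Q\<^sup>T *\<^sub>v (?E *\<^sub>v v)" if "v \<in> carrier_vec n" for v
    using E Q that complex_mat_hom(1)[of "Q\<^sup>T" n n E n] by (simp add: assoc_mult_mat_vec[of _ n n _ n])
  have EQmul: "complex_mat (Q\<^sup>T * E) *\<^sub>v v = complex_mat E\<^sup>T *\<^sub>v (?Q *\<^sub>v v)" if "v \<in> carrier_vec n" for v
    unfolding QE
    using E Q that complex_mat_hom(1)[of "E\<^sup>T" n n Q n] by (simp add: assoc_mult_mat_vec[of _ n n _ n])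
  have c [simp]: "?E *\<^sub>v v \<in> carrier_vec n" "?A *\<^sub>v v \<in> carrier_vec n" "?Q *\<^sub>v v \<in> carrier_vec n"
    "?J *\<^sub>v v \<in> carrier_vec n" "?R *\<^sub>v v \<in> carrier_vec n" if "v \<in> carrier_vec n" for v
    using E A Q J R that by auto
  have energy: "(?E *\<^sub>v u) \<bullet>c (?Q *\<^sub>v w) = u \<bullet>c (complex_mat (Q\<^sup>T * E) *\<^sub>v w)"
    if "u \<in> carrier_vec n" "w \<in> carrier_vec n" for u w
    using complex_mat_adjoint[OF E that(1), of "?Q *\<^sub>v w"] that EQmul by simp
  have diss: "(?A *\<^sub>v u) \<bullet>c (?Q *\<^sub>v w) = - ((?Q *\<^sub>v u) \<bullet>c (?J *\<^sub>v (?Q *\<^sub>v w))) - (?Q *\<^sub>v u) \<bullet>c (?R *\<^sub>v (?Q *\<^sub>v w))"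
    if u: "u \<in> carrier_vec n" and w: "w \<in> carrier_vec n" for u w
  proof -
    have "(?A *\<^sub>v u) \<bullet>c (?Q *\<^sub>v w) = (?Q *\<^sub>v u) \<bullet>c (complex_mat (J - R)\<^sup>T *\<^sub>v (?Q *\<^sub>v w))"
      using complex_mat_adjoint[of "J - R" n n "?Q *\<^sub>v u" "?Q *\<^sub>v w"] J R u w Amul by simp
    also have "\<dots> = (?Q *\<^sub>v u) \<bullet>c ((-1) \<cdot>\<^sub>v (?J *\<^sub>v (?Q *\<^sub>v w)) + (-1) \<cdot>\<^sub>v (?R *\<^sub>v (?Q *\<^sub>v w)))"
      using w J R Q
      by (subst JRT) (auto intro!: arg_cong[where f = "\<lambda>v. (?Q *\<^sub>v u) \<bullet>c v"] eq_vecI)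
    also have "\<dots> = - ((?Q *\<^sub>v u) \<bullet>c (?J *\<^sub>v (?Q *\<^sub>v w))) - (?Q *\<^sub>v u) \<bullet>c (?R *\<^sub>v (?Q *\<^sub>v w))"
      using u w by (subst cip_add[of _ n]) (auto simp: cip_smult[of _ n])
    finally show ?thesis .
  qed
  have Jre: "Re (v \<bullet>c (?J *\<^sub>v v)) = 0" if "v \<in> carrier_vec n" for v
  proof -
    have "(?J *\<^sub>v v) \<bullet>c v = v \<bullet>c ((-1) \<cdot>\<^sub>v (?J *\<^sub>v v))"
      using complex_mat_adjoint[OF J that that] J that unfolding JT
      by (simp add: uminus_mult_mat_vec uminus_vec_eq_smult)
    then show ?thesis
      using cip_commute[of "?J *\<^sub>v v" n v] that by (simp add: cip_smult[of _ n] complex_eq_iff)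
  qed
  have Re_diss: "Re ((?A *\<^sub>v u) \<bullet>c (?Q *\<^sub>v u)) = - Re ((?Q *\<^sub>v u) \<bullet>c (?R *\<^sub>v (?Q *\<^sub>v u)))"
    if "u \<in> carrier_vec n" for u
    using diss[OF that that] Jre[of "?Q *\<^sub>v u"] that by simp
  have "dissipative_forms n ?E ?A ?Q"
  proof
    show "?E \<in> carrier_mat n n" "?A \<in> carrier_mat n n" "?Q \<in> carrier_mat n n" using E A Q by auto
    fix u w :: "complex vec" assume u: "u \<in> carrier_vec n"
    show "?Q *\<^sub>v u = 0\<^sub>v n \<Longrightarrow> ?A *\<^sub>v u = 0\<^sub>v n" using Amul[OF u] J R by auto
    show "?E *\<^sub>v u = 0\<^sub>v n \<Longrightarrow> ?A *\<^sub>v u = 0\<^sub>v n \<Longrightarrow> u = 0\<^sub>v n"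
      using regular_pencil_kernel(1)[OF E A reg u] .
    show "Re ((?E *\<^sub>v u) \<bullet>c (?Q *\<^sub>v u)) \<ge> 0"
      using energy[OF u u] real_psd_cip(1)[OF QEpsd u] by simp
    show "Re ((?A *\<^sub>v u) \<bullet>c (?Q *\<^sub>v u)) \<le> 0"
      using Re_diss[OF u] real_psd_cip(1)[OF Rpsd, of "?Q *\<^sub>v u"] u by simp
    assume w: "w \<in> carrier_vec n"
    show "(?E *\<^sub>v u) \<bullet>c (?Q *\<^sub>v w) = (?Q *\<^sub>v u) \<bullet>c (?E *\<^sub>v w)"
      using energy[OF u w] complex_mat_adjoint[OF Q u, of "?E *\<^sub>v w"] QEmul u w by simp
    show "(?E *\<^sub>v w) \<bullet>c (?Q *\<^sub>v u) = 0" if "Re ((?E *\<^sub>v u) \<bullet>c (?Q *\<^sub>v u)) = 0"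
      using energy[OF u u] energy[OF w u] real_psd_cip(2)[OF QEpsd u] that w by simp
    show "(?A *\<^sub>v w) \<bullet>c (?Q *\<^sub>v u) = - ((?Q *\<^sub>v w) \<bullet>c (?A *\<^sub>v u))"
      if "Re ((?A *\<^sub>v u) \<bullet>c (?Q *\<^sub>v u)) = 0"
    proof -
      have R0: "?R *\<^sub>v (?Q *\<^sub>v u) = 0\<^sub>v n"
        using Re_diss[OF u] real_psd_cip(2)[OF Rpsd, of "?Q *\<^sub>v u"] u that by simp
      then have "?A *\<^sub>v u = ?J *\<^sub>v (?Q *\<^sub>v u)" using Amul[OF u] JR[of "?Q *\<^sub>v u"] u by simp
      then show ?thesis using diss[OF w u] R0 w by simp
    qed
  next
    fix y :: "complex vec" assume y: "y \<in> carrier_vec n"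
      and Ey: "\<And>w. w \<in> carrier_vec n \<Longrightarrow> (?E *\<^sub>v w) \<bullet>c y = 0"
      and Ay: "\<And>w. w \<in> carrier_vec n \<Longrightarrow> (?A *\<^sub>v w) \<bullet>c y = 0"
    \<comment> \<open>Testing the orthogonality with \<open>w = M\<^sup>T y\<close> produces the
      squared norm of \<open>M\<^sup>T y\<close>.\<close>
    have "complex_mat M\<^sup>T *\<^sub>v y = 0\<^sub>v n"
      if M: "M \<in> carrier_mat n n" and 0: "\<And>w. w \<in> carrier_vec n \<Longrightarrow> (complex_mat M *\<^sub>v w) \<bullet>c y = 0" for M
    proof -
      have v: "complex_mat M\<^sup>T *\<^sub>v y \<in> carrier_vec n" using M y by simp
      have "(complex_mat M\<^sup>T *\<^sub>v y) \<bullet>c (complex_mat M\<^sup>T *\<^sub>v y) = 0"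
        using complex_mat_adjoint[OF M v y] 0[OF v] by simp
      then show ?thesis using conjugate_square_eq_0_vec[OF v] by simp
    qed
    then show "y = 0\<^sub>v n" using regular_pencil_kernel(2)[OF E A reg y] E A Ey Ay by blast
  qed
  then show ?thesis using that by blast
qed

section \<open>Spectral conditions in terms of chains of length two and three\<close>

lemma pencil_at_mult:
  assumes "E \<in> carrier_mat n n" "A \<in> carrier_mat n n" "x \<in> carrier_vec n"
  shows "pencil_at E A l *\<^sub>v x = l \<cdot>\<^sub>v (complex_mat E *\<^sub>v x) - complex_mat A *\<^sub>v x"
    and "(complex_mat A - l \<cdot>\<^sub>m complex_mat E) *\<^sub>v x = complex_mat A *\<^sub>v x - l \<cdot>\<^sub>v (complex_mat E *\<^sub>v x)"
  using assms unfolding pencil_at_def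
  by (subst minus_mult_distrib_mat_vec[of _ n n]; auto simp: smult_mat_mult_vec[of _ n n])+

lemma vec_minus_eq_0_iff:
  assumes "x \<in> carrier_vec n" "y \<in> carrier_vec n"
  shows "x - y = 0\<^sub>v n \<longleftrightarrow> (x :: 'a :: ab_group_add vec) = y"
  using assms by (auto simp: vec_eq_iff)

lemma vec_minus_eq_iff:
  assumes "x \<in> carrier_vec n" "y \<in> carrier_vec n" "z \<in> carrier_vec n"
  shows "x - y = z \<longleftrightarrow> (x :: 'a :: ab_group_add vec) = y + z"
  using assms by (auto simp: vec_eq_iff algebra_simps)

lemma pencil_eigenvalue_iff:
  assumes "E \<in> carrier_mat n n" "A \<in> carrier_mat n n"
  shows "pencil_eigenvalue n E A l \<longleftrightarrow>
    (\<exists>x \<in> carrier_vec n. x \<noteq> 0\<^sub>v n \<and> complex_mat A *\<^sub>v x = l \<cdot>\<^sub>v (complex_mat E *\<^sub>v x))"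
proof -
  have "pencil_at E A l *\<^sub>v x = 0\<^sub>v n \<longleftrightarrow> complex_mat A *\<^sub>v x = l \<cdot>\<^sub>v (complex_mat E *\<^sub>v x)"
    if "x \<in> carrier_vec n" for x
    using assms that pencil_at_mult(1)[OF assms that]
    by (subst pencil_at_mult(1)) (auto simp: vec_minus_eq_0_iff[of _ n])
  then show ?thesis by (auto simp: pencil_eigenvalue_def)
qed

text \<open>The first two vectors of any longer chain form a chain of length two.\<close>

lemma semisimple_at_iff:
  assumes E: "E \<in> carrier_mat n n" and A: "A \<in> carrier_mat n n"
  shows "semisimple_at n E A l \<longleftrightarrow> \<not> (\<exists>x \<in> carrier_vec n. \<exists>y \<in> carrier_vec n. x \<noteq> 0\<^sub>v n \<and>
    complex_mat A *\<^sub>v x = l \<cdot>\<^sub>v (complex_mat E *\<^sub>v x) \<and>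
    complex_mat A *\<^sub>v y = l \<cdot>\<^sub>v (complex_mat E *\<^sub>v y) + complex_mat E *\<^sub>v x \<and> y \<noteq> 0\<^sub>v n)"
    (is "_ \<longleftrightarrow> \<not> ?chain")
proof -
  let ?E = "complex_mat E" let ?A = "complex_mat A"
  have m: "(?A - l \<cdot>\<^sub>m ?E) *\<^sub>v x = 0\<^sub>v n \<longleftrightarrow> ?A *\<^sub>v x = l \<cdot>\<^sub>v (?E *\<^sub>v x)"
    "(?A - l \<cdot>\<^sub>m ?E) *\<^sub>v y = ?E *\<^sub>v x \<longleftrightarrow> ?A *\<^sub>v y = l \<cdot>\<^sub>v (?E *\<^sub>v y) + ?E *\<^sub>v x"
    if "x \<in> carrier_vec n" "y \<in> carrier_vec n" for x y
    using that E A unfolding pencil_at_mult(2)[OF E A that(1)] pencil_at_mult(2)[OF E A that(2)]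
    by (subst vec_minus_eq_0_iff[of _ n] vec_minus_eq_iff[of _ n]; auto)+
  show ?thesis
  proof
    assume ss: "semisimple_at n E A l"
    show "\<not> ?chain"
    proof
      assume ?chain
      then obtain x y where x: "x \<in> carrier_vec n" and y: "y \<in> carrier_vec n" and 0: "x \<noteq> 0\<^sub>v n" "y \<noteq> 0\<^sub>v n"
        and c: "?A *\<^sub>v x = l \<cdot>\<^sub>v (?E *\<^sub>v x)" "?A *\<^sub>v y = l \<cdot>\<^sub>v (?E *\<^sub>v y) + ?E *\<^sub>v x" by blast
      have "pencil_chain n E A l [x, y]"
        using x y 0 m[OF x y] c by (auto simp: pencil_chain_def less_Suc_eq)
      then show False using ss unfolding semisimple_at_def by fastforce
    qed
  next
    assume nc: "\<not> ?chain"
    show "semisimple_at n E A l"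
      unfolding semisimple_at_def
    proof (intro notI, elim exE conjE)
      fix xs assume xs: "pencil_chain n E A l xs" "1 < length xs"
      let ?x = "xs ! 0" let ?y = "xs ! 1"
      have c: "?x \<in> carrier_vec n" "?y \<in> carrier_vec n" "?x \<noteq> 0\<^sub>v n" "?y \<noteq> 0\<^sub>v n"
        using xs nth_mem[of 0 xs] nth_mem[of 1 xs] unfolding pencil_chain_def by auto
      have "(?A - l \<cdot>\<^sub>m ?E) *\<^sub>v ?x = 0\<^sub>v n" "(?A - l \<cdot>\<^sub>m ?E) *\<^sub>v ?y = ?E *\<^sub>v ?x"
        using xs unfolding pencil_chain_def by auto
      then show False using nc c m[OF c(1,2)] by blast
    qed
  qed
qed

text \<open>The first three vectors of any longer chain form a chain of length three. Conversely the
  first vector of such a chain shows that infinity is an eigenvalue, so that the index really is the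
  supremum.\<close>

lemma pencil_index_le_2_iff:
  "pencil_index n E A \<le> 2 \<longleftrightarrow> \<not> (\<exists>x \<in> carrier_vec n. \<exists>y \<in> carrier_vec n. \<exists>z \<in> carrier_vec n.
    x \<noteq> 0\<^sub>v n \<and> y \<noteq> 0\<^sub>v n \<and> z \<noteq> 0\<^sub>v n \<and> complex_mat E *\<^sub>v x = 0\<^sub>v n \<and>
    complex_mat E *\<^sub>v y = complex_mat A *\<^sub>v x \<and> complex_mat E *\<^sub>v z = complex_mat A *\<^sub>v y)"
    (is "_ \<longleftrightarrow> \<not> ?chain")
proof
  let ?L = "{enat (length xs) | xs. pencil_chain_inf n E A xs}"
  assume ind: "pencil_index n E A \<le> 2"
  show "\<not> ?chain"
  proof
    assume ?chain
    then obtain x y z where c: "x \<in> carrier_vec n" "y \<in> carrier_vec n" "z \<in> carrier_vec n"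
      "x \<noteq> 0\<^sub>v n" "y \<noteq> 0\<^sub>v n" "z \<noteq> 0\<^sub>v n"
      "complex_mat E *\<^sub>v x = 0\<^sub>v n" "complex_mat E *\<^sub>v y = complex_mat A *\<^sub>v x"
      "complex_mat E *\<^sub>v z = complex_mat A *\<^sub>v y" by blast
    have "pencil_chain_inf n E A [x, y, z]"
      using c by (auto simp: pencil_chain_inf_def less_Suc_eq)
    then have "enat 3 \<in> ?L" by (force intro!: exI[of _ "[x, y, z]"])
    then have "enat 3 \<le> Sup ?L" by (rule Sup_upper)
    moreover have "pencil_eigenvalue_inf n E" using c by (auto simp: pencil_eigenvalue_inf_def)
    ultimately have "enat 3 \<le> 2" using ind by (simp add: pencil_index_def)
    then show False by (simp add: numeral_eq_enat)
  qed
next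
  assume nc: "\<not> ?chain"
  have "length xs \<le> 2" if "pencil_chain_inf n E A xs" for xs
  proof (rule ccontr)
    assume "\<not> length xs \<le> 2"
    then have l: "2 < length xs" by simp
    have el: "xs ! i \<in> carrier_vec n" "xs ! i \<noteq> 0\<^sub>v n" if "i < length xs" for i
      using \<open>pencil_chain_inf n E A xs\<close> nth_mem[OF that] unfolding pencil_chain_inf_def by auto
    have step: "complex_mat E *\<^sub>v xs ! j = complex_mat A *\<^sub>v xs ! (j - 1)" if "1 \<le> j" "j < length xs" for j
      using \<open>pencil_chain_inf n E A xs\<close> that unfolding pencil_chain_inf_def by blast
    have "complex_mat E *\<^sub>v xs ! 0 = 0\<^sub>v n"
      using that unfolding pencil_chain_inf_def by blast
    moreover have "complex_mat E *\<^sub>v xs ! 1 = complex_mat A *\<^sub>v xs ! 0"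
      "complex_mat E *\<^sub>v xs ! 2 = complex_mat A *\<^sub>v xs ! 1"
      using step[of 1] step[of 2] l by auto
    moreover have "0 < length xs" "1 < length xs" using l by linarith+
    ultimately show False using nc el l by blast
  qed
  then have "Sup {enat (length xs) | xs. pencil_chain_inf n E A xs} \<le> 2"
    by (intro Sup_least) (auto simp: numeral_eq_enat)
  then show "pencil_index n E A \<le> 2" by (simp add: pencil_index_def)
qed

lemma dissipative_Hamiltonian_spectrum:
  assumes E: "E \<in> carrier_mat n n" and A: "A \<in> carrier_mat n n" and reg: "regular_pencil E A"
    and dH: "dissipative_Hamiltonian n E A"
  shows "pencil_eigenvalue n E A l \<Longrightarrow> Re l \<le> 0"
    and "l \<noteq> 0 \<Longrightarrow> Re l = 0 \<Longrightarrow> semisimple_at n E A l"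
    and "pencil_index n E A \<le> 2"
    and "pencil_index n A E \<le> 2"
proof -
  obtain Q where "dissipative_forms n (complex_mat E) (complex_mat A) (complex_mat Q)"
    using dissipative_Hamiltonian_forms[OF assms] .
  then interpret dissipative_forms n "complex_mat E" "complex_mat A" "complex_mat Q" .
  show "pencil_eigenvalue n E A l \<Longrightarrow> Re l \<le> 0"
    unfolding pencil_eigenvalue_iff[OF E A] using eigen_Re_nonpos by blast
  show "l \<noteq> 0 \<Longrightarrow> Re l = 0 \<Longrightarrow> semisimple_at n E A l"
    unfolding semisimple_at_iff[OF E A] using imaginary_no_chain by blast
  show "pencil_index n E A \<le> 2"
    unfolding pencil_index_le_2_iff using no_infinite_chain by blast
  show "pencil_index n A E \<le> 2"
    unfolding pencil_index_le_2_iff using no_zero_chain by blast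
qed

subsection \<open>Products of linear factors\<close>

text \<open>Polynomials in a matrix enter through their lists of roots, so that only products of
  linear factors \<open>V - e\<close> are applied to vectors.\<close>

fun shifts :: "complex mat \<Rightarrow> complex list \<Rightarrow> complex vec \<Rightarrow> complex vec" where
  "shifts V [] y = y"
| "shifts V (e # es) y = shifts V es (V *\<^sub>v y - e \<cdot>\<^sub>v y)"

lemma shifts_carrier [simp]:
  assumes "V \<in> carrier_mat n n" "y \<in> carrier_vec n"
  shows "shifts V es y \<in> carrier_vec n"
  using assms(2) by (induction es arbitrary: y) (use assms(1) in auto)

lemma shift_linear:
  fixes V :: "'a :: field mat"
  assumes "V \<in> carrier_mat n n" "x \<in> carrier_vec n" "y \<in> carrier_vec n"
  shows "V *\<^sub>v (a \<cdot>\<^sub>v x + b \<cdot>\<^sub>v y) - e \<cdot>\<^sub>v (a \<cdot>\<^sub>v x + b \<cdot>\<^sub>v y) =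
    a \<cdot>\<^sub>v (V *\<^sub>v x - e \<cdot>\<^sub>v x) + b \<cdot>\<^sub>v (V *\<^sub>v y - e \<cdot>\<^sub>v y)"
proof -
  have "V *\<^sub>v (a \<cdot>\<^sub>v x + b \<cdot>\<^sub>v y) = a \<cdot>\<^sub>v (V *\<^sub>v x) + b \<cdot>\<^sub>v (V *\<^sub>v y)"
    using assms by (simp add: mult_add_distrib_mat_vec[of V n n] mult_mat_vec[of V n n])
  then show ?thesis
    using assms by (auto intro!: eq_vecI simp del: index_mult_mat_vec simp: algebra_simps)
qed

lemma shifts_linear:
  assumes V: "V \<in> carrier_mat n n" and "x \<in> carrier_vec n" "y \<in> carrier_vec n"
  shows "shifts V es (a \<cdot>\<^sub>v x + b \<cdot>\<^sub>v y) = a \<cdot>\<^sub>v shifts V es x + b \<cdot>\<^sub>v shifts V es y"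
  using assms(2,3)
proof (induction es arbitrary: x y)
  case (Cons e es)
  have "shifts V (e # es) (a \<cdot>\<^sub>v x + b \<cdot>\<^sub>v y) =
      shifts V es (a \<cdot>\<^sub>v (V *\<^sub>v x - e \<cdot>\<^sub>v x) + b \<cdot>\<^sub>v (V *\<^sub>v y - e \<cdot>\<^sub>v y))"
    using shift_linear[OF V Cons.prems] by simp
  also have "\<dots> = a \<cdot>\<^sub>v shifts V (e # es) x + b \<cdot>\<^sub>v shifts V (e # es) y"
    using Cons.IH Cons.prems V by simp
  finally show ?case .
qed simp

lemma shifts_smult:
  assumes V: "V \<in> carrier_mat n n" and x: "x \<in> carrier_vec n"
  shows "shifts V es (a \<cdot>\<^sub>v x) = a \<cdot>\<^sub>v shifts V es x"
proof -
  have 0: "a \<cdot>\<^sub>v v = a \<cdot>\<^sub>v v + 0 \<cdot>\<^sub>v v" if "v \<in> carrier_vec n" for v :: "complex vec" and a using that by auto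
  show ?thesis
    using shifts_linear[OF V x x, of es a 0] 0[OF x, of a] 0[of "shifts V es x" a] V x by simp
qed

lemma shifts_zero [simp]:
  assumes V: "V \<in> carrier_mat n n"
  shows "shifts V es (0\<^sub>v n) = 0\<^sub>v n"
proof -
  have 0: "0 \<cdot>\<^sub>v v = 0\<^sub>v n" if "v \<in> carrier_vec n" for v :: "complex vec"
    using that by auto
  have "shifts V es (0 \<cdot>\<^sub>v 0\<^sub>v n) = 0\<^sub>v n"
    unfolding shifts_smult[OF V zero_carrier_vec] by (intro 0 shifts_carrier[OF V zero_carrier_vec])
  then show ?thesis by (simp add: 0)
qed

lemma shifts_append: "shifts V (as @ bs) y = shifts V bs (shifts V as y)"
  by (induction as arbitrary: y) auto

lemma shifts_mult:
  assumes V: "V \<in> carrier_mat n n" and y: "y \<in> carrier_vec n"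
  shows "shifts V es (V *\<^sub>v y) = V *\<^sub>v shifts V es y"
  using y
proof (induction es arbitrary: y)
  case (Cons e es)
  have "V *\<^sub>v (V *\<^sub>v y) - e \<cdot>\<^sub>v (V *\<^sub>v y) = V *\<^sub>v (V *\<^sub>v y - e \<cdot>\<^sub>v y)"
    using V Cons.prems by (simp add: mult_minus_distrib_mat_vec[of V n n] mult_mat_vec[of V n n])
  then show ?case using Cons V by simp
qed simp

lemma shifts_shift:
  assumes V: "V \<in> carrier_mat n n" and y: "y \<in> carrier_vec n"
  shows "shifts V es (V *\<^sub>v y - e \<cdot>\<^sub>v y) = V *\<^sub>v shifts V es y - e \<cdot>\<^sub>v shifts V es y"
proof -
  have eq: "u - e \<cdot>\<^sub>v v = 1 \<cdot>\<^sub>v u + (- e) \<cdot>\<^sub>v v" if "u \<in> carrier_vec n" "v \<in> carrier_vec n" for u v :: "complex vec"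
    using that by (auto intro!: eq_vecI)
  show ?thesis
    using V y shifts_linear[OF V, of "V *\<^sub>v y" y es 1 "- e"] eq[of "V *\<^sub>v y" y]
      eq[of "V *\<^sub>v shifts V es y" "shifts V es y"] by (simp add: shifts_mult[of V n])
qed

text \<open>Linear factors in one matrix commute, so a list of roots matters only as a
  multiset.\<close>

lemma shifts_mset:
  assumes V: "V \<in> carrier_mat n n" and y: "y \<in> carrier_vec n" and m: "mset as = mset bs"
  shows "shifts V as y = shifts V bs y"
  using y m
proof (induction as arbitrary: bs y)
  case (Cons e as)
  have "e \<in> set bs" using Cons.prems(2) by (metis list.set_intros(1) set_mset_mset)
  then obtain b1 b2 where bs: "bs = b1 @ e # b2" by (meson split_list)
  have "mset as = mset (b1 @ b2)" using Cons.prems(2) bs by simp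
  then have "shifts V (e # as) y = shifts V (b1 @ b2) (V *\<^sub>v y - e \<cdot>\<^sub>v y)"
    using Cons V by simp
  then show ?case
    using shifts_shift[OF V Cons.prems(1)] by (simp add: bs shifts_append)
qed simp

lemma shifts_intertwine:
  assumes V: "V \<in> carrier_mat n n" and B: "B \<in> carrier_mat n n" and P: "P \<in> carrier_mat n n"
    and VP: "V * P = P * B" and z: "z \<in> carrier_vec n"
  shows "shifts V es (P *\<^sub>v z) = P *\<^sub>v shifts B es z"
  using z
proof (induction es arbitrary: z)
  case (Cons e es)
  have "V *\<^sub>v (P *\<^sub>v z) = P *\<^sub>v (B *\<^sub>v z)"
    using VP V B P Cons.prems by (metis assoc_mult_mat_vec)
  then have "V *\<^sub>v (P *\<^sub>v z) - e \<cdot>\<^sub>v (P *\<^sub>v z) = P *\<^sub>v (B *\<^sub>v z - e \<cdot>\<^sub>v z)"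
    using B P Cons.prems by (simp add: mult_minus_distrib_mat_vec[of P n n] mult_mat_vec[of P n n])
  then show ?case using Cons B by simp
qed simp

text \<open>The reversed list applies the factor of the last row first: subtracting the diagonal
  entry of the last coordinate in the support kills that coordinate, and triangularity keeps the
  later ones zero.\<close>

lemma shifts_triangular:
  assumes B: "B \<in> carrier_mat n n" and tri: "upper_triangular B"
    and z: "z \<in> carrier_vec n" and k: "k \<le> n" and supp: "\<And>i. k \<le> i \<Longrightarrow> i < n \<Longrightarrow> z $ i = 0"
  shows "shifts B (map (\<lambda>i. B $$ (i, i)) (rev [0..<k])) z = 0\<^sub>v n"
  using z k supp
proof (induction k arbitrary: z)
  case 0
  then show ?case by (auto intro!: eq_vecI)
next
  case (Suc k)
  let ?w = "B *\<^sub>v z - B $$ (k, k) \<cdot>\<^sub>v z"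
  have "?w $ i = 0" if i: "k \<le> i" "i < n" for i
  proof -
    have "(B *\<^sub>v z) $ i = (\<Sum>j = 0..<n. B $$ (i, j) * z $ j)"
      using B Suc.prems i by (auto simp: scalar_prod_def)
    also have "\<dots> = (\<Sum>j \<in> {0..<n} \<inter> {i}. B $$ (i, j) * z $ j)"
    proof (intro sum.mono_neutral_right ballI)
      fix j assume j: "j \<in> {0..<n} - {0..<n} \<inter> {i}"
      then consider "j < i" | "Suc k \<le> j" using i by (auto simp: neq_iff)
      then show "B $$ (i, j) * z $ j = 0"
        using B tri Suc.prems i j unfolding upper_triangular_def by cases auto
    qed auto
    also have "\<dots> = B $$ (k, k) * z $ i"
      using i Suc.prems by (cases "i = k") auto
    finally show ?thesis using B Suc.prems i by simp
  qed
  then show ?case using Suc.IH[of ?w] Suc.prems B by simp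
qed

text \<open>A Cayley-Hamilton theorem in terms of roots: after passing to a Schur form, the diagonal
  entries serve as the list.\<close>

lemma exists_annihilating_shifts:
  assumes V: "V \<in> carrier_mat n n"
  shows "\<exists>es. \<forall>y \<in> carrier_vec n. shifts V es y = 0\<^sub>v n"
proof -
  obtain as where "char_poly V = (\<Prod>a\<leftarrow>as. [:- a, 1:])"
    using char_poly_factorized[OF V] by blast
  then obtain B where B: "B \<in> carrier_mat n n" "upper_triangular B" "similar_mat V B"
    using schur_decomposition_exists[OF V] by blast
  then obtain P Q where w: "similar_mat_wit V B P Q" by (auto simp: similar_mat_def)
  have PQ: "P \<in> carrier_mat n n" "Q \<in> carrier_mat n n" "P * Q = 1\<^sub>m n" "Q * P = 1\<^sub>m n" "V = P * B * Q"
    using similar_mat_witD2[OF V w] by auto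
  have "V * P = P * B * (Q * P)" using PQ B by (simp add: assoc_mult_mat[of _ n n _ n _ n])
  then have VP: "V * P = P * B" using PQ B by simp
  let ?es = "map (\<lambda>i. B $$ (i, i)) (rev [0..<n])"
  have "shifts V ?es y = 0\<^sub>v n" if y: "y \<in> carrier_vec n" for y
  proof -
    have Qy: "Q *\<^sub>v y \<in> carrier_vec n" using PQ y by simp
    have "y = P *\<^sub>v (Q *\<^sub>v y)" using PQ y by (simp flip: assoc_mult_mat_vec[of _ n n _ n])
    then have "shifts V ?es y = P *\<^sub>v shifts B ?es (Q *\<^sub>v y)"
      using shifts_intertwine[OF V B(1) PQ(1) VP Qy] by metis
    also have "\<dots> = 0\<^sub>v n" using shifts_triangular[OF B(1,2) Qy le_refl] PQ by auto
    finally show ?thesis .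
  qed
  then show ?thesis by blast
qed

text \<open>Division of a polynomial by its variable: \<open>c\<close> is the constant term, the
  product of the \<open>- e\<close>, and is non-zero because 0 is no root.\<close>

lemma shifts_eq_const_plus:
  assumes S: "S \<in> carrier_mat n n" and "0 \<notin> set es"
  shows "\<exists>c \<noteq> 0. \<exists>D \<in> carrier_mat n n. \<forall>y \<in> carrier_vec n. shifts S es y = c \<cdot>\<^sub>v y + D *\<^sub>v (S *\<^sub>v y)"
  using assms(2)
proof (induction es)
  case Nil
  show ?case by (intro exI[of _ 1] conjI bexI[of _ "0\<^sub>m n n"]) (use S in auto)
next
  case (Cons e es)
  then obtain c D where c: "c \<noteq> 0" and D: "D \<in> carrier_mat n n"
    and eq: "\<And>y. y \<in> carrier_vec n \<Longrightarrow> shifts S es y = c \<cdot>\<^sub>v y + D *\<^sub>v (S *\<^sub>v y)" by auto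
  \<comment> \<open>Obtained by inserting \<open>(S - e) y\<close> into \<open>c y + D S y\<close>
    and collecting everything that acts on \<open>S y\<close>.\<close>
  let ?D = "c \<cdot>\<^sub>m 1\<^sub>m n + (D * S - e \<cdot>\<^sub>m D)"
  have "shifts S (e # es) y = (- e * c) \<cdot>\<^sub>v y + ?D *\<^sub>v (S *\<^sub>v y)" if y: "y \<in> carrier_vec n" for y
  proof -
    define z where "z = S *\<^sub>v y"
    have z: "z \<in> carrier_vec n" using S y by (simp add: z_def)
    have 1: "S *\<^sub>v (z - e \<cdot>\<^sub>v y) = S *\<^sub>v z - e \<cdot>\<^sub>v z"
      using S y z by (simp add: mult_minus_distrib_mat_vec[of S n n] mult_mat_vec[of S n n] z_def)
    have 2: "D *\<^sub>v (S *\<^sub>v z - e \<cdot>\<^sub>v z) = D *\<^sub>v (S *\<^sub>v z) - e \<cdot>\<^sub>v (D *\<^sub>v z)"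
      using S D y z by (simp add: mult_minus_distrib_mat_vec[of D n n] mult_mat_vec[of D n n])
    have 3: "?D *\<^sub>v z = c \<cdot>\<^sub>v z + (D *\<^sub>v (S *\<^sub>v z) - e \<cdot>\<^sub>v (D *\<^sub>v z))"
      using S D z
      by (simp add: add_mult_distrib_mat_vec[of _ n n] minus_mult_distrib_mat_vec[of _ n n]
          smult_mat_mult_vec[of _ n n] assoc_mult_mat_vec[of _ n n _ n])
    have "shifts S (e # es) y = c \<cdot>\<^sub>v (z - e \<cdot>\<^sub>v y) + D *\<^sub>v (S *\<^sub>v (z - e \<cdot>\<^sub>v y))"
      using eq[of "z - e \<cdot>\<^sub>v y"] y z by (simp add: z_def)
    also have "\<dots> = c \<cdot>\<^sub>v (z - e \<cdot>\<^sub>v y) + (D *\<^sub>v (S *\<^sub>v z) - e \<cdot>\<^sub>v (D *\<^sub>v z))"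
      by (simp only: 1 2)
    also have "\<dots> = (- e * c) \<cdot>\<^sub>v y + ?D *\<^sub>v z"
      unfolding 3 using y z D by (intro eq_vecI) (auto simp del: index_mult_mat_vec simp: algebra_simps)
    finally show ?thesis by (simp add: z_def)
  qed
  moreover have "- e * c \<noteq> 0" using c Cons.prems by auto
  moreover have "?D \<in> carrier_mat n n" using S D by simp
  ultimately show ?case by blast
qed

subsection \<open>Construction of J and R from Q\<close>

text \<open>The Gram matrix \<open>S = M\<^sup>T M\<close> is symmetric, so \<open>S\<^sup>2\<close>
  and \<open>S\<close> have the same kernel and one factor \<open>S\<close> is enough for the root
  0: \<open>S f(S) = 0\<close> with \<open>f(0) \<noteq> 0\<close>. Writing
  \<open>f(S) = c + D S\<close> exhibits the inverse as a multiple of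
  \<open>D M\<^sup>T\<close>.\<close>

lemma exists_generalized_inverse:
  fixes M :: "real mat"
  assumes M: "M \<in> carrier_mat n n"
  shows "\<exists>G \<in> carrier_mat n n. \<forall>x \<in> carrier_vec n. M *\<^sub>v (G *\<^sub>v (M *\<^sub>v x)) = M *\<^sub>v x"
proof -
  let ?M = "complex_mat M"
  define S where "S = complex_mat M\<^sup>T * ?M"
  have S: "S \<in> carrier_mat n n" using M by (simp add: S_def)
  have Smul: "S *\<^sub>v x = complex_mat M\<^sup>T *\<^sub>v (?M *\<^sub>v x)" if "x \<in> carrier_vec n" for x
    using M that unfolding S_def by (intro assoc_mult_mat_vec[of _ n n _ n]) auto
  have ker: "?M *\<^sub>v x = 0\<^sub>v n" if x: "x \<in> carrier_vec n" and 0: "S *\<^sub>v x = 0\<^sub>v n" for x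
  proof -
    have Mx: "?M *\<^sub>v x \<in> carrier_vec n" using M x by simp
    have "(?M *\<^sub>v x) \<bullet>c (?M *\<^sub>v x) = 0"
      unfolding complex_mat_adjoint[OF M x Mx] Smul[OF x, symmetric] 0 using x by simp
    then show ?thesis using conjugate_square_eq_0_vec[OF Mx] by simp
  qed
  have ker2: "S *\<^sub>v x = 0\<^sub>v n" if x: "x \<in> carrier_vec n" and 0: "S *\<^sub>v (S *\<^sub>v x) = 0\<^sub>v n" for x
  proof -
    have Sx: "S *\<^sub>v x \<in> carrier_vec n" using S x by simp
    have Mx: "?M *\<^sub>v x \<in> carrier_vec n" using M x by simp
    have MSx: "?M *\<^sub>v (S *\<^sub>v x) = 0\<^sub>v n" using ker[OF Sx 0] .
    have MT: "M\<^sup>T \<in> carrier_mat n n" using M by simp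
    have "(S *\<^sub>v x) \<bullet>c (S *\<^sub>v x) = (?M *\<^sub>v x) \<bullet>c (?M *\<^sub>v (S *\<^sub>v x))"
      using complex_mat_adjoint[OF MT Mx Sx] Smul[OF x] by simp
    also have "\<dots> = 0" using MSx Mx by simp
    finally show ?thesis using conjugate_square_eq_0_vec[OF Sx] by simp
  qed
  have ker_replicate: "S *\<^sub>v x = 0\<^sub>v n" if "x \<in> carrier_vec n" "shifts S (replicate k 0) x = 0\<^sub>v n" for k x
    using that
  proof (induction k arbitrary: x)
    case 0
    then show ?case using S by auto
  next
    case (Suc k)
    have "S *\<^sub>v x - 0 \<cdot>\<^sub>v x = S *\<^sub>v x" using S Suc.prems by (intro eq_vecI) auto
    then show ?case using Suc ker2[of x] S by simp
  qed
  obtain es where es: "\<And>y. y \<in> carrier_vec n \<Longrightarrow> shifts S es y = 0\<^sub>v n"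
    using exists_annihilating_shifts[OF S] by blast
  define fs where "fs = filter (\<lambda>e. e \<noteq> 0) es"
  have m: "mset es = mset (fs @ replicate (count (mset es) 0) 0)"
    unfolding fs_def by (induction es) auto
  have fs0: "S *\<^sub>v shifts S fs y = 0\<^sub>v n" if y: "y \<in> carrier_vec n" for y
    using ker_replicate[OF shifts_carrier[OF S y]] es[OF y] shifts_mset[OF S y m]
    by (metis shifts_append)
  obtain c D where c: "c \<noteq> 0" and D: "D \<in> carrier_mat n n"
    and eq: "\<And>y. y \<in> carrier_vec n \<Longrightarrow> shifts S fs y = c \<cdot>\<^sub>v y + D *\<^sub>v (S *\<^sub>v y)"
    using shifts_eq_const_plus[OF S, of fs] by (auto simp: fs_def)
  \<comment> \<open>Chosen so that \<open>y - H M y\<close> is \<open>f(S) y / c\<close>, with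
    \<open>f\<close> the polynomial with roots \<open>fs\<close>. This vector lies in the kernel of
    \<open>S\<close>, which is that of \<open>M\<close>.\<close>
  define H where "H = (- 1 / c) \<cdot>\<^sub>m (D * complex_mat M\<^sup>T)"
  have H: "H \<in> carrier_mat n n" using D M by (simp add: H_def)
  have MHM: "?M *\<^sub>v (H *\<^sub>v (?M *\<^sub>v y)) = ?M *\<^sub>v y" if y: "y \<in> carrier_vec n" for y
  proof -
    have My: "?M *\<^sub>v y \<in> carrier_vec n" using M y by simp
    have Hy: "H *\<^sub>v (?M *\<^sub>v y) = (- 1 / c) \<cdot>\<^sub>v (D *\<^sub>v (S *\<^sub>v y))"
      using D M My Smul[OF y] unfolding H_def
      by (subst smult_mat_mult_vec[of _ n n]) (auto simp: assoc_mult_mat_vec[of _ n n _ n])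
    have Hc: "H *\<^sub>v (?M *\<^sub>v y) \<in> carrier_vec n" using H My by simp
    have "y - H *\<^sub>v (?M *\<^sub>v y) = (1 / c) \<cdot>\<^sub>v shifts S fs y"
      unfolding Hy eq[OF y] using c D S y
      by (intro eq_vecI) (auto simp del: index_mult_mat_vec simp: field_simps)
    then have "S *\<^sub>v (y - H *\<^sub>v (?M *\<^sub>v y)) = (1 / c) \<cdot>\<^sub>v (S *\<^sub>v shifts S fs y)"
      using S y by (simp add: mult_mat_vec[of S n n])
    also have "\<dots> = 0\<^sub>v n" using fs0[OF y] by auto
    finally have "?M *\<^sub>v (y - H *\<^sub>v (?M *\<^sub>v y)) = 0\<^sub>v n" using ker y Hc by simp
    then show ?thesis
      using M y Hc by (simp add: mult_minus_distrib_mat_vec[of _ n n] vec_minus_eq_0_iff[of _ n])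
  qed
  \<comment> \<open>For real \<open>M\<close> and \<open>x\<close>, taking real parts in
    \<open>M H M x = M x\<close> only affects \<open>H\<close>.\<close>
  let ?G = "map_mat Re H"
  have "M *\<^sub>v (?G *\<^sub>v (M *\<^sub>v x)) = M *\<^sub>v x" if x: "x \<in> carrier_vec n" for x
  proof -
    let ?x = "map_vec complex_of_real x"
    have cx: "?x \<in> carrier_vec n" using x by simp
    have Re_cx: "Re_vec ?x = x" by (auto simp: Re_vec_def)
    have Mcx: "?M *\<^sub>v ?x = map_vec complex_of_real (M *\<^sub>v x)"
      by (rule of_real_hom.mult_mat_vec_hom[OF M x, symmetric])
    have ReH: "Re_vec (H *\<^sub>v map_vec complex_of_real v) = ?G *\<^sub>v v" if "v \<in> carrier_vec n" for v
      using H that by (auto simp: Re_vec_def scalar_prod_def intro!: eq_vecI)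
    have "Re_vec (?M *\<^sub>v (H *\<^sub>v (?M *\<^sub>v ?x))) = M *\<^sub>v Re_vec (H *\<^sub>v (?M *\<^sub>v ?x))"
      using M H cx by (intro Re_Im_vec_mult) auto
    also have "\<dots> = M *\<^sub>v (?G *\<^sub>v (M *\<^sub>v x))" using ReH[of "M *\<^sub>v x"] M x Mcx by simp
    finally show ?thesis
      using MHM[OF cx] Re_Im_vec_mult(1)[OF M cx] Re_cx by simp
  qed
  moreover have "?G \<in> carrier_mat n n" using H by simp
  ultimately show ?thesis by blast
qed

lemma mat_eqI_mult_vec:
  fixes M N :: "'a :: comm_ring_1 mat"
  assumes "M \<in> carrier_mat m n" "N \<in> carrier_mat m n"
    and eq: "\<And>x. x \<in> carrier_vec n \<Longrightarrow> M *\<^sub>v x = N *\<^sub>v x"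
  shows "M = N"
proof (rule eq_matI)
  fix i j assume ij: "i < dim_row N" "j < dim_col N"
  have "(M *\<^sub>v unit_vec n j) $ i = (N *\<^sub>v unit_vec n j) $ i" by (simp add: eq)
  then show "M $$ (i, j) = N $$ (i, j)" using assms(1,2) ij by simp
qed (use assms in auto)

lemma scalar_prod_transpose:
  fixes M :: "real mat"
  assumes "M \<in> carrier_mat n n" "x \<in> carrier_vec n" "y \<in> carrier_vec n"
  shows "x \<bullet> (M\<^sup>T *\<^sub>v y) = (M *\<^sub>v x) \<bullet> y"
  using transpose_vec_mult_scalar[OF assms] comm_scalar_prod[of x n "M\<^sup>T *\<^sub>v y"]
    comm_scalar_prod[of "M *\<^sub>v x" n y] assms by simp

text \<open>With \<open>G\<close> a generalized inverse of \<open>Q\<close>, the matrix \<open>T = A G Q G\<close> satisfies \<open>T Q = A\<close>, but its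
  quadratic form is controlled only on the range of \<open>Q\<close>; subtracting \<open>T\<^sup>T (1 - Q G)\<close> repairs this
  without changing the values on that range.\<close>

lemma dissipative_HamiltonianI:
  assumes E: "E \<in> carrier_mat n n" and A: "A \<in> carrier_mat n n" and Q: "Q \<in> carrier_mat n n"
    and sym: "\<And>x y. x \<in> carrier_vec n \<Longrightarrow> y \<in> carrier_vec n \<Longrightarrow>
      (Q *\<^sub>v x) \<bullet> (E *\<^sub>v y) = (E *\<^sub>v x) \<bullet> (Q *\<^sub>v y)"
    and nonneg: "\<And>x. x \<in> carrier_vec n \<Longrightarrow> (Q *\<^sub>v x) \<bullet> (E *\<^sub>v x) \<ge> 0"
    and nonpos: "\<And>x. x \<in> carrier_vec n \<Longrightarrow> (Q *\<^sub>v x) \<bullet> (A *\<^sub>v x) \<le> 0"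
    and kernel: "\<And>x. x \<in> carrier_vec n \<Longrightarrow> Q *\<^sub>v x = 0\<^sub>v n \<Longrightarrow> A *\<^sub>v x = 0\<^sub>v n"
  shows "dissipative_Hamiltonian n E A"
proof -
  obtain G where G: "G \<in> carrier_mat n n"
    and QGQ: "\<And>x. x \<in> carrier_vec n \<Longrightarrow> Q *\<^sub>v (G *\<^sub>v (Q *\<^sub>v x)) = Q *\<^sub>v x"
    using exists_generalized_inverse[OF Q] by blast
  have AGQ: "A *\<^sub>v (G *\<^sub>v (Q *\<^sub>v x)) = A *\<^sub>v x" if x: "x \<in> carrier_vec n" for x
  proof -
    have c: "G *\<^sub>v (Q *\<^sub>v x) \<in> carrier_vec n" using G Q x by simp
    \<comment> \<open>The difference lies in the kernel of \<open>Q\<close>, hence in that of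
      \<open>A\<close>.\<close>
    have "Q *\<^sub>v (x - G *\<^sub>v (Q *\<^sub>v x)) = 0\<^sub>v n"
      using QGQ[OF x] Q x c by (simp add: mult_minus_distrib_mat_vec[of _ n n])
    then have "A *\<^sub>v (x - G *\<^sub>v (Q *\<^sub>v x)) = 0\<^sub>v n" using kernel x c by simp
    then show ?thesis
      using A x c by (simp add: mult_minus_distrib_mat_vec[of _ n n] vec_minus_eq_0_iff[of _ n])
  qed
  define T where "T = A * G * Q * G"
  define K where "K = T - T\<^sup>T * (1\<^sub>m n - Q * G)"
  have T: "T \<in> carrier_mat n n" unfolding T_def using A G Q by (intro mult_carrier_mat)
  have K: "K \<in> carrier_mat n n" using T Q G by (simp add: K_def)
  have Tmul: "T *\<^sub>v y = A *\<^sub>v (G *\<^sub>v y)" if y: "y \<in> carrier_vec n" for y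
    using AGQ[of "G *\<^sub>v y"] A G Q y by (simp add: T_def assoc_mult_mat_vec[of _ n n _ n])
  have Kmul: "K *\<^sub>v y = T *\<^sub>v y - T\<^sup>T *\<^sub>v (y - Q *\<^sub>v (G *\<^sub>v y))" if y: "y \<in> carrier_vec n" for y
    unfolding K_def using T G Q y
    by (simp add: assoc_mult_mat_vec[of _ n n _ n] minus_mult_distrib_mat_vec[of _ n n])
  have KQ: "A = K * Q"
  proof (rule mat_eqI_mult_vec)
    fix x :: "real vec" assume x: "x \<in> carrier_vec n"
    have Qx: "Q *\<^sub>v x \<in> carrier_vec n" using Q x by simp
    have "T\<^sup>T *\<^sub>v (Q *\<^sub>v x - Q *\<^sub>v x) = 0\<^sub>v n" using T Qx by auto
    then have "K *\<^sub>v (Q *\<^sub>v x) = A *\<^sub>v x"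
      using Kmul[OF Qx] QGQ[OF x] Tmul[OF Qx] AGQ[OF x] A x by simp
    then show "A *\<^sub>v x = K * Q *\<^sub>v x" using K Q x by simp
  qed (use A K Q in auto)
  have Kneg: "y \<bullet> (K *\<^sub>v y) \<le> 0" if y: "y \<in> carrier_vec n" for y
  proof -
    have Gy: "G *\<^sub>v y \<in> carrier_vec n" and QGy: "Q *\<^sub>v (G *\<^sub>v y) \<in> carrier_vec n"
      and Ty: "T *\<^sub>v y \<in> carrier_vec n" using G Q T y by auto
    \<comment> \<open>The subtracted term removes the part of the form of \<open>T\<close> along
      \<open>y - Q G y\<close>, leaving the pairing of \<open>T y = A G y\<close> with
      \<open>Q G y\<close>, which is the given form of \<open>A\<close> and \<open>Q\<close> at
      \<open>G y\<close>.\<close>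
    have "y \<bullet> (K *\<^sub>v y) = y \<bullet> (T *\<^sub>v y) - (T *\<^sub>v y) \<bullet> (y - Q *\<^sub>v (G *\<^sub>v y))"
      using y T QGy Ty unfolding Kmul[OF y]
      by (subst scalar_prod_minus_distrib[of _ n]) (auto simp: scalar_prod_transpose[of T n])
    also have "\<dots> = (T *\<^sub>v y) \<bullet> (Q *\<^sub>v (G *\<^sub>v y))"
      using y QGy Ty by (simp add: scalar_prod_minus_distrib[of _ n] comm_scalar_prod[of y n])
    also have "\<dots> = (Q *\<^sub>v (G *\<^sub>v y)) \<bullet> (A *\<^sub>v (G *\<^sub>v y))"
      unfolding Tmul[OF y, symmetric] by (rule comm_scalar_prod[OF Ty QGy])
    also have "\<dots> \<le> 0" using nonpos[OF Gy] .
    finally show ?thesis .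
  qed
  define J where "J = (1/2) \<cdot>\<^sub>m (K - K\<^sup>T)"
  define R where "R = (-1/2) \<cdot>\<^sub>m (K + K\<^sup>T)"
  have JR: "J \<in> carrier_mat n n" "R \<in> carrier_mat n n" using K by (auto simp: J_def R_def)
  have "K = J - R" using K unfolding J_def R_def by (intro eq_matI) (auto simp: field_simps)
  moreover have "J = - J\<^sup>T" using K unfolding J_def by (intro eq_matI) (auto simp: field_simps)
  moreover have "real_psd n R"
    unfolding real_psd_def
  proof (intro conjI ballI)
    show "R \<in> carrier_mat n n" by (rule JR)
    show "R\<^sup>T = R" using K unfolding R_def by (intro eq_matI) auto
    fix y :: "real vec" assume y: "y \<in> carrier_vec n"
    have Ky: "K *\<^sub>v y \<in> carrier_vec n" using K y by simp
    have "y \<bullet> (R *\<^sub>v y) = (-1/2) * (y \<bullet> (K *\<^sub>v y) + y \<bullet> (K\<^sup>T *\<^sub>v y))"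
      unfolding R_def using K y
      by (simp add: smult_mat_mult_vec[of _ n n] add_mult_distrib_mat_vec[of _ n n] scalar_prod_add_distrib[of _ n])
    also have "y \<bullet> (K\<^sup>T *\<^sub>v y) = y \<bullet> (K *\<^sub>v y)"
      using scalar_prod_transpose[OF K y y] comm_scalar_prod[OF y Ky] by simp
    finally show "0 \<le> y \<bullet> (R *\<^sub>v y)" using Kneg[OF y] by simp
  qed
  moreover have QE: "Q\<^sup>T * E = E\<^sup>T * Q"
  proof (rule eq_matI)
    fix i j assume "i < dim_row (E\<^sup>T * Q)" "j < dim_col (E\<^sup>T * Q)"
    then have ij: "i < n" "j < n" using E Q by auto
    have "Q *\<^sub>v unit_vec n k = col Q k" "E *\<^sub>v unit_vec n k = col E k" if "k < n" for k
      using E Q that by (auto intro!: eq_vecI)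
    then show "(Q\<^sup>T * E) $$ (i, j) = (E\<^sup>T * Q) $$ (i, j)"
      using sym[of "unit_vec n i" "unit_vec n j"] E Q ij by simp
  qed (use E Q in auto)
  moreover have "real_psd n (Q\<^sup>T * E)"
    unfolding real_psd_def
  proof (intro conjI ballI)
    show "Q\<^sup>T * E \<in> carrier_mat n n" using E Q by simp
    have "(Q\<^sup>T * E)\<^sup>T = E\<^sup>T * Q" using E Q by (subst transpose_mult[of _ n n _ n]) auto
    then show "(Q\<^sup>T * E)\<^sup>T = Q\<^sup>T * E" using QE by simp
    fix x :: "real vec" assume x: "x \<in> carrier_vec n"
    have "x \<bullet> (Q\<^sup>T * E *\<^sub>v x) = (Q *\<^sub>v x) \<bullet> (E *\<^sub>v x)"
      using E Q x by (simp add: assoc_mult_mat_vec[of _ n n _ n] scalar_prod_transpose[of _ n])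
    then show "0 \<le> x \<bullet> (Q\<^sup>T * E *\<^sub>v x)" using nonneg[OF x] by simp
  qed
  ultimately show ?thesis unfolding dissipative_Hamiltonian_def using JR Q KQ by blast
qed

subsection \<open>Quadratic Lyapunov forms\<close>

abbreviation sq_norm :: "complex vec \<Rightarrow> real" where
  "sq_norm x \<equiv> Re (x \<bullet>c x)"

lemma sq_norm_eq_sum:
  assumes "x \<in> carrier_vec n"
  shows "sq_norm x = (\<Sum>i<n. (cmod (x $ i))\<^sup>2)"
proof -
  have "sq_norm x = (\<Sum>i = 0..<n. Re (x $ i * cnj (x $ i)))"
    using assms by (simp add: scalar_prod_def)
  also have "\<dots> = (\<Sum>i<n. (cmod (x $ i))\<^sup>2)"
    by (intro sum.cong) (auto simp flip: complex_norm_square)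
  finally show ?thesis .
qed

lemma sq_norm_nonneg:
  assumes "x \<in> carrier_vec n"
  shows "sq_norm x \<ge> 0"
  unfolding sq_norm_eq_sum[OF assms] by (simp add: sum_nonneg)

lemma sq_norm_eq_0_iff:
  assumes "x \<in> carrier_vec n"
  shows "sq_norm x = 0 \<longleftrightarrow> x = 0\<^sub>v n"
  unfolding sq_norm_eq_sum[OF assms] using assms by (auto simp: sum_nonneg_eq_0_iff vec_eq_iff)

lemma sq_norm_smult:
  assumes "x \<in> carrier_vec n"
  shows "sq_norm (c \<cdot>\<^sub>v x) = (cmod c)\<^sup>2 * sq_norm x"
proof -
  have "sq_norm (c \<cdot>\<^sub>v x) = (\<Sum>i<n. (cmod ((c \<cdot>\<^sub>v x) $ i))\<^sup>2)"
    using assms by (intro sq_norm_eq_sum) simp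
  also have "\<dots> = (\<Sum>i<n. (cmod c)\<^sup>2 * (cmod (x $ i))\<^sup>2)"
    using assms by (intro sum.cong) (auto simp: norm_mult power_mult_distrib)
  also have "\<dots> = (cmod c)\<^sup>2 * sq_norm x"
    unfolding sq_norm_eq_sum[OF assms] by (simp add: sum_distrib_left)
  finally show ?thesis .
qed

text \<open>Forms are kept as functions, and the matrix merely exists: sums, scalings and
  substitutions of polynomials in \<open>V\<close> then need no matrix computations.
  \<open>H\<close> may be any complex matrix, since only the real part of its form enters and it is
  symmetrized at the very end.\<close>

definition quad_form :: "nat \<Rightarrow> (complex vec \<Rightarrow> real) \<Rightarrow> bool" where
  "quad_form n q \<longleftrightarrow> (\<exists>H \<in> carrier_mat n n. \<forall>x \<in> carrier_vec n. q x = Re ((H *\<^sub>v x) \<bullet>c x) \<and> 0 \<le> q x)"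

lemma quad_form_nonneg: "quad_form n q \<Longrightarrow> x \<in> carrier_vec n \<Longrightarrow> 0 \<le> q x"
  by (auto simp: quad_form_def)

lemma quad_form_zero: "quad_form n (\<lambda>x. 0)"
proof -
  have "0\<^sub>m n n *\<^sub>v x = 0\<^sub>v n" if "x \<in> carrier_vec n" for x :: "complex vec"
    using that by (intro eq_vecI) auto
  then show ?thesis unfolding quad_form_def by (intro bexI[of _ "0\<^sub>m n n"]) auto
qed

lemma quad_form_sq_norm: "quad_form n sq_norm"
  unfolding quad_form_def using sq_norm_nonneg by (intro bexI[of _ "1\<^sub>m n"]) auto

lemma quad_form_add:
  assumes "quad_form n p" "quad_form n q"
  shows "quad_form n (\<lambda>x. p x + q x)"
proof -
  obtain G H where G: "G \<in> carrier_mat n n" "\<And>x. x \<in> carrier_vec n \<Longrightarrow> p x = Re ((G *\<^sub>v x) \<bullet>c x) \<and> 0 \<le> p x"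
    and H: "H \<in> carrier_mat n n" "\<And>x. x \<in> carrier_vec n \<Longrightarrow> q x = Re ((H *\<^sub>v x) \<bullet>c x) \<and> 0 \<le> q x"
    using assms unfolding quad_form_def by metis
  have "((G + H) *\<^sub>v x) \<bullet>c x = (G *\<^sub>v x) \<bullet>c x + (H *\<^sub>v x) \<bullet>c x" if "x \<in> carrier_vec n" for x
    using G(1) H(1) that by (simp add: add_mult_distrib_mat_vec[of _ n n] cip_add[of _ n])
  moreover have "0 \<le> p x + q x" if "x \<in> carrier_vec n" for x
    using G(2)[OF that] H(2)[OF that] by linarith
  ultimately show ?thesis
    unfolding quad_form_def using G H by (intro bexI[of _ "G + H"]) auto
qed

lemma quad_form_scale:
  assumes "quad_form n q" "c \<ge> 0"
  shows "quad_form n (\<lambda>x. c * q x)"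
proof -
  obtain H where H: "H \<in> carrier_mat n n" "\<And>x. x \<in> carrier_vec n \<Longrightarrow> q x = Re ((H *\<^sub>v x) \<bullet>c x) \<and> 0 \<le> q x"
    using assms unfolding quad_form_def by metis
  have "((complex_of_real c \<cdot>\<^sub>m H) *\<^sub>v x) \<bullet>c x = c * ((H *\<^sub>v x) \<bullet>c x)" if "x \<in> carrier_vec n" for x
    using H(1) that by (simp add: smult_mat_mult_vec[of _ n n] cip_smult[of _ n])
  moreover have "0 \<le> c * Re ((H *\<^sub>v x) \<bullet>c x)" if "x \<in> carrier_vec n" for x
    using H(2)[OF that] assms(2) by (metis mult_nonneg_nonneg)
  ultimately show ?thesis
    unfolding quad_form_def using H by (intro bexI[of _ "complex_of_real c \<cdot>\<^sub>m H"]) auto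
qed

text \<open>Each linear factor \<open>M = V - e\<close> is substituted separately and turns
  \<open>H\<close> into \<open>M\<^sup>H H M\<close>, with \<open>M\<^sup>H\<close> the conjugate
  transpose of \<open>M\<close>.\<close>

lemma quad_form_shifts:
  assumes V: "V \<in> carrier_mat n n" and q: "quad_form n q"
  shows "quad_form n (\<lambda>x. q (shifts V es x))"
proof (induction es)
  case Nil
  then show ?case using q by simp
next
  case (Cons e es)
  then obtain H where H: "H \<in> carrier_mat n n"
    "\<And>x. x \<in> carrier_vec n \<Longrightarrow> q (shifts V es x) = Re ((H *\<^sub>v x) \<bullet>c x) \<and> 0 \<le> q (shifts V es x)"
    unfolding quad_form_def by metis
  define M where "M = V - e \<cdot>\<^sub>m 1\<^sub>m n"
  define K where "K = (map_mat cnj M)\<^sup>T * (H * M)"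
  have M: "M \<in> carrier_mat n n" by (simp add: M_def)
  have M': "map_mat cnj (map_mat cnj M)\<^sup>T = M\<^sup>T" by (intro eq_matI) auto
  have K: "K \<in> carrier_mat n n" using M H(1) by (simp add: K_def)
  have Mmul: "M *\<^sub>v x = V *\<^sub>v x - e \<cdot>\<^sub>v x" if "x \<in> carrier_vec n" for x
    unfolding M_def using V that
    by (simp add: minus_mult_distrib_mat_vec[of _ n n] smult_mat_mult_vec[of _ n n])
  have "(K *\<^sub>v x) \<bullet>c x = (H *\<^sub>v (M *\<^sub>v x)) \<bullet>c (M *\<^sub>v x)" if x: "x \<in> carrier_vec n" for x
  proof -
    have "K *\<^sub>v x = (map_mat cnj M)\<^sup>T *\<^sub>v (H *\<^sub>v (M *\<^sub>v x))"
      unfolding K_def using M H(1) x by (simp add: assoc_mult_mat_vec[of _ n n _ n])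
    then show ?thesis
      using cip_adjoint[of "(map_mat cnj M)\<^sup>T" n n "H *\<^sub>v (M *\<^sub>v x)" x] M H(1) x M' by simp
  qed
  then have "q (shifts V (e # es) x) = Re ((K *\<^sub>v x) \<bullet>c x) \<and> 0 \<le> q (shifts V (e # es) x)"
    if "x \<in> carrier_vec n" for x
    using H(2)[of "M *\<^sub>v x"] that V M Mmul by simp
  then show ?case unfolding quad_form_def using K by blast
qed

text \<open>On real vectors the imaginary part of \<open>H\<close> contributes nothing to the real
  part of the form, so the symmetric part of \<open>Re H\<close> represents it.\<close>

lemma quad_form_real_psd:
  assumes "quad_form n q"
  shows "\<exists>X. real_psd n X \<and> (\<forall>x \<in> carrier_vec n. x \<bullet> (X *\<^sub>v x) = q (map_vec complex_of_real x))"
proof -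
  obtain H where H: "H \<in> carrier_mat n n" "\<And>x. x \<in> carrier_vec n \<Longrightarrow> q x = Re ((H *\<^sub>v x) \<bullet>c x) \<and> 0 \<le> q x"
    using assms unfolding quad_form_def by metis
  define G where "G = map_mat Re H"
  define X where "X = (1/2) \<cdot>\<^sub>m (G + G\<^sup>T)"
  have G: "G \<in> carrier_mat n n" using H(1) by (simp add: G_def)
  have eq: "x \<bullet> (X *\<^sub>v x) = q (map_vec complex_of_real x)" if x: "x \<in> carrier_vec n" for x
  proof -
    have "x \<bullet> (X *\<^sub>v x) = (1/2) * (x \<bullet> (G *\<^sub>v x) + x \<bullet> (G\<^sup>T *\<^sub>v x))"
      unfolding X_def using G x
      by (simp add: smult_mat_mult_vec[of _ n n] add_mult_distrib_mat_vec[of _ n n] scalar_prod_add_distrib[of _ n])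
    also have "x \<bullet> (G\<^sup>T *\<^sub>v x) = x \<bullet> (G *\<^sub>v x)"
      using scalar_prod_transpose[OF G x x] comm_scalar_prod[of x n "G *\<^sub>v x"] G x by simp
    also have "x \<bullet> (G *\<^sub>v x) = Re ((H *\<^sub>v map_vec complex_of_real x) \<bullet>c map_vec complex_of_real x)"
      using x H(1) by (auto simp: G_def scalar_prod_def sum_distrib_left mult.commute intro!: sum.cong)
    finally show ?thesis using H(2)[of "map_vec complex_of_real x"] x by simp
  qed
  have "real_psd n X"
    unfolding real_psd_def
  proof (intro conjI ballI)
    show "X \<in> carrier_mat n n" using G by (simp add: X_def)
    show "X\<^sup>T = X" using G unfolding X_def by (intro eq_matI) auto
    show "0 \<le> x \<bullet> (X *\<^sub>v x)" if "x \<in> carrier_vec n" for x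
      using eq[OF that] H(2)[of "map_vec complex_of_real x"] that by simp
  qed
  then show ?thesis using eq by blast
qed

text \<open>The cross term is split by completing the square with weight \<open>d / 2\<close>. The
  weight is small enough that \<open>(1 + d / 2) (1 - d) \<le> 1 - d / 2\<close>, where
  \<open>1 - d\<close> is the squared modulus of \<open>v\<close>; so half of the contraction
  survives.\<close>

lemma sq_norm_perturb:
  assumes y: "y \<in> carrier_vec n" and z: "z \<in> carrier_vec n" and v: "cmod v < 1"
  defines "d \<equiv> 1 - (cmod v)\<^sup>2"
  shows "sq_norm (v \<cdot>\<^sub>v y + z) \<le> (1 - d / 2) * sq_norm y + (1 + 2 / d) * sq_norm z"
proof -
  have d: "0 < d" "d \<le> 1" using v by (auto simp: d_def abs_square_less_1)
  have pt: "(cmod (v * a + b))\<^sup>2 \<le> (1 - d / 2) * (cmod a)\<^sup>2 + (1 + 2 / d) * (cmod b)\<^sup>2" for a b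
  proof -
    let ?a = "cmod v * cmod a" let ?b = "cmod b"
    have "cmod (v * a + b) \<le> ?a + ?b" by (metis norm_mult norm_triangle_ineq)
    then have "(cmod (v * a + b))\<^sup>2 \<le> (?a + ?b)\<^sup>2" by (intro power_mono) auto
    also have "\<dots> \<le> (1 + d / 2) * ?a\<^sup>2 + (1 + 2 / d) * ?b\<^sup>2"
    proof -
      have "0 \<le> (d * ?a - 2 * ?b)\<^sup>2 / (2 * d)" using d by simp
      also have "\<dots> = (1 + d / 2) * ?a\<^sup>2 + (1 + 2 / d) * ?b\<^sup>2 - (?a + ?b)\<^sup>2"
        using d by (simp add: field_simps power2_eq_square)
      finally show ?thesis by simp
    qed
    also have "(1 + d / 2) * ?a\<^sup>2 = ((1 + d / 2) * (1 - d)) * (cmod a)\<^sup>2"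
      by (simp add: d_def power_mult_distrib)
    also have "(1 + d / 2) * (1 - d) \<le> 1 - d / 2"
    proof -
      have "(1 - d / 2) - (1 + d / 2) * (1 - d) = d * d / 2" by (simp add: field_simps)
      then show ?thesis using mult_pos_pos[OF d(1) d(1)] by linarith
    qed
    finally show ?thesis by (simp add: mult_right_mono)
  qed
  have "sq_norm (v \<cdot>\<^sub>v y + z) = (\<Sum>i<n. (cmod ((v \<cdot>\<^sub>v y + z) $ i))\<^sup>2)"
    using y z by (intro sq_norm_eq_sum) simp
  also have "\<dots> \<le> (\<Sum>i<n. (1 - d / 2) * (cmod (y $ i))\<^sup>2 + (1 + 2 / d) * (cmod (z $ i))\<^sup>2)"
    using y z pt by (intro sum_mono) simp
  also have "\<dots> = (1 - d / 2) * sq_norm y + (1 + 2 / d) * sq_norm z"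
    unfolding sq_norm_eq_sum[OF y] sq_norm_eq_sum[OF z] by (simp add: sum.distrib sum_distrib_left)
  finally show ?thesis .
qed

text \<open>The Lyapunov function grows by one linear factor at a time: with \<open>z = (V - v) y\<close>, a form \<open>p\<close> for the
  remaining factors is extended to \<open>c |y|\<^sup>2 + K p(z)\<close>, where \<open>K\<close> absorbs the cross terms of \<open>|v y + z|\<^sup>2\<close>.\<close>

lemma stable_quad_form:
  assumes V: "V \<in> carrier_mat n n" and "\<And>e. e \<in> set es \<Longrightarrow> cmod e < 1"
  shows "\<exists>q. quad_form n q \<and> (\<forall>y \<in> carrier_vec n. shifts V es y = 0\<^sub>v n \<longrightarrow> q (V *\<^sub>v y) \<le> q y - sq_norm y)"
  using assms(2)
proof (induction es)
  case Nil
  show ?case using V by (intro exI[of _ "\<lambda>x. 0"]) (auto simp: quad_form_zero)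
next
  case (Cons v es)
  then obtain p where p: "quad_form n p"
    and dec: "\<And>y. y \<in> carrier_vec n \<Longrightarrow> shifts V es y = 0\<^sub>v n \<Longrightarrow> p (V *\<^sub>v y) \<le> p y - sq_norm y"
    by auto
  define d where "d = 1 - (cmod v)\<^sup>2"
  have d: "d > 0" using Cons.prems[of v] by (simp add: d_def abs_square_less_1)
  \<comment> \<open>The surviving contraction is \<open>d / 2\<close>, so \<open>c = 2 / d\<close>
    turns it into a decrease by exactly one \<open>sq_norm y\<close>; \<open>K\<close> makes the
    decrease of \<open>p\<close> at \<open>z\<close> cancel the error term in
    \<open>sq_norm z\<close>.\<close>
  define c where "c = 2 / d"
  define K where "K = c * (1 + 2 / d)"
  have cK: "c \<ge> 0" "K \<ge> 0" using d by (auto simp: c_def K_def)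
  let ?q = "\<lambda>y. c * sq_norm y + K * p (shifts V [v] y)"
  have "quad_form n ?q"
    by (intro quad_form_add quad_form_scale quad_form_sq_norm quad_form_shifts V p cK)
  moreover have "?q (V *\<^sub>v y) \<le> ?q y - sq_norm y"
    if y: "y \<in> carrier_vec n" and 0: "shifts V (v # es) y = 0\<^sub>v n" for y
  proof -
    define z where "z = shifts V [v] y"
    have z: "z \<in> carrier_vec n" using V y by (simp add: z_def)
    have Vy: "V *\<^sub>v y = v \<cdot>\<^sub>v y + z" using V y by (auto simp: z_def intro!: eq_vecI)
    have "K * p (V *\<^sub>v z) \<le> K * (p z - sq_norm z)"
      using dec[OF z] 0 cK by (intro mult_left_mono) (auto simp: z_def)
    moreover have "c * sq_norm (V *\<^sub>v y) \<le> c * ((1 - d / 2) * sq_norm y + (1 + 2 / d) * sq_norm z)"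
      unfolding Vy using sq_norm_perturb[OF y z] Cons.prems[of v] cK
      by (intro mult_left_mono) (auto simp: d_def)
    moreover have "c * ((1 - d / 2) * sq_norm y + (1 + 2 / d) * sq_norm z)
        = c * sq_norm y - sq_norm y + K * sq_norm z"
      using d by (simp add: c_def K_def field_simps)
    moreover have "?q (V *\<^sub>v y) = c * sq_norm (V *\<^sub>v y) + K * p (V *\<^sub>v z)"
      by (simp only: z_def shifts_mult[OF V y])
    moreover have "?q y = c * sq_norm y + K * p z" by (simp only: z_def)
    moreover have "K * (p z - sq_norm z) = K * p z - K * sq_norm z" by (rule right_diff_distrib)
    ultimately show ?thesis by linarith
  qed
  ultimately show ?case by blast
qed

section \<open>Forms that do not increase under the Cayley transform\<close>

lemma shifts_eigenvector:
  fixes V :: "complex mat"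
  assumes V: "V \<in> carrier_mat n n" and y: "y \<in> carrier_vec n" and eig: "V *\<^sub>v y - e \<cdot>\<^sub>v y = 0\<^sub>v n"
  shows "V *\<^sub>v y = e \<cdot>\<^sub>v y"
  using vec_minus_eq_0_iff[of "V *\<^sub>v y" n "e \<cdot>\<^sub>v y"] V y eig by simp

text \<open>The matrix \<open>V\<close> satisfies a polynomial equation whose roots, listed with multiplicity, are those
  of a Cayley transform with (i) to (iv): infinity corresponds to -1, and 0 to 1.\<close>

locale cayley_spectrum =
  fixes n :: nat and V :: "complex mat" and es :: "complex list"
  assumes V: "V \<in> carrier_mat n n"
    and annihilates: "\<And>y. y \<in> carrier_vec n \<Longrightarrow> shifts V es y = 0\<^sub>v n"
    and disc: "\<And>e. e \<in> set es \<Longrightarrow> cmod e \<le> 1"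
    and simple: "\<And>e. cmod e = 1 \<Longrightarrow> e \<noteq> 1 \<Longrightarrow> e \<noteq> - 1 \<Longrightarrow> count (mset es) e \<le> 1"
    and double: "count (mset es) 1 \<le> 2" "count (mset es) (- 1) \<le> 2"
begin

text \<open>Surplus factors keep a zero vector at zero, so the upper bound \<open>k\<close> can
  stand in for the exact multiplicity.\<close>

lemma shifts_split:
  assumes "count (mset es) e \<le> k" and y: "y \<in> carrier_vec n"
  shows "shifts V (filter (\<lambda>x. x \<noteq> e) es @ replicate k e) y = 0\<^sub>v n"
proof -
  let ?m = "count (mset es) e"
  have "mset (filter (\<lambda>x. x \<noteq> e) es @ replicate ?m e) = mset es"
    by (induction es) auto
  then have "shifts V (filter (\<lambda>x. x \<noteq> e) es @ replicate ?m e) y = 0\<^sub>v n"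
    using shifts_mset[OF V y] annihilates[OF y] by metis
  moreover have "replicate k e = replicate ?m e @ replicate (k - ?m) e"
    using assms(1) by (simp flip: replicate_add)
  ultimately show ?thesis
    by (metis append_assoc shifts_append shifts_zero[OF V])
qed

text \<open>The last clause says, through root lists, that \<open>V x - x\<close> has no component
  in the generalized eigenspace at \<open>e\<close>. The value -1 is excluded because a double root
  there would give this only for \<open>V x + x\<close>.\<close>

lemma exists_invariant_form:
  assumes e: "e \<noteq> - 1"
  shows "\<exists>q. quad_form n q \<and> (\<forall>x \<in> carrier_vec n. q (V *\<^sub>v x) \<le> q x) \<and>
    (\<forall>x \<in> carrier_vec n. q x = 0 \<longrightarrow> (\<exists>fs. e \<notin> set fs \<and> shifts V fs (V *\<^sub>v x - x) = 0\<^sub>v n))"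
proof -
  have c: "V *\<^sub>v x - x \<in> carrier_vec n" if "x \<in> carrier_vec n" for x using V that by simp
  have one: "shifts V fs (V *\<^sub>v x - x) = V *\<^sub>v shifts V fs x - shifts V fs x" if "x \<in> carrier_vec n" for fs x
    using shifts_shift[OF V that, of fs 1] by simp
  \<comment> \<open>If the polynomial with roots \<open>gs\<close> maps everything into eigenvectors
    for a unimodular \<open>e\<close>, then \<open>V\<close> preserves the norm of its values; this
    covers 1 and the other points of the circle.\<close>
  have invariant: ?thesis if e1: "cmod e = 1" and fs: "e \<notin> set fs"
    and eig: "\<And>x. x \<in> carrier_vec n \<Longrightarrow> V *\<^sub>v shifts V gs x = e \<cdot>\<^sub>v shifts V gs x"
    and ker: "\<And>x. x \<in> carrier_vec n \<Longrightarrow> shifts V gs x = 0\<^sub>v n \<Longrightarrow> shifts V fs (V *\<^sub>v x - x) = 0\<^sub>v n"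
    for fs gs
  proof (intro exI[of _ "\<lambda>x. sq_norm (shifts V gs x)"] conjI ballI impI)
    show "quad_form n (\<lambda>x. sq_norm (shifts V gs x))"
      by (rule quad_form_shifts[OF V quad_form_sq_norm])
    fix x :: "complex vec" assume x: "x \<in> carrier_vec n"
    show "sq_norm (shifts V gs (V *\<^sub>v x)) \<le> sq_norm (shifts V gs x)"
      unfolding shifts_mult[OF V x] eig[OF x] sq_norm_smult[OF shifts_carrier[OF V x]] using e1 by simp
    assume "sq_norm (shifts V gs x) = 0"
    then have "shifts V gs x = 0\<^sub>v n" using sq_norm_eq_0_iff[OF shifts_carrier[OF V x]] by simp
    then show "\<exists>fs. e \<notin> set fs \<and> shifts V fs (V *\<^sub>v x - x) = 0\<^sub>v n"
      using ker[OF x] fs by blast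
  qed
  consider (out) "e \<notin> set es" | (stable) "e \<in> set es" "cmod e < 1" | (one) "e = 1"
    | (unimodular) "cmod e = 1" "e \<noteq> 1"
    using disc[of e] by force
  then show ?thesis
  proof cases
    case out
    then show ?thesis
      using annihilates c quad_form_zero by (intro exI[of _ "\<lambda>x. 0"]) auto
  next
    case stable
    \<comment> \<open>The factors at the unimodular roots \<open>s\<close> push every vector into
      the stable part, where the Lyapunov form decreases strictly. If the form vanishes at a vector,
      that vector is therefore killed by \<open>s\<close>, which does not contain
      \<open>e\<close>.\<close>
    define s where "s = filter (\<lambda>x. \<not> cmod x < 1) es"
    define t where "t = filter (\<lambda>x. cmod x < 1) es"
    obtain p where p: "quad_form n p"
      and dec: "\<And>y. y \<in> carrier_vec n \<Longrightarrow> shifts V t y = 0\<^sub>v n \<Longrightarrow> p (V *\<^sub>v y) \<le> p y - sq_norm y"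
      using stable_quad_form[OF V, of t] by (auto simp: t_def)
    have "mset es = mset (s @ t)" unfolding s_def t_def by (induction es) auto
    then have st: "shifts V t (shifts V s x) = 0\<^sub>v n" if "x \<in> carrier_vec n" for x
      using shifts_mset[OF V that] annihilates[OF that] by (metis shifts_append)
    have desc: "p (V *\<^sub>v shifts V s x) \<le> p (shifts V s x) - sq_norm (shifts V s x)" if "x \<in> carrier_vec n" for x
      using dec st that V by simp
    show ?thesis
    proof (intro exI[of _ "\<lambda>x. p (shifts V s x)"] conjI ballI impI)
      show "quad_form n (\<lambda>x. p (shifts V s x))" by (rule quad_form_shifts[OF V p])
      fix x :: "complex vec" assume x: "x \<in> carrier_vec n"
      have sx: "shifts V s x \<in> carrier_vec n" using V x by simp
      show "p (shifts V s (V *\<^sub>v x)) \<le> p (shifts V s x)"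
        unfolding shifts_mult[OF V x] using desc[OF x] sq_norm_nonneg[OF sx] by linarith
      assume "p (shifts V s x) = 0"
      then have "sq_norm (shifts V s x) = 0"
        using desc[OF x] sq_norm_nonneg[OF sx] quad_form_nonneg[OF p, of "V *\<^sub>v shifts V s x"] V sx by simp
      then have "shifts V s x = 0\<^sub>v n" using sq_norm_eq_0_iff[OF sx] by simp
      then have "shifts V s (V *\<^sub>v x - x) = 0\<^sub>v n" using one[OF x] V by auto
      moreover have "e \<notin> set s" using stable by (simp add: s_def)
      ultimately show "\<exists>fs. e \<notin> set fs \<and> shifts V fs (V *\<^sub>v x - x) = 0\<^sub>v n" by blast
    qed
  next
    case one
    \<comment> \<open>With a double root, \<open>r\<close> alone leaves chains of length two, so one
      factor \<open>V - 1\<close> is added to reach eigenvectors. It is paid for by the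
      \<open>V x - x\<close> in the conclusion.\<close>
    define r where "r = filter (\<lambda>x. x \<noteq> 1) es"
    have split: "shifts V (r @ replicate 2 1) x = 0\<^sub>v n" if "x \<in> carrier_vec n" for x
      using shifts_split[OF double(1) that] by (simp add: r_def)
    show ?thesis
    proof (rule invariant[of r "1 # r"])
      fix x :: "complex vec" assume x: "x \<in> carrier_vec n"
      have rx: "shifts V r x \<in> carrier_vec n" using V x by simp
      have eq: "shifts V (1 # r) x = V *\<^sub>v shifts V r x - shifts V r x"
        using shifts_shift[OF V x, of r 1] rx by simp
      have "shifts V (1 # r) x \<in> carrier_vec n" using V x by simp
      then have "V *\<^sub>v shifts V (1 # r) x - 1 \<cdot>\<^sub>v shifts V (1 # r) x = 0\<^sub>v n"
        unfolding eq using split[OF x] rx by (simp add: shifts_append numeral_2_eq_2)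
      then show "V *\<^sub>v shifts V (1 # r) x = e \<cdot>\<^sub>v shifts V (1 # r) x"
        unfolding \<open>e = 1\<close> by (intro shifts_eigenvector[OF V]) (use V x in auto)
      show "shifts V (1 # r) x = 0\<^sub>v n \<Longrightarrow> shifts V r (V *\<^sub>v x - x) = 0\<^sub>v n"
        using x by simp
    qed (use one in \<open>auto simp: r_def\<close>)
  next
    case unimodular
    define r where "r = filter (\<lambda>x. x \<noteq> e) es"
    have split: "shifts V (r @ replicate 1 e) x = 0\<^sub>v n" if "x \<in> carrier_vec n" for x
      using shifts_split[OF simple[OF unimodular assms] that] by (simp add: r_def)
    show ?thesis
    proof (rule invariant[of r r])
      fix x :: "complex vec" assume x: "x \<in> carrier_vec n"
      show "V *\<^sub>v shifts V r x = e \<cdot>\<^sub>v shifts V r x"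
        using split[OF x] by (intro shifts_eigenvector[OF V]) (use V x in \<open>auto simp: shifts_append\<close>)
      show "shifts V r x = 0\<^sub>v n \<Longrightarrow> shifts V r (V *\<^sub>v x - x) = 0\<^sub>v n"
        using one[OF x] V by auto
    qed (use unimodular in \<open>auto simp: r_def\<close>)
  qed
qed

text \<open>The forms of the individual roots are summed; since all are nonnegative, a zero of the
  sum is a zero of each.\<close>

lemma exists_lyapunov_form:
  "\<exists>q. quad_form n q \<and> (\<forall>x \<in> carrier_vec n. q (V *\<^sub>v x) \<le> q x) \<and>
    (\<forall>x \<in> carrier_vec n. q x = 0 \<longrightarrow>
      (\<forall>e \<in> set es - {- 1}. \<exists>fs. e \<notin> set fs \<and> shifts V fs (V *\<^sub>v x - x) = 0\<^sub>v n))"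
proof -
  have "finite B \<Longrightarrow> B \<subseteq> - {- 1} \<Longrightarrow>
    \<exists>q. quad_form n q \<and> (\<forall>x \<in> carrier_vec n. q (V *\<^sub>v x) \<le> q x) \<and>
      (\<forall>x \<in> carrier_vec n. q x = 0 \<longrightarrow>
        (\<forall>e \<in> B. \<exists>fs. e \<notin> set fs \<and> shifts V fs (V *\<^sub>v x - x) = 0\<^sub>v n))" for B
  proof (induction B rule: finite_induct)
    case empty
    show ?case using quad_form_zero by (intro exI[of _ "\<lambda>x. 0"]) auto
  next
    case (insert e B)
    obtain p where p: "quad_form n p" "\<And>x. x \<in> carrier_vec n \<Longrightarrow> p (V *\<^sub>v x) \<le> p x"
      "\<And>x. x \<in> carrier_vec n \<Longrightarrow> p x = 0 \<Longrightarrow>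
        \<forall>e \<in> B. \<exists>fs. e \<notin> set fs \<and> shifts V fs (V *\<^sub>v x - x) = 0\<^sub>v n"
      using insert by auto
    obtain q where q: "quad_form n q" "\<And>x. x \<in> carrier_vec n \<Longrightarrow> q (V *\<^sub>v x) \<le> q x"
      "\<And>x. x \<in> carrier_vec n \<Longrightarrow> q x = 0 \<Longrightarrow>
        \<exists>fs. e \<notin> set fs \<and> shifts V fs (V *\<^sub>v x - x) = 0\<^sub>v n"
      using exists_invariant_form[of e] insert by auto
    show ?case
    proof (intro exI[of _ "\<lambda>x. p x + q x"] conjI ballI impI)
      show "quad_form n (\<lambda>x. p x + q x)" by (rule quad_form_add[OF p(1) q(1)])
      fix x :: "complex vec" assume x: "x \<in> carrier_vec n"
      show "p (V *\<^sub>v x) + q (V *\<^sub>v x) \<le> p x + q x" using p(2)[OF x] q(2)[OF x] by linarith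
      fix a assume "p x + q x = 0" "a \<in> insert e B"
      moreover from this have "p x = 0" "q x = 0"
        using quad_form_nonneg[OF p(1) x] quad_form_nonneg[OF q(1) x] by auto
      ultimately show "\<exists>fs. a \<notin> set fs \<and> shifts V fs (V *\<^sub>v x - x) = 0\<^sub>v n"
        using p(3)[OF x] q(3)[OF x] by blast
    qed
  qed
  from this[of "set es - {- 1}"] show ?thesis by blast
qed

text \<open>The polynomials killing \<open>y\<close> form an ideal; if they have no common root, it is everything.\<close>

lemma eq_0_if_coprime_annihilators:
  assumes y: "y \<in> carrier_vec n"
    and ann: "\<And>e. e \<in> set es \<Longrightarrow> \<exists>fs. e \<notin> set fs \<and> shifts V fs y = 0\<^sub>v n"
  shows "y = 0\<^sub>v n"
proof -
  \<comment> \<open>On an eigenvector for \<open>e\<close> the factors act as the non-zero scalars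
    \<open>e - f\<close>.\<close>
  have inj: "shifts V fs w = 0\<^sub>v n \<Longrightarrow> V *\<^sub>v w = e \<cdot>\<^sub>v w \<Longrightarrow> e \<notin> set fs \<Longrightarrow> w = 0\<^sub>v n"
    if "w \<in> carrier_vec n" for fs e w
    using that
  proof (induction fs arbitrary: w)
    case (Cons f fs)
    have "V *\<^sub>v w - f \<cdot>\<^sub>v w = (e - f) \<cdot>\<^sub>v w"
      unfolding Cons.prems(2) by (intro eq_vecI) (auto simp: algebra_simps)
    then have "shifts V (f # fs) w = (e - f) \<cdot>\<^sub>v shifts V fs w"
      using shifts_smult[OF V Cons.prems(4)] by simp
    then have "(e - f) \<cdot>\<^sub>v shifts V fs w = 0\<^sub>v n" using Cons.prems by simp
    then have "shifts V fs w = 0\<^sub>v n"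
      using Cons.prems V shifts_carrier[OF V Cons.prems(4), of fs] by (auto simp: vec_eq_iff)
    then show ?case using Cons by simp
  qed simp
  \<comment> \<open>Roots are removed one by one: the vector left before the factor of
    \<open>e\<close> is an eigenvector for \<open>e\<close>, and it is also killed by a list
    avoiding \<open>e\<close>, so \<open>inj\<close> makes it zero.\<close>
  have "shifts V gs y = 0\<^sub>v n \<Longrightarrow> set gs \<subseteq> set es \<Longrightarrow> y = 0\<^sub>v n" for gs
  proof (induction gs)
    case Nil
    then show ?case by simp
  next
    case (Cons e gs)
    obtain fs where fs: "e \<notin> set fs" "shifts V fs y = 0\<^sub>v n" using ann[of e] Cons.prems by auto
    let ?w = "shifts V gs y"
    have w: "?w \<in> carrier_vec n" using V y by simp
    have "V *\<^sub>v ?w - e \<cdot>\<^sub>v ?w = 0\<^sub>v n" using shifts_shift[OF V y, of gs e] Cons.prems by simp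
    then have eig: "V *\<^sub>v ?w = e \<cdot>\<^sub>v ?w" by (rule shifts_eigenvector[OF V w])
    have "shifts V fs ?w = shifts V gs (shifts V fs y)"
      using shifts_mset[OF V y, of "gs @ fs" "fs @ gs"] by (simp add: shifts_append)
    then have "?w = 0\<^sub>v n" using inj[OF w _ eig fs(1)] fs(2) V by simp
    then show ?case using Cons by simp
  qed
  then show ?thesis using annihilates[OF y] by blast
qed

end

text \<open>The factors of \<open>e\<close> and its conjugate multiply to a quadratic polynomial
  with real coefficients. Appending all conjugates makes the product real whether or not
  \<open>r\<close> is closed under conjugation, at the price of additional roots.\<close>

lemma real_matrix_of_conjugate_shifts:
  assumes V: "V \<in> carrier_mat n n"
  shows "\<exists>u \<in> carrier_mat n n. \<forall>y \<in> carrier_vec n.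
    complex_mat u *\<^sub>v y = shifts (complex_mat V) (r @ map cnj r) y"
proof (induction r)
  case Nil
  have "complex_mat (1\<^sub>m n) = (1\<^sub>m n :: complex mat)" by (intro eq_matI) auto
  then show ?case by (intro bexI[of _ "1\<^sub>m n"]) auto
next
  case (Cons e r)
  let ?V = "complex_mat V"
  have cV: "?V \<in> carrier_mat n n" using V by simp
  obtain u where u: "u \<in> carrier_mat n n"
    and eq: "\<And>y. y \<in> carrier_vec n \<Longrightarrow> complex_mat u *\<^sub>v y = shifts ?V (r @ map cnj r) y"
    using Cons by blast
  define F where "F = V * V - (2 * Re e) \<cdot>\<^sub>m V + (cmod e)\<^sup>2 \<cdot>\<^sub>m 1\<^sub>m n"
  have F: "F \<in> carrier_mat n n" using V by (simp add: F_def)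
  have cone: "complex_mat (1\<^sub>m n) = (1\<^sub>m n :: complex mat)" by (intro eq_matI) auto
  have cF: "complex_mat F = ?V * ?V - complex_of_real (2 * Re e) \<cdot>\<^sub>m ?V + complex_of_real ((cmod e)\<^sup>2) \<cdot>\<^sub>m 1\<^sub>m n"
    unfolding F_def using V
    by (simp add: complex_mat_hom(1)[of _ n n _ n] complex_mat_hom(2,3)[of _ n n] complex_mat_hom(4) cone
        del: of_real_mult of_real_power)
  have "complex_mat (u * F) *\<^sub>v y = shifts ?V ((e # r) @ map cnj (e # r)) y" if y: "y \<in> carrier_vec n" for y
  proof -
    have Vy: "?V *\<^sub>v y \<in> carrier_vec n" using V y by simp
    have Fy: "complex_mat F *\<^sub>v y = ?V *\<^sub>v (?V *\<^sub>v y) - (e + cnj e) \<cdot>\<^sub>v (?V *\<^sub>v y) + (e * cnj e) \<cdot>\<^sub>v y"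
      unfolding cF complex_add_cnj[symmetric] complex_norm_square using V y
      by (simp add: add_mult_distrib_mat_vec[of _ n n] minus_mult_distrib_mat_vec[of _ n n]
          smult_mat_mult_vec[of _ n n] assoc_mult_mat_vec[of _ n n _ n])
    have "shifts ?V [e, cnj e] y = ?V *\<^sub>v (?V *\<^sub>v y) - e \<cdot>\<^sub>v (?V *\<^sub>v y) - cnj e \<cdot>\<^sub>v (?V *\<^sub>v y - e \<cdot>\<^sub>v y)"
      using V y Vy by (simp add: mult_minus_distrib_mat_vec[of _ n n] mult_mat_vec[of _ n n])
    also have "\<dots> = complex_mat F *\<^sub>v y"
      unfolding Fy using V y Vy
      by (intro eq_vecI) (auto simp del: index_mult_mat_vec simp: algebra_simps)
    finally have "complex_mat u *\<^sub>v (complex_mat F *\<^sub>v y) = shifts ?V ([e, cnj e] @ r @ map cnj r) y"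
      using eq[of "complex_mat F *\<^sub>v y"] F y by (simp add: shifts_append)
    also have "\<dots> = shifts ?V ((e # r) @ map cnj (e # r)) y"
      by (rule shifts_mset[OF cV y]) simp
    finally show ?thesis
      using u F y complex_mat_hom(1)[OF u F] by (simp add: assoc_mult_mat_vec[of _ n n _ n])
  qed
  then show ?case using u F by (intro bexI[of _ "u * F"]) auto
qed

subsection \<open>The eigenvalue -1\<close>

text \<open>The contribution \<open>Y\<close> of the eigenvalue -1 to \<open>Q\<close>. Here \<open>u\<close> is a polynomial in \<open>V\<close> that vanishes on
  the other generalized eigenspaces, \<open>N = (V + 1) u\<close> has square zero, and \<open>z\<close> has kernel the range
  of \<open>N\<close>.\<close>

lemma exists_nilpotent_part:
  fixes V u :: "real mat"
  assumes V: "V \<in> carrier_mat n n" and u: "u \<in> carrier_mat n n"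
    and comm: "\<And>x. x \<in> carrier_vec n \<Longrightarrow> u *\<^sub>v (V *\<^sub>v x) = V *\<^sub>v (u *\<^sub>v x)"
    and nil: "\<And>x. x \<in> carrier_vec n \<Longrightarrow>
      V *\<^sub>v (V *\<^sub>v (u *\<^sub>v x) + u *\<^sub>v x) + (V *\<^sub>v (u *\<^sub>v x) + u *\<^sub>v x) = 0\<^sub>v n"
  shows "\<exists>Y \<in> carrier_mat n n.
    (\<forall>x \<in> carrier_vec n. \<forall>y \<in> carrier_vec n.
      (Y *\<^sub>v x) \<bullet> (V *\<^sub>v y + y) = (V *\<^sub>v x + x) \<bullet> (Y *\<^sub>v y)) \<and>
    (\<forall>x \<in> carrier_vec n. (Y *\<^sub>v x) \<bullet> (V *\<^sub>v x + x) \<ge> 0 \<and> (Y *\<^sub>v x) \<bullet> (V *\<^sub>v x - x) \<le> 0 \<and>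
      (Y *\<^sub>v x = 0\<^sub>v n \<longrightarrow> u *\<^sub>v x = 0\<^sub>v n))"
proof -
  define m where "m x = V *\<^sub>v x + x" for x
  have m [simp]: "m x \<in> carrier_vec n" if "x \<in> carrier_vec n" for x using V that by (simp add: m_def)
  define N where "N = (V + 1\<^sub>m n) * u"
  have N: "N \<in> carrier_mat n n" unfolding N_def using V u by (intro mult_carrier_mat) auto
  have um: "u *\<^sub>v m x = m (u *\<^sub>v x)" if "x \<in> carrier_vec n" for x
    using u V that comm[OF that] by (simp add: m_def mult_add_distrib_mat_vec[of _ n n])
  have Nmul: "N *\<^sub>v x = m (u *\<^sub>v x)" if "x \<in> carrier_vec n" for x
    using V u that by (simp add: N_def m_def assoc_mult_mat_vec[of _ n n _ n] add_mult_distrib_mat_vec[of _ n n])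
  have mm: "m (m (u *\<^sub>v x)) = 0\<^sub>v n" if "x \<in> carrier_vec n" for x
    using nil[OF that] by (simp add: m_def)
  have m0: "m (0\<^sub>v n) = 0\<^sub>v n" using V by (auto simp: m_def)
  have Nm: "N *\<^sub>v m x = 0\<^sub>v n" if "x \<in> carrier_vec n" for x
    using that by (simp add: Nmul um mm)
  have um': "u *\<^sub>v m x = N *\<^sub>v x" if "x \<in> carrier_vec n" for x
    using that by (simp add: Nmul um)
  obtain G where G: "G \<in> carrier_mat n n"
    and NGN: "\<And>x. x \<in> carrier_vec n \<Longrightarrow> N *\<^sub>v (G *\<^sub>v (N *\<^sub>v x)) = N *\<^sub>v x"
    using exists_generalized_inverse[OF N] by blast
  define z where "z = 1\<^sub>m n - N * G"
  have z: "z \<in> carrier_mat n n" using N G by (simp add: z_def)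
  have zmul: "z *\<^sub>v x = x - N *\<^sub>v (G *\<^sub>v x)" if "x \<in> carrier_vec n" for x
    using N G that by (simp add: z_def minus_mult_distrib_mat_vec[of _ n n] assoc_mult_mat_vec[of _ n n _ n])
  have zN: "z *\<^sub>v (N *\<^sub>v x) = 0\<^sub>v n" if "x \<in> carrier_vec n" for x
    using zmul[of "N *\<^sub>v x"] NGN[OF that] N that by simp
  define t where "t = z * u"
  have t: "t \<in> carrier_mat n n" unfolding t_def using z u by (rule mult_carrier_mat)
  have tmul: "t *\<^sub>v x = z *\<^sub>v (u *\<^sub>v x)" if "x \<in> carrier_vec n" for x
    unfolding t_def using z u that by (rule assoc_mult_mat_vec)
  \<comment> \<open>With \<open>m = V + 1\<close> one has \<open>u m = N\<close>,
    \<open>N m = 0\<close> and \<open>t m = 0\<close>, so pairing \<open>Y x\<close> with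
    \<open>m y\<close> leaves only the product of \<open>N x\<close> and \<open>N y\<close>, which
    comes from the skew part. On the diagonal the skew part drops out, and since
    \<open>V - 1 = m - 2\<close> the terms \<open>N\<^sup>T N\<close> and \<open>t\<^sup>T t\<close>
    enter twice with a minus sign, outweighing that product. The term \<open>t\<^sup>T t\<close>
    detects \<open>u x\<close> modulo the range of \<open>N\<close>.\<close>
  define Y where "Y = u\<^sup>T * N - N\<^sup>T * u + N\<^sup>T * N + t\<^sup>T * t"
  have Y: "Y \<in> carrier_mat n n" unfolding Y_def using u N t
    by (intro add_carrier_mat minus_carrier_mat mult_carrier_mat[of _ n n] transpose_carrier_mat[THEN iffD2]) auto
  have c [simp]: "u *\<^sub>v x \<in> carrier_vec n" "N *\<^sub>v x \<in> carrier_vec n" "z *\<^sub>v x \<in> carrier_vec n"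
    "Y *\<^sub>v x \<in> carrier_vec n" "u\<^sup>T *\<^sub>v x \<in> carrier_vec n" "N\<^sup>T *\<^sub>v x \<in> carrier_vec n" "t\<^sup>T *\<^sub>v x \<in> carrier_vec n"
    if "x \<in> carrier_vec n" for x
    using u N z t Y that by auto
  have Ymul: "Y *\<^sub>v x = u\<^sup>T *\<^sub>v (N *\<^sub>v x) - N\<^sup>T *\<^sub>v (u *\<^sub>v x) + N\<^sup>T *\<^sub>v (N *\<^sub>v x) + t\<^sup>T *\<^sub>v (t *\<^sub>v x)"
    if x: "x \<in> carrier_vec n" for x
    unfolding Y_def using u N t x
    by (simp add: add_mult_distrib_mat_vec[of _ n n] minus_mult_distrib_mat_vec[of _ n n]
        assoc_mult_mat_vec[of _ n n _ n])
  have T: "(M\<^sup>T *\<^sub>v a) \<bullet> b = a \<bullet> (M *\<^sub>v b)"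
    if "M \<in> carrier_mat n n" "a \<in> carrier_vec n" "b \<in> carrier_vec n" for M :: "real mat" and a b
    using transpose_vec_mult_scalar[OF that(1,3,2)] .
  have form: "(Y *\<^sub>v x) \<bullet> y = (N *\<^sub>v x) \<bullet> (u *\<^sub>v y) - (u *\<^sub>v x) \<bullet> (N *\<^sub>v y) + (N *\<^sub>v x) \<bullet> (N *\<^sub>v y)
      + (z *\<^sub>v (u *\<^sub>v x)) \<bullet> (z *\<^sub>v (u *\<^sub>v y))"
    if x: "x \<in> carrier_vec n" and y: "y \<in> carrier_vec n" for x y
    unfolding Ymul[OF x] using x y u N t
    by (simp add: add_scalar_prod_distrib[of _ n] minus_scalar_prod_distrib[of _ n] T tmul)
  have form_m: "(Y *\<^sub>v x) \<bullet> m y = (N *\<^sub>v x) \<bullet> (N *\<^sub>v y)"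
    if x: "x \<in> carrier_vec n" and y: "y \<in> carrier_vec n" for x y
    unfolding form[OF x m[OF y]] using x y by (simp add: um' Nm zN)
  have nn: "0 \<le> v \<bullet> v" for v :: "real vec"
    using conjugate_square_ge_0_vec[of v] by simp
  have form_d: "(Y *\<^sub>v x) \<bullet> (V *\<^sub>v x - x) =
      - ((N *\<^sub>v x) \<bullet> (N *\<^sub>v x)) - 2 * ((z *\<^sub>v (u *\<^sub>v x)) \<bullet> (z *\<^sub>v (u *\<^sub>v x)))"
    if x: "x \<in> carrier_vec n" for x
  proof -
    have "V *\<^sub>v x - x = m x - 2 \<cdot>\<^sub>v x" using V x by (auto simp: m_def intro!: eq_vecI)
    then have "(Y *\<^sub>v x) \<bullet> (V *\<^sub>v x - x) = (Y *\<^sub>v x) \<bullet> m x - 2 * ((Y *\<^sub>v x) \<bullet> x)"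
      using x Y by (simp add: scalar_prod_minus_distrib[of _ n])
    then show ?thesis
      unfolding form_m[OF x x] form[OF x x]
      using x comm_scalar_prod[of "u *\<^sub>v x" n "N *\<^sub>v x"] by simp
  qed
  have ker: "u *\<^sub>v x = 0\<^sub>v n" if x: "x \<in> carrier_vec n" and Y0: "Y *\<^sub>v x = 0\<^sub>v n" for x
  proof -
    have "- ((N *\<^sub>v x) \<bullet> (N *\<^sub>v x)) - 2 * ((z *\<^sub>v (u *\<^sub>v x)) \<bullet> (z *\<^sub>v (u *\<^sub>v x))) = 0"
      using form_d[OF x] Y0 V x by simp
    then have "(N *\<^sub>v x) \<bullet> (N *\<^sub>v x) = 0" "(z *\<^sub>v (u *\<^sub>v x)) \<bullet> (z *\<^sub>v (u *\<^sub>v x)) = 0"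
      using nn[of "N *\<^sub>v x"] nn[of "z *\<^sub>v (u *\<^sub>v x)"] by linarith+
    then have Nx: "N *\<^sub>v x = 0\<^sub>v n" and zux: "z *\<^sub>v (u *\<^sub>v x) = 0\<^sub>v n"
      using conjugate_square_eq_0_vec[of "N *\<^sub>v x" n] conjugate_square_eq_0_vec[of "z *\<^sub>v (u *\<^sub>v x)" n] x
      by auto
    \<comment> \<open>As \<open>z\<close> kills \<open>u x\<close>, this vector lies in the range of
      \<open>N\<close>, with preimage \<open>w\<close>. Pairing \<open>Y x\<close> with
      \<open>w\<close> isolates the skew part, which equals minus the squared norm of
      \<open>u x\<close>.\<close>
    define w where "w = G *\<^sub>v (u *\<^sub>v x)"
    have w: "w \<in> carrier_vec n" using G x by (simp add: w_def)
    have uxw: "u *\<^sub>v x = N *\<^sub>v w"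
      using zux zmul[of "u *\<^sub>v x"] vec_minus_eq_0_iff[of "u *\<^sub>v x" n "N *\<^sub>v w"] x w
      by (simp add: w_def)
    have "(Y *\<^sub>v x) \<bullet> w = - ((u *\<^sub>v x) \<bullet> (u *\<^sub>v x))"
      unfolding form[OF x w] Nx zux using x w by (simp add: uxw[symmetric])
    then have "(u *\<^sub>v x) \<bullet> (u *\<^sub>v x) = 0" using Y0 w by simp
    then show ?thesis using conjugate_square_eq_0_vec[of "u *\<^sub>v x" n] x by simp
  qed
  show ?thesis
  proof (intro bexI[OF _ Y] conjI ballI impI)
    fix x y :: "real vec" assume x: "x \<in> carrier_vec n" and y: "y \<in> carrier_vec n"
    have "(Y *\<^sub>v x) \<bullet> m y = m x \<bullet> (Y *\<^sub>v y)"
      using form_m[OF x y] form_m[OF y x] comm_scalar_prod[of "m x" n "Y *\<^sub>v y"]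
        comm_scalar_prod[of "N *\<^sub>v x" n "N *\<^sub>v y"] x y by simp
    then show "(Y *\<^sub>v x) \<bullet> (V *\<^sub>v y + y) = (V *\<^sub>v x + x) \<bullet> (Y *\<^sub>v y)" by (simp add: m_def)
  next
    fix x :: "real vec" assume x: "x \<in> carrier_vec n"
    show "(Y *\<^sub>v x) \<bullet> (V *\<^sub>v x + x) \<ge> 0"
      using form_m[OF x x] nn[of "N *\<^sub>v x"] by (simp add: m_def)
    show "(Y *\<^sub>v x) \<bullet> (V *\<^sub>v x - x) \<le> 0"
      using form_d[OF x] nn[of "N *\<^sub>v x"] nn[of "z *\<^sub>v (u *\<^sub>v x)"] by linarith
    show "Y *\<^sub>v x = 0\<^sub>v n \<Longrightarrow> u *\<^sub>v x = 0\<^sub>v n" using ker[OF x] .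
  qed
qed

section \<open>Real matrices behind \<open>X\<close> and \<open>u\<close>\<close>

abbreviation complex_vec :: "real vec \<Rightarrow> complex vec" where
  "complex_vec \<equiv> map_vec complex_of_real"

lemma complex_vec_simps:
  "x \<in> carrier_vec n \<Longrightarrow> y \<in> carrier_vec n \<Longrightarrow> complex_vec x + complex_vec y = complex_vec (x + y)"
  "x \<in> carrier_vec n \<Longrightarrow> y \<in> carrier_vec n \<Longrightarrow> complex_vec x - complex_vec y = complex_vec (x - y)"
  "complex_vec x = complex_vec y \<longleftrightarrow> x = y"
  "complex_vec x = 0\<^sub>v n \<longleftrightarrow> x = 0\<^sub>v n"
  by (auto simp: vec_eq_iff intro!: eq_vecI)

lemma complex_mat_mult_vec:
  assumes "M \<in> carrier_mat m n" "x \<in> carrier_vec n"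
  shows "complex_mat M *\<^sub>v complex_vec x = complex_vec (M *\<^sub>v x)"
  by (rule of_real_hom.mult_mat_vec_hom[OF assms, symmetric])

lemma exists_real_lyapunov_matrix:
  assumes carrV: "V \<in> carrier_mat n n" and spec: "cayley_spectrum n (complex_mat V) es"
  shows "\<exists>X. real_psd n X \<and> (\<forall>x \<in> carrier_vec n. (V *\<^sub>v x) \<bullet> (X *\<^sub>v (V *\<^sub>v x)) \<le> x \<bullet> (X *\<^sub>v x)) \<and>
    (\<forall>x \<in> carrier_vec n. x \<bullet> (X *\<^sub>v x) = 0 \<longrightarrow> (\<forall>e \<in> set es - {- 1}.
      \<exists>fs. e \<notin> set fs \<and> shifts (complex_mat V) fs (complex_vec (V *\<^sub>v x - x)) = 0\<^sub>v n))"
proof -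
  interpret cayley_spectrum n "complex_mat V" es by fact
  obtain q where q: "quad_form n q" "\<And>x. x \<in> carrier_vec n \<Longrightarrow> q (complex_mat V *\<^sub>v x) \<le> q x"
    "\<And>x. x \<in> carrier_vec n \<Longrightarrow> q x = 0 \<Longrightarrow> \<forall>e \<in> set es - {- 1}.
      \<exists>fs. e \<notin> set fs \<and> shifts (complex_mat V) fs (complex_mat V *\<^sub>v x - x) = 0\<^sub>v n"
    using exists_lyapunov_form by blast
  obtain X where X: "real_psd n X" "\<And>x. x \<in> carrier_vec n \<Longrightarrow> x \<bullet> (X *\<^sub>v x) = q (complex_vec x)"
    using quad_form_real_psd[OF q(1)] by blast
  show ?thesis
  proof (intro exI[of _ X] conjI ballI[where A = "carrier_vec n"] impI)
    show "real_psd n X" by (rule X)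
    fix x :: "real vec" assume x: "x \<in> carrier_vec n"
    have Vx: "V *\<^sub>v x \<in> carrier_vec n" using carrV x by simp
    have cx: "complex_vec x \<in> carrier_vec n" using x by simp
    show "(V *\<^sub>v x) \<bullet> (X *\<^sub>v (V *\<^sub>v x)) \<le> x \<bullet> (X *\<^sub>v x)"
      using q(2)[OF cx] X(2)[OF x] X(2)[OF Vx] complex_mat_mult_vec[OF carrV x] by simp
    assume "x \<bullet> (X *\<^sub>v x) = 0"
    then show "\<forall>e \<in> set es - {- 1}. \<exists>fs. e \<notin> set fs \<and>
        shifts (complex_mat V) fs (complex_vec (V *\<^sub>v x - x)) = 0\<^sub>v n"
      using q(3)[OF cx] X(2)[OF x] complex_mat_mult_vec[OF carrV x] complex_vec_simps(2)[OF Vx x] by simp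
  qed
qed

text \<open>\<open>u\<close> is the product of the factors at all roots other than -1 and at their
  conjugates. It is in general not idempotent but separates the spectrum like a projection: its
  range lies in the kernel of \<open>(V + 1)\<^sup>2\<close>, because -1 is at most a double root,
  and its kernel has no component at -1.\<close>

lemma exists_real_nilpotent_projection:
  assumes carrV: "V \<in> carrier_mat n n" and spec: "cayley_spectrum n (complex_mat V) es"
  shows "\<exists>u \<in> carrier_mat n n. \<forall>x \<in> carrier_vec n.
    u *\<^sub>v (V *\<^sub>v x) = V *\<^sub>v (u *\<^sub>v x) \<and>
    V *\<^sub>v (V *\<^sub>v (u *\<^sub>v x) + u *\<^sub>v x) + (V *\<^sub>v (u *\<^sub>v x) + u *\<^sub>v x) = 0\<^sub>v n \<and>
    (u *\<^sub>v x = 0\<^sub>v n \<longrightarrow> (\<exists>fs. - 1 \<notin> set fs \<and> shifts (complex_mat V) fs (complex_vec x) = 0\<^sub>v n))"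
proof -
  let ?V = "complex_mat V"
  interpret cayley_spectrum n ?V es by fact
  note cV = V
  define r where "r = filter (\<lambda>x. x \<noteq> - 1) es"
  define rr where "rr = r @ map cnj r"
  obtain u where u: "u \<in> carrier_mat n n"
    and eq: "\<And>y. y \<in> carrier_vec n \<Longrightarrow> complex_mat u *\<^sub>v y = shifts ?V rr y"
    using real_matrix_of_conjugate_shifts[OF carrV, of r] unfolding rr_def by blast
  have ueq: "complex_vec (u *\<^sub>v x) = shifts ?V rr (complex_vec x)" if "x \<in> carrier_vec n" for x
    using eq[of "complex_vec x"] complex_mat_mult_vec[OF u that] that by simp
  show ?thesis
  proof (intro bexI[OF _ u] ballI conjI impI)
    fix x :: "real vec" assume x: "x \<in> carrier_vec n"
    have cx: "complex_vec x \<in> carrier_vec n" using x by simp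
    have ux: "u *\<^sub>v x \<in> carrier_vec n" and Vx: "V *\<^sub>v x \<in> carrier_vec n" using u carrV x by auto
    have "complex_vec (u *\<^sub>v (V *\<^sub>v x)) = complex_vec (V *\<^sub>v (u *\<^sub>v x))"
      using ueq[OF Vx] ueq[OF x] complex_mat_mult_vec[OF carrV x] complex_mat_mult_vec[OF carrV ux]
        shifts_mult[OF cV cx, of rr] by simp
    then show "u *\<^sub>v (V *\<^sub>v x) = V *\<^sub>v (u *\<^sub>v x)" by (simp add: complex_vec_simps)
    let ?w = "V *\<^sub>v (u *\<^sub>v x) + u *\<^sub>v x"
    have w: "?w \<in> carrier_vec n" using carrV ux by simp
    have minus: "a - (- 1) \<cdot>\<^sub>v b = a + b" if "a \<in> carrier_vec n" "b \<in> carrier_vec n" for a b :: "complex vec"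
      using that by (auto intro!: eq_vecI)
    have step: "?V *\<^sub>v complex_vec a - (- 1) \<cdot>\<^sub>v complex_vec a = complex_vec (V *\<^sub>v a + a)"
      if "a \<in> carrier_vec n" for a
      using that carrV minus[of "?V *\<^sub>v complex_vec a" "complex_vec a"] complex_mat_mult_vec[OF carrV that]
        complex_vec_simps(1)[of "V *\<^sub>v a" n a] by simp
    have "shifts ?V (rr @ replicate 2 (- 1)) (complex_vec x) = complex_vec (V *\<^sub>v ?w + ?w)"
      using step[OF ux] step[OF w] by (simp add: shifts_append ueq[OF x, symmetric] numeral_2_eq_2)
    also have "shifts ?V (rr @ replicate 2 (- 1)) (complex_vec x) =
        shifts ?V ((r @ replicate 2 (- 1)) @ map cnj r) (complex_vec x)"
      by (rule shifts_mset[OF cV cx]) (simp add: rr_def)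
    also have "\<dots> = 0\<^sub>v n"
      using shifts_split[OF double(2) cx] cV by (simp add: r_def[symmetric] shifts_append)
    finally show "V *\<^sub>v ?w + ?w = 0\<^sub>v n" using complex_vec_simps(4) by metis
    assume "u *\<^sub>v x = 0\<^sub>v n"
    then have "shifts ?V rr (complex_vec x) = 0\<^sub>v n"
      using ueq[OF x] complex_vec_simps(4)[of "u *\<^sub>v x" n] by simp
    \<comment> \<open>As -1 is real, it is not the conjugate of any other number.\<close>
    moreover have "- 1 \<notin> set rr" by (auto simp: rr_def r_def complex_eq_iff)
    ultimately show "\<exists>fs. - 1 \<notin> set fs \<and> shifts ?V fs (complex_vec x) = 0\<^sub>v n" by blast
  qed
qed

subsection \<open>The Cayley transform\<close>

text \<open>A shortest list of roots works: dropping one of them would otherwise still annihilate, so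
  \<open>k\<close> copies of a root leave behind a Jordan chain of length \<open>k\<close>.\<close>

lemma exists_cayley_spectrum:
  fixes V :: "complex mat"
  assumes V: "V \<in> carrier_mat n n"
    and disc: "\<And>y e. y \<in> carrier_vec n \<Longrightarrow> y \<noteq> 0\<^sub>v n \<Longrightarrow> V *\<^sub>v y = e \<cdot>\<^sub>v y \<Longrightarrow> cmod e \<le> 1"
    and simple: "\<And>x y e. x \<in> carrier_vec n \<Longrightarrow> y \<in> carrier_vec n \<Longrightarrow> x \<noteq> 0\<^sub>v n \<Longrightarrow>
      cmod e = 1 \<Longrightarrow> e \<noteq> 1 \<Longrightarrow> e \<noteq> - 1 \<Longrightarrow> V *\<^sub>v x = e \<cdot>\<^sub>v x \<Longrightarrow> V *\<^sub>v y = e \<cdot>\<^sub>v y + x \<Longrightarrow> False"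
    and double: "\<And>x y z e. x \<in> carrier_vec n \<Longrightarrow> y \<in> carrier_vec n \<Longrightarrow> z \<in> carrier_vec n \<Longrightarrow>
      x \<noteq> 0\<^sub>v n \<Longrightarrow> e = 1 \<or> e = - 1 \<Longrightarrow> V *\<^sub>v x = e \<cdot>\<^sub>v x \<Longrightarrow> V *\<^sub>v y = e \<cdot>\<^sub>v y + x \<Longrightarrow>
      V *\<^sub>v z = e \<cdot>\<^sub>v z + y \<Longrightarrow> False"
  shows "\<exists>es. cayley_spectrum n V es"
proof -
  let ?ann = "\<lambda>es. \<forall>y \<in> carrier_vec n. shifts V es y = 0\<^sub>v n"
  obtain es where es: "?ann es" and least: "\<And>fs. ?ann fs \<Longrightarrow> length es \<le> length fs"
    using exists_annihilating_shifts[OF V] ex_has_least_nat[of ?ann _ length] by metis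
  \<comment> \<open>The indices run against those of a Jordan chain: \<open>w (k - 1)\<close> is the
    eigenvector, non-zero by minimality of \<open>es\<close>, and \<open>w 0\<close> is the far
    end.\<close>
  have chain: "\<exists>w. (\<forall>j. w j \<in> carrier_vec n \<and> V *\<^sub>v w j = e \<cdot>\<^sub>v w j + w (Suc j)) \<and>
      w (k - 1) \<noteq> 0\<^sub>v n \<and> w k = 0\<^sub>v n" if k: "count (mset es) e \<ge> k" "k > 0" for e k
  proof -
    obtain fs where fs: "mset fs = mset es - replicate_mset k e" using ex_mset by blast
    have "replicate_mset k e \<subseteq># mset es" using k by (simp add: count_le_replicate_mset_subset_eq)
    then have m: "mset es = mset (fs @ replicate k e)" using fs by simp
    have "\<not> ?ann (fs @ replicate (k - 1) e)"
    proof
      assume "?ann (fs @ replicate (k - 1) e)"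
      from least[OF this] show False using arg_cong[OF m, of size] k by simp
    qed
    then obtain y where y: "y \<in> carrier_vec n" and ne: "shifts V (fs @ replicate (k - 1) e) y \<noteq> 0\<^sub>v n"
      by blast
    define w where "w j = shifts V (fs @ replicate j e) y" for j
    have w: "w j \<in> carrier_vec n" for j using V y by (simp add: w_def)
    have "w (Suc j) = V *\<^sub>v w j - e \<cdot>\<^sub>v w j" for j
    proof -
      have "w (Suc j) = shifts V [e] (w j)"
        unfolding w_def by (simp add: replicate_append_same[symmetric] shifts_append del: replicate_append_same)
      then show ?thesis by simp
    qed
    then have "V *\<^sub>v w j = e \<cdot>\<^sub>v w j + w (Suc j)" for j
      using vec_minus_eq_iff[of "V *\<^sub>v w j" n "e \<cdot>\<^sub>v w j" "w (Suc j)"] V w by simp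
    moreover have "w k = 0\<^sub>v n" unfolding w_def using es y shifts_mset[OF V y m] by simp
    ultimately show ?thesis using w ne by (intro exI[of _ w]) (auto simp: w_def)
  qed
  have plus0: "e \<cdot>\<^sub>v v + 0\<^sub>v n = e \<cdot>\<^sub>v v" if "v \<in> carrier_vec n" for e and v :: "complex vec"
    using that by simp
  have dbl: "count (mset es) e \<le> 2" if e: "e = 1 \<or> e = - 1" for e
  proof (rule ccontr)
    assume "\<not> count (mset es) e \<le> 2"
    then obtain w where w: "\<And>j. w j \<in> carrier_vec n" "\<And>j. V *\<^sub>v w j = e \<cdot>\<^sub>v w j + w (Suc j)"
      "w 2 \<noteq> 0\<^sub>v n" "w 3 = 0\<^sub>v n" using chain[of 3 e] by auto
    have "V *\<^sub>v w 2 = e \<cdot>\<^sub>v w 2" "V *\<^sub>v w 1 = e \<cdot>\<^sub>v w 1 + w 2"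
      using w(2)[of 2] w(2)[of 1] w(1,4) plus0 by (simp_all add: numeral_2_eq_2 numeral_3_eq_3)
    then show False using double[OF w(1)[of 2] w(1)[of 1] w(1)[of 0] w(3) e] w(2)[of 0] by simp
  qed
  have "cayley_spectrum n V es"
  proof
    show "V \<in> carrier_mat n n" by (rule V)
    show "shifts V es y = 0\<^sub>v n" if "y \<in> carrier_vec n" for y using es that by blast
    show "count (mset es) 1 \<le> 2" "count (mset es) (- 1) \<le> 2" using dbl by auto
    show "cmod e \<le> 1" if "e \<in> set es" for e
    proof -
      have "count (mset es) e \<ge> 1" using that by (simp add: Suc_le_eq count_greater_zero_iff)
      then obtain w where w: "\<And>j. w j \<in> carrier_vec n" "\<And>j. V *\<^sub>v w j = e \<cdot>\<^sub>v w j + w (Suc j)"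
        "w 0 \<noteq> 0\<^sub>v n" "w 1 = 0\<^sub>v n" using chain[of 1 e] by auto
      have "V *\<^sub>v w 0 = e \<cdot>\<^sub>v w 0" using w(2)[of 0] w(1,4) plus0 by simp
      then show ?thesis using disc[OF w(1,3)] by blast
    qed
    show "count (mset es) e \<le> 1" if e: "cmod e = 1" "e \<noteq> 1" "e \<noteq> - 1" for e
    proof (rule ccontr)
      assume "\<not> count (mset es) e \<le> 1"
      then obtain w where w: "\<And>j. w j \<in> carrier_vec n" "\<And>j. V *\<^sub>v w j = e \<cdot>\<^sub>v w j + w (Suc j)"
        "w 1 \<noteq> 0\<^sub>v n" "w 2 = 0\<^sub>v n" using chain[of 2 e] by auto
      have "V *\<^sub>v w 1 = e \<cdot>\<^sub>v w 1"
        using w(2)[of 1] w(1,4) plus0 by (simp add: numeral_2_eq_2)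
      then show False using simple[OF w(1)[of 1] w(1)[of 0] w(3) e] w(2)[of 0] by simp
    qed
  qed
  then show ?thesis by blast
qed

text \<open>The inverse Cayley map takes the unit disc to the left half-plane and the circle to the
  imaginary axis; the formula comes from multiplying by the conjugate of the denominator.\<close>

lemma Re_cayley:
  assumes "v \<noteq> - 1"
  shows "Re ((v - 1) / (v + 1)) = ((cmod v)\<^sup>2 - 1) / (cmod (v + 1))\<^sup>2"
proof -
  have "Re ((v - 1) * cnj (v + 1)) = (cmod v)\<^sup>2 - 1"
    by (simp add: cmod_power2) (simp add: algebra_simps power2_eq_square)
  then show ?thesis
    by (subst complex_div_cnj) (metis Re_divide_of_real of_real_power)
qed

text \<open>The Cayley transform \<open>V = (E - A)\<^sup>-\<^sup>1 (E + A)\<close> of the pencil, with \<open>W = E - A\<close>.\<close>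

locale cayley_transform =
  fixes n :: nat and E A W V :: "complex mat"
  assumes carr: "E \<in> carrier_mat n n" "A \<in> carrier_mat n n" "W \<in> carrier_mat n n" "V \<in> carrier_mat n n"
    and E_eq: "\<And>y. y \<in> carrier_vec n \<Longrightarrow> E *\<^sub>v y = (1/2) \<cdot>\<^sub>v (W *\<^sub>v (V *\<^sub>v y + y))"
    and A_eq: "\<And>y. y \<in> carrier_vec n \<Longrightarrow> A *\<^sub>v y = (1/2) \<cdot>\<^sub>v (W *\<^sub>v (V *\<^sub>v y - y))"
    and W_inj: "\<And>y. y \<in> carrier_vec n \<Longrightarrow> W *\<^sub>v y = 0\<^sub>v n \<Longrightarrow> y = 0\<^sub>v n"
begin

text \<open>Expressing both images through \<open>W x\<close> and \<open>W y\<close> reduces the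
  chain conditions of the pencil to identities between scalars.\<close>

lemma chain_images:
  assumes x: "x \<in> carrier_vec n" and y: "y \<in> carrier_vec n" and V: "V *\<^sub>v x = e \<cdot>\<^sub>v x + y"
  shows "E *\<^sub>v x = ((e + 1) / 2) \<cdot>\<^sub>v (W *\<^sub>v x) + (1/2) \<cdot>\<^sub>v (W *\<^sub>v y)"
    and "A *\<^sub>v x = ((e - 1) / 2) \<cdot>\<^sub>v (W *\<^sub>v x) + (1/2) \<cdot>\<^sub>v (W *\<^sub>v y)"
proof -
  have c: "W *\<^sub>v x \<in> carrier_vec n" "W *\<^sub>v y \<in> carrier_vec n" using carr x y by auto
  have lin: "W *\<^sub>v (a \<cdot>\<^sub>v x + y) = a \<cdot>\<^sub>v (W *\<^sub>v x) + W *\<^sub>v y" for a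
    using carr x y by (simp add: mult_add_distrib_mat_vec[of W n n] mult_mat_vec[of W n n])
  have "V *\<^sub>v x + x = (e + 1) \<cdot>\<^sub>v x + y" "V *\<^sub>v x - x = (e - 1) \<cdot>\<^sub>v x + y"
    unfolding V using x y by (auto intro!: eq_vecI simp: algebra_simps)
  then show "E *\<^sub>v x = ((e + 1) / 2) \<cdot>\<^sub>v (W *\<^sub>v x) + (1/2) \<cdot>\<^sub>v (W *\<^sub>v y)"
    "A *\<^sub>v x = ((e - 1) / 2) \<cdot>\<^sub>v (W *\<^sub>v x) + (1/2) \<cdot>\<^sub>v (W *\<^sub>v y)"
    unfolding E_eq[OF x] A_eq[OF x] using carr c lin
    by (auto intro!: eq_vecI simp del: index_mult_mat_vec simp: field_simps)
qed

lemma eigen_images: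
  assumes x: "x \<in> carrier_vec n" and V: "V *\<^sub>v x = e \<cdot>\<^sub>v x"
  shows "E *\<^sub>v x = ((e + 1) / 2) \<cdot>\<^sub>v (W *\<^sub>v x)" "A *\<^sub>v x = ((e - 1) / 2) \<cdot>\<^sub>v (W *\<^sub>v x)"
proof -
  have "W *\<^sub>v 0\<^sub>v n = 0\<^sub>v n" "(1/2) \<cdot>\<^sub>v 0\<^sub>v n = (0\<^sub>v n :: complex vec)" using carr by auto
  moreover have "V *\<^sub>v x = e \<cdot>\<^sub>v x + 0\<^sub>v n" using V x by simp
  ultimately show "E *\<^sub>v x = ((e + 1) / 2) \<cdot>\<^sub>v (W *\<^sub>v x)" "A *\<^sub>v x = ((e - 1) / 2) \<cdot>\<^sub>v (W *\<^sub>v x)"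
    using chain_images[OF x, of "0\<^sub>v n" e] x carr by auto
qed

text \<open>An eigenvalue \<open>e\<close> of \<open>V\<close> corresponds to
  \<open>(e - 1) / (e + 1)\<close>, with -1 corresponding to infinity. Jordan chains of
  \<open>V\<close> become chains of the pencil after a change of coefficients, and since chains
  consist of non-zero vectors, the new vectors have to be checked for this.\<close>

lemma exists_spectrum:
  assumes stable: "\<And>x l. x \<in> carrier_vec n \<Longrightarrow> x \<noteq> 0\<^sub>v n \<Longrightarrow> A *\<^sub>v x = l \<cdot>\<^sub>v (E *\<^sub>v x) \<Longrightarrow> Re l \<le> 0"
    and simple: "\<And>x y l. x \<in> carrier_vec n \<Longrightarrow> y \<in> carrier_vec n \<Longrightarrow> x \<noteq> 0\<^sub>v n \<Longrightarrow> y \<noteq> 0\<^sub>v n \<Longrightarrow>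
      l \<noteq> 0 \<Longrightarrow> Re l = 0 \<Longrightarrow> A *\<^sub>v x = l \<cdot>\<^sub>v (E *\<^sub>v x) \<Longrightarrow>
      A *\<^sub>v y = l \<cdot>\<^sub>v (E *\<^sub>v y) + E *\<^sub>v x \<Longrightarrow> False"
    and at_infinity: "\<And>x y z. x \<in> carrier_vec n \<Longrightarrow> y \<in> carrier_vec n \<Longrightarrow> z \<in> carrier_vec n \<Longrightarrow>
      x \<noteq> 0\<^sub>v n \<Longrightarrow> y \<noteq> 0\<^sub>v n \<Longrightarrow> z \<noteq> 0\<^sub>v n \<Longrightarrow> E *\<^sub>v x = 0\<^sub>v n \<Longrightarrow> E *\<^sub>v y = A *\<^sub>v x \<Longrightarrow>
      E *\<^sub>v z = A *\<^sub>v y \<Longrightarrow> False"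
    and at_zero: "\<And>x y z. x \<in> carrier_vec n \<Longrightarrow> y \<in> carrier_vec n \<Longrightarrow> z \<in> carrier_vec n \<Longrightarrow>
      x \<noteq> 0\<^sub>v n \<Longrightarrow> y \<noteq> 0\<^sub>v n \<Longrightarrow> z \<noteq> 0\<^sub>v n \<Longrightarrow> A *\<^sub>v x = 0\<^sub>v n \<Longrightarrow> A *\<^sub>v y = E *\<^sub>v x \<Longrightarrow>
      A *\<^sub>v z = E *\<^sub>v y \<Longrightarrow> False"
  shows "\<exists>es. cayley_spectrum n V es"
proof (rule exists_cayley_spectrum)
  have c: "W *\<^sub>v x \<in> carrier_vec n" if "x \<in> carrier_vec n" for x using carr that by simp
  show "V \<in> carrier_mat n n" by (rule carr)
  show "cmod e \<le> 1" if y: "y \<in> carrier_vec n" "y \<noteq> 0\<^sub>v n" and V: "V *\<^sub>v y = e \<cdot>\<^sub>v y" for y e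
  proof (cases "e = - 1")
    case False
    then have e: "e + 1 \<noteq> 0" by (simp add: add_eq_0_iff2)
    have "A *\<^sub>v y = ((e - 1) / (e + 1)) \<cdot>\<^sub>v (E *\<^sub>v y)"
      unfolding eigen_images[OF y(1) V] using e by (simp add: smult_smult_assoc)
    then have "Re ((e - 1) / (e + 1)) \<le> 0" using stable y by blast
    then have "(cmod e)\<^sup>2 \<le> 1"
      using Re_cayley[OF False] e by (simp add: divide_le_0_iff)
    then show ?thesis by (simp add: abs_square_le_1)
  qed simp
  show False if x: "x \<in> carrier_vec n" and y: "y \<in> carrier_vec n" and x0: "x \<noteq> 0\<^sub>v n"
    and e: "cmod e = 1" "e \<noteq> 1" "e \<noteq> - 1" and V: "V *\<^sub>v x = e \<cdot>\<^sub>v x" "V *\<^sub>v y = e \<cdot>\<^sub>v y + x" for x y e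
  proof -
    have e1: "e + 1 \<noteq> 0" using e by (simp add: add_eq_0_iff2)
    \<comment> \<open>\<open>?c\<close> is the reciprocal of the derivative of
      \<open>(e - 1) / (e + 1)\<close> with respect to \<open>e\<close>, the factor by which the
      Cayley map stretches the second chain vector.\<close>
    let ?l = "(e - 1) / (e + 1)" and ?c = "(e + 1)\<^sup>2 / 2"
    have y0: "y \<noteq> 0\<^sub>v n"
    proof
      assume "y = 0\<^sub>v n"
      then have "V *\<^sub>v y = 0\<^sub>v n" "e \<cdot>\<^sub>v y = 0\<^sub>v n" using carr by auto
      then show False using V(2) x0 x by simp
    qed
    have cy: "?c \<cdot>\<^sub>v y \<in> carrier_vec n" using y by simp
    have cy0: "?c \<cdot>\<^sub>v y \<noteq> 0\<^sub>v n" using y y0 e1 by (auto simp: vec_eq_iff)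
    have l: "?l \<noteq> 0" "Re ?l = 0" using e e1 Re_cayley[OF e(3)] by auto
    have "A *\<^sub>v x = ?l \<cdot>\<^sub>v (E *\<^sub>v x)"
      unfolding eigen_images[OF x V(1)] using e1 by (simp add: smult_smult_assoc)
    moreover have "A *\<^sub>v (?c \<cdot>\<^sub>v y) = ?l \<cdot>\<^sub>v (E *\<^sub>v (?c \<cdot>\<^sub>v y)) + E *\<^sub>v x"
    proof -
      have "?c * ((e - 1) / 2) = ?l * (?c * ((e + 1) / 2))"
        using e1 by (simp add: power2_eq_square)
      moreover have "?c * (1/2) = ?l * (?c * (1/2)) + (e + 1) / 2"
      proof -
        have "s\<^sup>2 / 2 * (1/2) = (s - 2) / s * (s\<^sup>2 / 2 * (1/2)) + s / 2" if "s \<noteq> 0" for s :: complex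
          using that by (simp add: field_simps power2_eq_square)
        from this[OF e1] show ?thesis by (simp only: add_diff_eq[symmetric]) simp
      qed
      moreover have "p * a + h * b = ?l * (p' * a + h' * b) + t * b"
        if "p = ?l * p'" "h = ?l * h' + t" for p p' h h' t a b :: complex
        unfolding that by (simp only: distrib_left distrib_right mult.assoc add.assoc)
      ultimately have "?c * ((e - 1) / 2) * a + ?c * (1/2) * b =
          ?l * (?c * ((e + 1) / 2) * a + ?c * (1/2) * b) + (e + 1) / 2 * b" for a b
        by blast
      then have scal: "?c * ((e - 1) / 2 * a + 1/2 * b) =
          ?l * (?c * ((e + 1) / 2 * a + 1/2 * b)) + (e + 1) / 2 * b" for a b
        by (simp only: distrib_left mult.assoc)
      show ?thesis
        unfolding mult_mat_vec[OF carr(1) y] mult_mat_vec[OF carr(2) y]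
          chain_images[OF y x V(2)] eigen_images(1)[OF x V(1)]
        using carr c[OF x] c[OF y] scal
        by (intro eq_vecI) (auto simp del: index_mult_mat_vec)
    qed
    ultimately show False using simple[OF x cy x0 cy0 l] by blast
  qed
  show False if x: "x \<in> carrier_vec n" and y: "y \<in> carrier_vec n" and z: "z \<in> carrier_vec n" and x0: "x \<noteq> 0\<^sub>v n"
    and e: "e = 1 \<or> e = - 1"
    and V: "V *\<^sub>v x = e \<cdot>\<^sub>v x" "V *\<^sub>v y = e \<cdot>\<^sub>v y + x" "V *\<^sub>v z = e \<cdot>\<^sub>v z + y" for x y z e
  proof -
    note cx = c[OF x] and cy = c[OF y] and cz = c[OF z]
    have ee: "e * e = 1" using e by auto
    \<comment> \<open>The coefficients solve the chain relations for \<open>e = 1\<close> and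
      \<open>e = -1\<close> simultaneously; the term in \<open>y\<close> inside \<open>?z\<close> is
      the second-order correction of the Cayley map.\<close>
    let ?y = "(2 * e) \<cdot>\<^sub>v y" and ?z = "(2 * e) \<cdot>\<^sub>v y + 4 \<cdot>\<^sub>v z"
    have cc: "?y \<in> carrier_vec n" "?z \<in> carrier_vec n" using y z by auto
    have y0: "y \<noteq> 0\<^sub>v n"
    proof
      assume "y = 0\<^sub>v n"
      then have "V *\<^sub>v y = 0\<^sub>v n" "e \<cdot>\<^sub>v y = 0\<^sub>v n" using carr by auto
      then show False using V(2) x0 x by simp
    qed
    have e0: "e \<noteq> 0" using e by auto
    have y0': "?y \<noteq> 0\<^sub>v n" using y y0 e0 by (auto simp: vec_eq_iff)
    \<comment> \<open>Applying \<open>V - e\<close> twice to \<open>?z\<close> gives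
      \<open>4 x\<close>, which is not zero.\<close>
    have z0: "?z \<noteq> 0\<^sub>v n"
    proof
      assume z0: "?z = 0\<^sub>v n"
      have Vz: "V *\<^sub>v ?z = (2 * e) \<cdot>\<^sub>v (V *\<^sub>v y) + 4 \<cdot>\<^sub>v (V *\<^sub>v z)"
        using carr y z by (simp add: mult_add_distrib_mat_vec[of V n n] mult_mat_vec[of V n n])
      have "0\<^sub>v n = V *\<^sub>v ?z - e \<cdot>\<^sub>v ?z" using z0 carr by auto
      also have "\<dots> = (2 * e) \<cdot>\<^sub>v x + 4 \<cdot>\<^sub>v y"
        unfolding Vz V using x y z by (intro eq_vecI) (auto simp: algebra_simps)
      finally have 1: "(2 * e) \<cdot>\<^sub>v x + 4 \<cdot>\<^sub>v y = 0\<^sub>v n" by simp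
      have Vy: "V *\<^sub>v ((2 * e) \<cdot>\<^sub>v x + 4 \<cdot>\<^sub>v y) = (2 * e) \<cdot>\<^sub>v (V *\<^sub>v x) + 4 \<cdot>\<^sub>v (V *\<^sub>v y)"
        using carr x y by (simp add: mult_add_distrib_mat_vec[of V n n] mult_mat_vec[of V n n])
      have "0\<^sub>v n = V *\<^sub>v ((2 * e) \<cdot>\<^sub>v x + 4 \<cdot>\<^sub>v y) - e \<cdot>\<^sub>v ((2 * e) \<cdot>\<^sub>v x + 4 \<cdot>\<^sub>v y)" using 1 carr by auto
      also have "\<dots> = 4 \<cdot>\<^sub>v x"
        unfolding Vy V using x y by (intro eq_vecI) (auto simp: algebra_simps)
      finally show False using x x0 by (auto simp: vec_eq_iff)
    qed
    have lin: "M *\<^sub>v ?y = (2 * e) \<cdot>\<^sub>v (M *\<^sub>v y)" "M *\<^sub>v ?z = (2 * e) \<cdot>\<^sub>v (M *\<^sub>v y) + 4 \<cdot>\<^sub>v (M *\<^sub>v z)"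
      if "M \<in> carrier_mat n n" for M
      using that y z by (auto simp: mult_add_distrib_mat_vec[of M n n] mult_mat_vec[of M n n])
    note im = eigen_images[OF x V(1)] chain_images[OF y x V(2)] chain_images[OF z y V(3)]
    from e show False
    proof
      assume e: "e = 1"
      show False
      proof (rule at_zero[OF x cc x0 y0' z0])
        show "A *\<^sub>v x = 0\<^sub>v n" unfolding im using carr e cx by (auto intro!: eq_vecI)
        show "A *\<^sub>v ?y = E *\<^sub>v x"
          unfolding lin[OF carr(2)] im using carr e cx cy
          by (intro eq_vecI) (auto simp del: index_mult_mat_vec)
        show "A *\<^sub>v ?z = E *\<^sub>v ?y"
          unfolding lin[OF carr(2)] lin[OF carr(1)] im using carr e cx cy cz
          by (intro eq_vecI) (auto simp del: index_mult_mat_vec)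
      qed
    next
      assume e: "e = - 1"
      show False
      proof (rule at_infinity[OF x cc x0 y0' z0])
        show "E *\<^sub>v x = 0\<^sub>v n" unfolding im using carr e cx by (auto intro!: eq_vecI)
        show "E *\<^sub>v ?y = A *\<^sub>v x"
          unfolding lin[OF carr(1)] im using carr e cx cy
          by (intro eq_vecI) (auto simp del: index_mult_mat_vec)
        show "E *\<^sub>v ?z = A *\<^sub>v ?y"
          unfolding lin[OF carr(2)] lin[OF carr(1)] im using carr e cx cy cz
          by (intro eq_vecI) (auto simp del: index_mult_mat_vec)
      qed
    qed
  qed
qed

end

section \<open>Assembly of \<open>Q\<close> from the Cayley transform\<close>

lemma cayley_mult:
  fixes E A W V :: "'a :: field_char_0 mat"
  assumes E: "E \<in> carrier_mat n n" and A: "A \<in> carrier_mat n n" and V: "V \<in> carrier_mat n n"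
    and W: "W = E - A" and WV: "W * V = E + A" and y: "y \<in> carrier_vec n"
  shows "E *\<^sub>v y = (1/2) \<cdot>\<^sub>v (W *\<^sub>v (V *\<^sub>v y + y))" "A *\<^sub>v y = (1/2) \<cdot>\<^sub>v (W *\<^sub>v (V *\<^sub>v y - y))"
proof -
  have Wc: "W \<in> carrier_mat n n" using A W by simp
  have Ey: "E *\<^sub>v y \<in> carrier_vec n" and Ay: "A *\<^sub>v y \<in> carrier_vec n" using E A y by auto
  have WVy: "W *\<^sub>v (V *\<^sub>v y) = E *\<^sub>v y + A *\<^sub>v y"
    using assoc_mult_mat_vec[OF Wc V y] WV E A y by (simp add: add_mult_distrib_mat_vec[of _ n n])
  have Wy: "W *\<^sub>v y = E *\<^sub>v y - A *\<^sub>v y"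
    unfolding W using E A y by (simp add: minus_mult_distrib_mat_vec[of _ n n])
  have "W *\<^sub>v (V *\<^sub>v y + y) = (E *\<^sub>v y + A *\<^sub>v y) + (E *\<^sub>v y - A *\<^sub>v y)"
    "W *\<^sub>v (V *\<^sub>v y - y) = (E *\<^sub>v y + A *\<^sub>v y) - (E *\<^sub>v y - A *\<^sub>v y)"
    using Wc V y unfolding WVy[symmetric] Wy[symmetric]
    by (simp_all add: mult_add_distrib_mat_vec[of _ n n] mult_minus_distrib_mat_vec[of _ n n])
  then show "E *\<^sub>v y = (1/2) \<cdot>\<^sub>v (W *\<^sub>v (V *\<^sub>v y + y))" "A *\<^sub>v y = (1/2) \<cdot>\<^sub>v (W *\<^sub>v (V *\<^sub>v y - y))"
    using E A Ey Ay by (auto intro!: eq_vecI simp del: index_mult_mat_vec)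
qed

lemma dissipative_Hamiltonian_if_spectrum:
  assumes E: "E \<in> carrier_mat n n" and A: "A \<in> carrier_mat n n"
    and stable: "\<And>l. pencil_eigenvalue n E A l \<Longrightarrow> Re l \<le> 0"
    and imaginary: "\<And>l. pencil_eigenvalue n E A l \<Longrightarrow> l \<noteq> 0 \<Longrightarrow> Re l = 0 \<Longrightarrow> semisimple_at n E A l"
    and index: "pencil_index n E A \<le> 2" "pencil_index n A E \<le> 2"
  shows "dissipative_Hamiltonian n E A"
proof -
  let ?E = "complex_mat E" and ?A = "complex_mat A"
  define W where "W = E - A"
  have W: "W \<in> carrier_mat n n" using A by (simp add: W_def)
  \<comment> \<open>A null vector of \<open>W\<close> would be an eigenvector of the pencil at 1,
    which has positive real part.\<close>
  have "det W \<noteq> 0"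
  proof
    assume "det W = 0"
    then obtain x where x: "x \<in> carrier_vec n" "x \<noteq> 0\<^sub>v n" "W *\<^sub>v x = 0\<^sub>v n"
      using det_0_iff_vec_prod_zero_field[OF W] by blast
    have "A *\<^sub>v x = E *\<^sub>v x"
      using x E A vec_minus_eq_0_iff[of "E *\<^sub>v x" n "A *\<^sub>v x"]
      by (simp add: W_def minus_mult_distrib_mat_vec[of _ n n])
    then have "?A *\<^sub>v complex_vec x = 1 \<cdot>\<^sub>v (?E *\<^sub>v complex_vec x)"
      using complex_mat_mult_vec[OF E x(1)] complex_mat_mult_vec[OF A x(1)] by simp
    then have "pencil_eigenvalue n E A 1"
      unfolding pencil_eigenvalue_iff[OF E A] using x complex_vec_simps(4)[of x n]
      by (intro bexI[of _ "complex_vec x"]) auto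
    then show False using stable[of 1] by simp
  qed
  then obtain G where G: "G \<in> carrier_mat n n" "G * W = 1\<^sub>m n" "W * G = 1\<^sub>m n"
    using det_non_zero_imp_unit[OF W, of "()"] by (auto simp: Units_def ring_mat_def)
  define V where "V = G * (E + A)"
  have V: "V \<in> carrier_mat n n" using G E A by (simp add: V_def)
  have "W * V = (W * G) * (E + A)" unfolding V_def using W G E A by (intro assoc_mult_mat[symmetric]) auto
  then have WV: "W * V = E + A" using G E A by simp
  have GW: "G *\<^sub>v (W *\<^sub>v x) = x" if "x \<in> carrier_vec n" for x
    using assoc_mult_mat_vec[OF G(1) W that] G(2) that by simp
  note real_cayley = cayley_mult[OF E A V W_def WV]
  interpret cayley_transform n ?E ?A "complex_mat W" "complex_mat V"
  proof
    show "?E \<in> carrier_mat n n" "?A \<in> carrier_mat n n" "complex_mat W \<in> carrier_mat n n"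
      "complex_mat V \<in> carrier_mat n n" using E A W V by auto
    fix y :: "complex vec" assume y: "y \<in> carrier_vec n"
    have cW: "complex_mat W = ?E - ?A" unfolding W_def by (rule complex_mat_hom(2)[OF E A])
    have cWV: "complex_mat W * complex_mat V = ?E + ?A"
      using complex_mat_hom(1)[OF W V] complex_mat_hom(3)[OF E A] WV by simp
    show "?E *\<^sub>v y = (1/2) \<cdot>\<^sub>v (complex_mat W *\<^sub>v (complex_mat V *\<^sub>v y + y))"
      "?A *\<^sub>v y = (1/2) \<cdot>\<^sub>v (complex_mat W *\<^sub>v (complex_mat V *\<^sub>v y - y))"
      using cayley_mult[OF _ _ _ cW cWV y] E A V by auto
    assume "complex_mat W *\<^sub>v y = 0\<^sub>v n"
    then have W0: "W *\<^sub>v Re_vec y = 0\<^sub>v n" "W *\<^sub>v Im_vec y = 0\<^sub>v n"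
      using Re_Im_vec_mult[OF W y] vec_eq_0_iff_Re_Im[of "complex_mat W *\<^sub>v y" n] by auto
    have "G *\<^sub>v 0\<^sub>v n = 0\<^sub>v n" using G(1) by auto
    then show "y = 0\<^sub>v n" using GW[of "Re_vec y"] GW[of "Im_vec y"] W0 y vec_eq_0_iff_Re_Im[OF y] by simp
  qed
  have "\<exists>es. cayley_spectrum n (complex_mat V) es"
  proof (rule exists_spectrum)
    show "Re l \<le> 0" if "x \<in> carrier_vec n" "x \<noteq> 0\<^sub>v n" "?A *\<^sub>v x = l \<cdot>\<^sub>v (?E *\<^sub>v x)" for x l
      using stable[of l] that unfolding pencil_eigenvalue_iff[OF E A] by blast
    show False if x: "x \<in> carrier_vec n" and y: "y \<in> carrier_vec n" "x \<noteq> 0\<^sub>v n" "y \<noteq> 0\<^sub>v n"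
      "l \<noteq> 0" "Re l = 0" and ch: "?A *\<^sub>v x = l \<cdot>\<^sub>v (?E *\<^sub>v x)" "?A *\<^sub>v y = l \<cdot>\<^sub>v (?E *\<^sub>v y) + ?E *\<^sub>v x" for x y l
    proof -
      have "pencil_eigenvalue n E A l" unfolding pencil_eigenvalue_iff[OF E A] using x y ch by blast
      then have "semisimple_at n E A l" using imaginary y by blast
      then show False unfolding semisimple_at_iff[OF E A] using x y ch by blast
    qed
    show False if "x \<in> carrier_vec n" "y \<in> carrier_vec n" "z \<in> carrier_vec n"
      "x \<noteq> 0\<^sub>v n" "y \<noteq> 0\<^sub>v n" "z \<noteq> 0\<^sub>v n" "?E *\<^sub>v x = 0\<^sub>v n" "?E *\<^sub>v y = ?A *\<^sub>v x" "?E *\<^sub>v z = ?A *\<^sub>v y" for x y z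
      using index(1) that unfolding pencil_index_le_2_iff by blast
    show False if "x \<in> carrier_vec n" "y \<in> carrier_vec n" "z \<in> carrier_vec n"
      "x \<noteq> 0\<^sub>v n" "y \<noteq> 0\<^sub>v n" "z \<noteq> 0\<^sub>v n" "?A *\<^sub>v x = 0\<^sub>v n" "?A *\<^sub>v y = ?E *\<^sub>v x" "?A *\<^sub>v z = ?E *\<^sub>v y" for x y z
      using index(2) that unfolding pencil_index_le_2_iff by blast
  qed
  then obtain es where spec: "cayley_spectrum n (complex_mat V) es" by blast
  obtain X where psd: "real_psd n X"
    and decay: "\<And>x. x \<in> carrier_vec n \<Longrightarrow> (V *\<^sub>v x) \<bullet> (X *\<^sub>v (V *\<^sub>v x)) \<le> x \<bullet> (X *\<^sub>v x)"
    and X0: "\<And>x e. x \<in> carrier_vec n \<Longrightarrow> x \<bullet> (X *\<^sub>v x) = 0 \<Longrightarrow> e \<in> set es - {- 1} \<Longrightarrow>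
      \<exists>fs. e \<notin> set fs \<and> shifts (complex_mat V) fs (complex_vec (V *\<^sub>v x - x)) = 0\<^sub>v n"
    using exists_real_lyapunov_matrix[OF V spec] by blast
  obtain u where u: "u \<in> carrier_mat n n"
    and u_prop: "\<And>x. x \<in> carrier_vec n \<Longrightarrow> u *\<^sub>v (V *\<^sub>v x) = V *\<^sub>v (u *\<^sub>v x)"
      "\<And>x. x \<in> carrier_vec n \<Longrightarrow>
        V *\<^sub>v (V *\<^sub>v (u *\<^sub>v x) + u *\<^sub>v x) + (V *\<^sub>v (u *\<^sub>v x) + u *\<^sub>v x) = 0\<^sub>v n"
    and u0: "\<And>x. x \<in> carrier_vec n \<Longrightarrow> u *\<^sub>v x = 0\<^sub>v n \<Longrightarrow>
      \<exists>fs. - 1 \<notin> set fs \<and> shifts (complex_mat V) fs (complex_vec x) = 0\<^sub>v n"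
    using exists_real_nilpotent_projection[OF V spec] by blast
  obtain Y where Y: "Y \<in> carrier_mat n n"
    and Ysym: "\<And>x y. x \<in> carrier_vec n \<Longrightarrow> y \<in> carrier_vec n \<Longrightarrow>
      (Y *\<^sub>v x) \<bullet> (V *\<^sub>v y + y) = (V *\<^sub>v x + x) \<bullet> (Y *\<^sub>v y)"
    and Yprop: "\<And>x. x \<in> carrier_vec n \<Longrightarrow> (Y *\<^sub>v x) \<bullet> (V *\<^sub>v x + x) \<ge> 0"
      "\<And>x. x \<in> carrier_vec n \<Longrightarrow> (Y *\<^sub>v x) \<bullet> (V *\<^sub>v x - x) \<le> 0"
      "\<And>x. x \<in> carrier_vec n \<Longrightarrow> Y *\<^sub>v x = 0\<^sub>v n \<Longrightarrow> u *\<^sub>v x = 0\<^sub>v n"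
    using exists_nilpotent_part[OF V u u_prop] by blast
  have X: "X \<in> carrier_mat n n" and Xnn: "\<And>x. x \<in> carrier_vec n \<Longrightarrow> 0 \<le> x \<bullet> (X *\<^sub>v x)"
    using psd by (auto simp: real_psd_def)
  define m where "m x = V *\<^sub>v x + x" for x
  define d where "d x = V *\<^sub>v x - x" for x
  define Q' where "Q' = X * (V + 1\<^sub>m n) + Y"
  \<comment> \<open>The factor \<open>G\<^sup>T\<close> cancels \<open>W\<close>: pairing
    \<open>Q x\<close> with \<open>W y\<close> is pairing \<open>Q' x\<close> with \<open>y\<close>,
    so only \<open>V + 1\<close> and \<open>V - 1\<close> remain of \<open>E\<close> and
    \<open>A\<close>.\<close>
  define Q where "Q = G\<^sup>T * Q'"
  have Q': "Q' \<in> carrier_mat n n"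
    unfolding Q'_def using X V Y by (intro add_carrier_mat)
  have Q: "Q \<in> carrier_mat n n" unfolding Q_def using G Q' by (intro mult_carrier_mat) auto
  have c [simp]: "V *\<^sub>v x \<in> carrier_vec n" "m x \<in> carrier_vec n" "d x \<in> carrier_vec n"
    "X *\<^sub>v x \<in> carrier_vec n" "Y *\<^sub>v x \<in> carrier_vec n" "Q' *\<^sub>v x \<in> carrier_vec n" "W *\<^sub>v x \<in> carrier_vec n"
    if "x \<in> carrier_vec n" for x
    using that V X Y Q' W by (auto simp: m_def d_def)
  have Q'mul: "Q' *\<^sub>v x = X *\<^sub>v m x + Y *\<^sub>v x" if "x \<in> carrier_vec n" for x
  proof -
    have "(X * (V + 1\<^sub>m n)) *\<^sub>v x = X *\<^sub>v ((V + 1\<^sub>m n) *\<^sub>v x)"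
      using X V that by (intro assoc_mult_mat_vec[of _ n n _ n]) auto
    moreover have "(V + 1\<^sub>m n) *\<^sub>v x = m x"
      unfolding m_def using V that by (simp add: add_mult_distrib_mat_vec[of _ n n])
    moreover have "X * (V + 1\<^sub>m n) \<in> carrier_mat n n" using X V by (intro mult_carrier_mat) auto
    ultimately show ?thesis unfolding Q'_def using Y that by (simp add: add_mult_distrib_mat_vec[of _ n n])
  qed
  have Qmul: "Q *\<^sub>v x = G\<^sup>T *\<^sub>v (Q' *\<^sub>v x)" if "x \<in> carrier_vec n" for x
    unfolding Q_def using G Q' that by (intro assoc_mult_mat_vec[of _ n n _ n]) auto
  have form: "(Q *\<^sub>v x) \<bullet> ((1/2) \<cdot>\<^sub>v (W *\<^sub>v y)) = (1/2) * ((Q' *\<^sub>v x) \<bullet> y)"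
    if x: "x \<in> carrier_vec n" and y: "y \<in> carrier_vec n" for x y
  proof -
    have "(G\<^sup>T *\<^sub>v (Q' *\<^sub>v x)) \<bullet> (W *\<^sub>v y) = (Q' *\<^sub>v x) \<bullet> (G *\<^sub>v (W *\<^sub>v y))"
      using x y by (intro transpose_vec_mult_scalar[OF G(1)]) auto
    then have "(Q *\<^sub>v x) \<bullet> (W *\<^sub>v y) = (Q' *\<^sub>v x) \<bullet> y" using GW[OF y] Qmul[OF x] by simp
    then show ?thesis
      using Q x y by (simp add: scalar_prod_smult_distrib[of _ n])
  qed
  have Eform: "(Q *\<^sub>v x) \<bullet> (E *\<^sub>v y) = (1/2) * ((X *\<^sub>v m x) \<bullet> m y + (Y *\<^sub>v x) \<bullet> m y)"
    if x: "x \<in> carrier_vec n" and y: "y \<in> carrier_vec n" for x y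
    unfolding real_cayley(1)[OF y] m_def[symmetric] form[OF x c(2)[OF y]] Q'mul[OF x]
    using x y by (simp add: add_scalar_prod_distrib[of _ n])
  have Xform: "(X *\<^sub>v a) \<bullet> b = a \<bullet> (X *\<^sub>v b)" if "a \<in> carrier_vec n" "b \<in> carrier_vec n" for a b
    using real_psd_sym[OF psd that(2,1)] comm_scalar_prod[of b n "X *\<^sub>v a"] that by simp
  have Xd: "(X *\<^sub>v m x) \<bullet> d x = (V *\<^sub>v x) \<bullet> (X *\<^sub>v (V *\<^sub>v x)) - x \<bullet> (X *\<^sub>v x)" if x: "x \<in> carrier_vec n" for x
  proof -
    have "X *\<^sub>v m x = X *\<^sub>v (V *\<^sub>v x) + X *\<^sub>v x"
      unfolding m_def using X x by (simp add: mult_add_distrib_mat_vec[of _ n n])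
    then have "(X *\<^sub>v m x) \<bullet> d x = (X *\<^sub>v (V *\<^sub>v x)) \<bullet> (V *\<^sub>v x) - (X *\<^sub>v (V *\<^sub>v x)) \<bullet> x
        + (X *\<^sub>v x) \<bullet> (V *\<^sub>v x) - (X *\<^sub>v x) \<bullet> x"
      unfolding d_def using x
      by (simp add: add_scalar_prod_distrib[of _ n] scalar_prod_minus_distrib[of _ n])
    moreover have "(X *\<^sub>v (V *\<^sub>v x)) \<bullet> x = (X *\<^sub>v x) \<bullet> (V *\<^sub>v x)"
      using x Xform[of "V *\<^sub>v x" x] comm_scalar_prod[of "V *\<^sub>v x" n "X *\<^sub>v x"] by simp
    ultimately show ?thesis using x Xform[of "V *\<^sub>v x" "V *\<^sub>v x"] Xform[of x x] by simp
  qed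
  have Aform: "(Q *\<^sub>v x) \<bullet> (A *\<^sub>v x) = (1/2) * ((X *\<^sub>v m x) \<bullet> d x + (Y *\<^sub>v x) \<bullet> d x)"
    if x: "x \<in> carrier_vec n" for x
    unfolding real_cayley(2)[OF x] d_def[symmetric] form[OF x c(3)[OF x]] Q'mul[OF x]
    using x by (simp add: add_scalar_prod_distrib[of _ n])
  have Xm: "(X *\<^sub>v m x) \<bullet> m x \<ge> 0" if "x \<in> carrier_vec n" for x
    using Xnn[of "m x"] Xform[of "m x" "m x"] that by simp
  have Ynn: "(Y *\<^sub>v x) \<bullet> m x \<ge> 0" "(Y *\<^sub>v x) \<bullet> d x \<le> 0" if "x \<in> carrier_vec n" for x
    using Yprop(1,2)[OF that] by (auto simp: m_def d_def)
  show ?thesis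
  proof (rule dissipative_HamiltonianI[OF E A Q])
    fix x :: "real vec" assume x: "x \<in> carrier_vec n"
    show "(Q *\<^sub>v x) \<bullet> (E *\<^sub>v x) \<ge> 0"
      unfolding Eform[OF x x] using Xm[OF x] Ynn(1)[OF x] by simp
    show "(Q *\<^sub>v x) \<bullet> (A *\<^sub>v x) \<le> 0"
      unfolding Aform[OF x] Xd[OF x] using decay[OF x] Ynn(2)[OF x] by simp
    show "(Q *\<^sub>v x) \<bullet> (E *\<^sub>v y) = (E *\<^sub>v x) \<bullet> (Q *\<^sub>v y)" if y: "y \<in> carrier_vec n" for y
    proof -
      have "(E *\<^sub>v x) \<bullet> (Q *\<^sub>v y) = (Q *\<^sub>v y) \<bullet> (E *\<^sub>v x)"
        using E Q x y by (intro comm_scalar_prod[of _ n]) auto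
      also have "\<dots> = (1/2) * ((X *\<^sub>v m y) \<bullet> m x + (Y *\<^sub>v y) \<bullet> m x)" by (rule Eform[OF y x])
      also have "(X *\<^sub>v m y) \<bullet> m x = (X *\<^sub>v m x) \<bullet> m y"
        using Xform[of "m y" "m x"] comm_scalar_prod[of "m y" n "X *\<^sub>v m x"] x y by simp
      also have "(Y *\<^sub>v y) \<bullet> m x = (Y *\<^sub>v x) \<bullet> m y"
        using Ysym[OF x y] comm_scalar_prod[of "m x" n "Y *\<^sub>v y"] x y by (simp add: m_def)
      finally show ?thesis using Eform[OF x y] by simp
    qed
    assume Q0: "Q *\<^sub>v x = 0\<^sub>v n"
    \<comment> \<open>Both summands of the energy are nonnegative, so both vanish. Semidefiniteness
      then gives \<open>X (V + 1) x = 0\<close>, and what is left of \<open>Q' x = 0\<close> is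
      \<open>Y x = 0\<close>.\<close>
    have E0: "(X *\<^sub>v m x) \<bullet> m x + (Y *\<^sub>v x) \<bullet> m x = 0"
      using Eform[OF x x] Q0 E x by simp
    then have q0: "m x \<bullet> (X *\<^sub>v m x) = 0"
      using Xm[OF x] Ynn(1)[OF x] Xform[of "m x" "m x"] x by simp
    have "X *\<^sub>v m x = 0\<^sub>v n" by (rule real_psd_null[OF psd _ q0]) (use x in simp)
    moreover have "Q' *\<^sub>v x = 0\<^sub>v n"
    proof -
      have "W\<^sup>T * G\<^sup>T = 1\<^sub>m n" using transpose_mult[OF G(1) W] G(2) by simp
      then have "Q' *\<^sub>v x = W\<^sup>T *\<^sub>v (G\<^sup>T *\<^sub>v (Q' *\<^sub>v x))"
        using assoc_mult_mat_vec[of "W\<^sup>T" n n "G\<^sup>T" n "Q' *\<^sub>v x"] W G(1) x by simp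
      also have "\<dots> = 0\<^sub>v n" using Q0 Qmul[OF x] W by auto
      finally show ?thesis .
    qed
    ultimately have "Y *\<^sub>v x = 0\<^sub>v n" using Q'mul[OF x] x by simp
    then have ux: "u *\<^sub>v x = 0\<^sub>v n" using Yprop(3)[OF x] by simp
    interpret S: cayley_spectrum n "complex_mat V" es by (rule spec)
    have cx: "complex_vec x \<in> carrier_vec n" and cd: "complex_vec (d x) \<in> carrier_vec n" using x by auto
    \<comment> \<open>Since \<open>A x\<close> is half of \<open>W d x\<close>, it suffices that
      \<open>d x\<close> has no component at any root: \<open>u x = 0\<close> handles -1, and the
      vanishing of the form of \<open>X\<close> at \<open>m x\<close> handles all others.\<close>
    have "complex_vec (d x) = 0\<^sub>v n"
    proof (rule S.eq_0_if_coprime_annihilators[OF cd])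
      fix e assume e: "e \<in> set es"
      show "\<exists>fs. e \<notin> set fs \<and> shifts (complex_mat V) fs (complex_vec (d x)) = 0\<^sub>v n"
      proof (cases "e = - 1")
        case True
        obtain fs where fs: "- 1 \<notin> set fs" "shifts (complex_mat V) fs (complex_vec x) = 0\<^sub>v n"
          using u0[OF x ux] by blast
        have "complex_vec (d x) = complex_mat V *\<^sub>v complex_vec x - 1 \<cdot>\<^sub>v complex_vec x"
          unfolding d_def using complex_mat_mult_vec[OF V x] complex_vec_simps(2)[of "V *\<^sub>v x" n x] x by simp
        then have "shifts (complex_mat V) fs (complex_vec (d x)) = 0\<^sub>v n"
          using shifts_shift[OF S.V cx, of fs 1] fs(2) S.V by auto
        then show ?thesis using fs(1) True by blast
      next
        case False
        obtain fs where fs: "e \<notin> set fs" "shifts (complex_mat V) fs (complex_vec (V *\<^sub>v m x - m x)) = 0\<^sub>v n"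
          using X0[of "m x" e] q0 e False x by auto
        \<comment> \<open>The form speaks about \<open>(V - 1) (V + 1) x\<close>, which is
          \<open>V + 1\<close> applied to \<open>d x\<close>. The additional root -1 is allowed in
          the annihilating list because \<open>e \<noteq> -1\<close>.\<close>
        have "V *\<^sub>v m x - m x = V *\<^sub>v d x + d x"
          unfolding m_def d_def using V x
          by (simp add: mult_add_distrib_mat_vec[of V n n] mult_minus_distrib_mat_vec[of V n n])
            (auto intro!: eq_vecI simp del: index_mult_mat_vec)
        then have "complex_vec (V *\<^sub>v m x - m x) = complex_mat V *\<^sub>v complex_vec (d x) + complex_vec (d x)"
          using complex_mat_mult_vec[OF V, of "d x"] complex_vec_simps(1)[of "V *\<^sub>v d x" n "d x"] x by simp
        also have "\<dots> = complex_mat V *\<^sub>v complex_vec (d x) - (- 1) \<cdot>\<^sub>v complex_vec (d x)"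
          using V cd by (intro eq_vecI) auto
        finally have "shifts (complex_mat V) ((- 1) # fs) (complex_vec (d x)) = 0\<^sub>v n"
          using fs(2) by simp
        then show ?thesis using fs(1) False by (intro exI[of _ "- 1 # fs"]) auto
      qed
    qed
    then have "d x = 0\<^sub>v n" by (simp add: complex_vec_simps)
    then have "A *\<^sub>v x = (1/2) \<cdot>\<^sub>v (W *\<^sub>v 0\<^sub>v n)" using real_cayley(2)[OF x] by (simp add: d_def)
    also have "\<dots> = 0\<^sub>v n" using W by auto
    finally show "A *\<^sub>v x = 0\<^sub>v n" .
  qed
qed

theorem theoremB7:
  fixes n :: nat and E A :: "real mat"
  assumes E: "E \<in> carrier_mat n n" and A: "A \<in> carrier_mat n n"
    and regular: "regular_pencil E A"
  shows "dissipative_Hamiltonian n E A \<longleftrightarrow>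
    (\<forall>lam. pencil_eigenvalue n E A lam \<longrightarrow> Re lam \<le> 0) \<and>
    (\<forall>lam. pencil_eigenvalue n E A lam \<and> lam \<noteq> 0 \<and> Re lam = 0 \<longrightarrow> semisimple_at n E A lam) \<and>
    pencil_index n E A \<le> 2 \<and>
    pencil_index n A E \<le> 2"
  using dissipative_Hamiltonian_spectrum[OF E A regular] dissipative_Hamiltonian_if_spectrum[OF E A]
  by blast

end
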